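(* There exists a pair $(U',\varphi_{U'})$ satisfying the following conditions. (i) $U'\subset M'$ is a direct factor of the $S'$-module $M'$, free of rank $1$, satisfying $\nabla_q(U')\subset U'\otimes_{S'}q\Omega_{S'/R}$. Let $\rho_{U'}$ denote the $\rho$-semilinear continuous action of $\Gamma$ on $U'$ associated to $\nabla_q|_{U'}$. (ii) $\varphi_{U'}$ is a $\varphi$-semilinear endomorphism of $U'$ and $S'\cdot\varphi_{U'}(U')=U'$. (iii) The triple $(U',\varphi_{U'},\rho_{U'})$ is an object of $\mathrm{MF}^{[p]_q,q-1}_{[0,0]}(S',\varphi,\Gamma)$, i.e. $\rho_{U'}(\gamma)\circ\varphi_{U'}=\varphi_{U'}\circ\rho_{U'}(\gamma)$. (iv) The isomorphism $M'\otimes_{S'}B'\cong H_{B'}$ (sending $e_1'\mapsto\omega$, $e_2\mapsto-\lambda(1-\lambda)D(\omega)$) induces a $B'$-linear isomorphism $U'\otimes_{S'}B'\xrightarrow{\cong}U_{B'}$, and the latter defines an isomorphism between $(U_{B'},\nabla,\varphi_{U_{B'}})$ and the image of $(U',\varphi_{U'},\rho_{U'})$ under the reduction functor $\mathrm{MF}^{[p]_q,q-1}_{[0,0]}(S',\varphi,\Gamma)\to\mathrm{MIC}_{[0,0]}(B',\varphi,\mathrm{Fil}^\bullet)$.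
   Context: Rings. $p$ is an odd prime, $q$ a formal variable, $R=\mathbb{Z}_p[[q-1]]$. For $a\in\mathbb{Q}\cap\mathbb{Z}_p$, $q^a=\sum_{i\ge0}\binom{a}{i}(q-1)^i\in R$ and $[a]_q=\frac{q^a-1}{q-1}=\sum_{i\ge1}\binom{a}{i}(q-1)^{i-1}\in R$. Let $h(\lambda)=\sum_{i=0}^{(p-1)/2}\binom{(p-1)/2}{i}^2\lambda^i$. $S'=R\langle\lambda,\frac1{h(\lambda)}\rangle$ is the $(p,q-1)$-adic completion of $R[\lambda,\frac1{h(\lambda)}]$, with the $(p,q-1)$-adic topology, and $B'=\mathbb{Z}_p\langle\lambda,\frac1{h(\lambda)}\rangle$ is the $p$-adic completion of $\mathbb{Z}_p[\lambda,\frac1{h(\lambda)}]$; $S'/(q-1)=B'$. $\varphi$ is the continuous ring endomorphism of $S'$ with $\varphi(a)=a$ ($a\in\mathbb{Z}_p$), $\varphi(q)=q^p$, $\varphi(\lambda)=\lambda^p$; it induces $\varphi$ on $B'$. $\Gamma\cong\mathbb{Z}$ is a group with generator $\gamma$ and discrete topology, acting on $S'$ by $R$-algebra automorphisms (action denoted $\rho$) continuously with $\gamma(\lambda)=q\lambda$. One has $(\gamma-1)(S')\subset(q-1)\lambda S'$, and $d_q:=\frac{\gamma-1}{(q-1)\lambda}$ on $S'$. $q$-connections. $q\Omega_{S'/R}$ is the free $S'$-module $S'\,d\log\lambda$, $d\lambda:=\lambda\,d\log\lambda$, and $\delta_q(x)=d_q(x)\,d\lambda$. For an $S'$-module $M$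 and $\ell\in S'\setminus\{0\}$, a $q$-connection $\nabla_q:M\to M\otimes_{S'}\frac1{\ell}q\Omega_{S'/R}$ is an $R$-linear map with $\nabla_q(am)=m\otimes\delta_q(a)+\gamma(a)\nabla_q(m)$. If $\nabla_q$ takes values in $M\otimes q\Omega_{S'/R}$, write $\nabla_q=D_q^{\log}\otimes d\log\lambda$; the associated $\rho$-semilinear action $\rho_M$ of $\Gamma$ on $M$ is the one in which $\gamma$ acts by $1+(q-1)D_q^{\log}$. The module $M'$. $M'=S'e_1'\oplus S'e_2$ is free of rank $2$, with $q$-connection $\nabla_q:M'\to M'\otimes_{S'}\frac1{1-\lambda}q\Omega_{S'/R}$ given by $$\nabla_q(e_1')=-\tfrac{1}{\lambda(1-\lambda)}e_2\otimes d\lambda,\qquad \nabla_q(e_2)=\Big(-[\tfrac12]_q^2\,e_1'+[\tfrac12]_q^2\tfrac{q-1}{1-\lambda}\,e_2\Big)\otimes d\lambda .$$ (Up to the change of basis $e_1'=\frac1{\lambda(1-\lambda)}e_1$, the condition $\nabla_q(f_1e_1+f_2e_2)=0$ is equivalent to $f_1=d_qf_2$ and $f_2$ satisfying the $q$-hypergeometric equation $q\lambda(1-q\lambda)d_q^2f+(1-(1+[2]_q-2[\frac12]_q)\lambda)d_qf-[\frac12]_q^2f=0$.) The classical objects. Let $T=\mathrm{Spec}(B')$ with the log structure defined by the divisor $\lambda(1-\lambda)=0$, and let $E'/T$ be the log smooth Legendre family $Y^2Z=X(X-Z)(X-\lambda Z)$. $H_{B'}=H^1_{\mathrm{dR}}(E'/T)$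 is its relative log de Rham cohomology, a free $B'$-module of rank $2$ with logarithmic Gauss–Manin connection $\nabla:H_{B'}\to H_{B'}\otimes_{B'} B'\frac{d\lambda}{\lambda(1-\lambda)}$. Put $\omega=dx/y$ and write $\nabla=D\otimes d\lambda$ (after inverting $\lambda(1-\lambda)$). Then $(\omega,\lambda(1-\lambda)D(\omega))$ is a basis of $H_{B'}$, and $D(-\lambda(1-\lambda)D(\omega))=-\frac14\omega$. The map $e_1'\mapsto\omega$, $e_2\mapsto-\lambda(1-\lambda)D(\omega)$ induces an isomorphism $M'\otimes_{S'}B'\cong H_{B'}$ compatible with connections. Let $f=\sum_{n\ge0}\Big(\prod_{i=0}^{n-1}\frac{i+1/2}{i+1}\Big)^2\lambda^n\in\mathbb{Z}_p[[\lambda]]$. It is known (Dwork) that $\frac{f}{\varphi(f)}\in B'^{\times}$ and $\frac1f\frac{df}{d\lambda}\in B'$. Put $\overline e_2'=\lambda(1-\lambda)\big(\frac1f\frac{df}{d\lambda}\omega-D(\omega)\big)$. The unit root part is $U_{B'}=B'\overline e_2'\subset H_{B'}$, with Frobenius $\varphi_{U_{B'}}(\overline e_2')=(-1)^{(p-1)/2}\frac{f}{\varphi(f)}\overline e_2'$ ($\varphi$-semilinear) and connection $\nabla(\overline e_2')=-\frac1f\frac{df}{d\lambda}\overline e_2'\otimes d\lambda$. Categories (for $a=0$, where filtrations carry no information). An object of $\mathrm{MF}^{[p]_q,q-1}_{[0,0]}(S',\varphi,\Gamma)$ is a free $S'$-module $M$ of finite type with a $\varphi$-semilinear endomorphism $\varphi_M$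 such that $S'\cdot\varphi_M(M)=M$, and a $\rho$-semilinear continuous action $\rho_M$ of $\Gamma$ on $M$ commuting with $\varphi_M$ such that $(\rho_M(\gamma)-1)(M)\subset(q-1)M$. An object of $\mathrm{MIC}_{[0,0]}(B',\varphi,\mathrm{Fil}^\bullet)$ is a free $B'$-module $N$ of finite type with a $\varphi$-semilinear endomorphism $\varphi_N$ such that $B'\cdot\varphi_N(N)=N$ and a connection $\nabla:N\to N\otimes_{B'}\Omega$, $\Omega=B'\,d\log\lambda$, with $\nabla\circ\varphi_N=(\varphi_N\otimes\varphi^1)\circ\nabla$, where $\varphi^1$ is $\varphi$-semilinear with $\varphi^1(d\log\lambda)=p\,d\log\lambda$. (A connection with values in $N\otimes B'd\lambda$ is regarded as one with values in $N\otimes B'd\log\lambda$ via $d\lambda=\lambda\,d\log\lambda$.) Morphisms are linear maps compatible with all structures. The reduction functor sends $(M,\varphi_M,\rho_M)$ to $M/(q-1)M$ with the induced Frobenius and the connection $\big(\frac{\rho_M(\gamma)-1}{q-1}\bmod q-1\big)\otimes d\log\lambda$ (it is an equivalence of categories). *)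

theory Defs
  imports
    "Berlekamp_Zassenhaus.Finite_Field"
    "HOL-Computational_Algebra.Formal_Power_Series"
    "HOL-Computational_Algebra.Fraction_Field"
    "HOL-Analysis.Product_Topology"
    "HOL-Analysis.Product_Vector"
begin

section \<open>The ring of \<open>p\<close>-adic integers\<close>

text \<open>The prime is \<open>p = CARD('p)\<close>.  A \<open>p\<close>-adic integer is an element of the inverse limit of
  the rings of integers modulo \<open>p ^ n\<close>, each component being given by its residue in
  \<open>{0..<p ^ n}\<close>.\<close>

typedef (overloaded) 'p zp =
  "{x :: nat \<Rightarrow> int. \<forall>n. x n \<in> {0..<int CARD('p::prime_card) ^ n}
      \<and> x (Suc n) mod int CARD('p) ^ n = x n}"
proof
  have "0 < CARD('p)"
    using prime_gt_0_nat[OF prime_card[where 'a='p]] .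
  then show "(\<lambda>_. 0) \<in> {x :: nat \<Rightarrow> int. \<forall>n. x n \<in> {0..<int CARD('p) ^ n}
      \<and> x (Suc n) mod int CARD('p) ^ n = x n}"
    by simp
qed

setup_lifting type_definition_zp

lemma prime_card_gt_0: "0 < int CARD('p::prime_card)"
  using prime_gt_0_nat[OF prime_card[where 'a='p]] by simp

lemma prime_card_gt_1: "1 < int CARD('p::prime_card)"
  using prime_gt_1_nat[OF prime_card[where 'a='p]] by simp

lemma mod_power_Suc_mod: "c mod b ^ Suc n mod b ^ n = c mod b ^ n" for b c :: int
  by (rule mod_mod_cancel) (simp add: le_imp_power_dvd)

lemma zp_compatible:
  fixes x y x' y' m :: int
  assumes "x' mod m = x" "y' mod m = y"
  shows zp_compatible_add: "(x' + y') mod m = (x + y) mod m"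
    and zp_compatible_mult: "(x' * y') mod m = (x * y) mod m"
  using assms by (metis mod_add_eq, metis mod_mult_eq)

lemma zp_compatible_minus: "x' mod m = x \<Longrightarrow> (- x') mod m = (- x) mod m" for x x' m :: int
  by (metis mod_minus_eq)

instantiation zp :: (prime_card) comm_ring_1
begin

lift_definition zero_zp :: "'a zp" is "\<lambda>_. 0"
  by (simp add: prime_card_gt_0)

lift_definition one_zp :: "'a zp" is "\<lambda>n. 1 mod int CARD('a) ^ n"
  by (auto simp: prime_card_gt_0 mod_power_Suc_mod simp del: power_Suc)

lift_definition plus_zp :: "'a zp \<Rightarrow> 'a zp \<Rightarrow> 'a zp"
  is "\<lambda>x y n. (x n + y n) mod int CARD('a) ^ n"
  by (auto simp: prime_card_gt_0 mod_power_Suc_mod intro!: zp_compatible_add simp del: power_Suc)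

lift_definition uminus_zp :: "'a zp \<Rightarrow> 'a zp" is "\<lambda>x n. (- x n) mod int CARD('a) ^ n"
  by (auto simp: prime_card_gt_0 mod_power_Suc_mod intro!: zp_compatible_minus simp del: power_Suc)

lift_definition times_zp :: "'a zp \<Rightarrow> 'a zp \<Rightarrow> 'a zp"
  is "\<lambda>x y n. (x n * y n) mod int CARD('a) ^ n"
  by (auto simp: prime_card_gt_0 mod_power_Suc_mod intro!: zp_compatible_mult simp del: power_Suc)

definition minus_zp :: "'a zp \<Rightarrow> 'a zp \<Rightarrow> 'a zp" where
  "minus_zp x y = x + - y"

instance
proof
  fix a b c :: "'a zp"
  show "a * b * c = a * (b * c)"
    by transfer (simp add: mod_mult_left_eq mod_mult_right_eq mult.assoc)
  show "a * b = b * a"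
    by transfer (simp add: mult.commute)
  show "1 * a = a"
    by transfer (simp add: mod_mult_left_eq)
  show "(a + b) * c = a * c + b * c"
    by transfer (simp add: mod_mult_left_eq mod_add_left_eq mod_add_right_eq distrib_right)
  show "a + b + c = a + (b + c)"
    by transfer (simp add: mod_add_left_eq mod_add_right_eq add.assoc)
  show "a + b = b + a"
    by transfer (simp add: add.commute)
  show "0 + a = a"
    by transfer simp
  show "- a + a = 0"
    by transfer (simp add: mod_add_left_eq)
  show "a - b = a + - b"
    by (simp add: minus_zp_def)
  show "(0::'a zp) \<noteq> 1"
  proof (transfer, rule notI)
    assume "(\<lambda>_. 0) = (\<lambda>n. 1 mod int CARD('a) ^ n)"
    then have "0 = 1 mod int CARD('a) ^ 1"
      by (rule fun_cong)
    then show False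
      using prime_card_gt_1[where 'p='a] by simp
  qed
qed

end

lemma of_nat_zp: "Rep_zp (of_nat m :: 'p::prime_card zp) n = int m mod int CARD('p) ^ n"
  by (induction m) (auto simp: zero_zp.rep_eq one_zp.rep_eq plus_zp.rep_eq mod_simps)

instance zp :: (prime_card) idom
proof
  fix x y :: "'a zp"
  assume "x \<noteq> 0" "y \<noteq> 0"
  let ?p = "int CARD('a)"
  have p: "prime ?p"
    using prime_card[where 'a='a] by simp
  have mono: "Rep_zp z k mod ?p ^ n = Rep_zp z n" if "n \<le> k" for z :: "'a zp" and n k
    using that
  proof (induction k rule: dec_induct)
    case base
    then show ?case using Rep_zp[of z] by simp
  next
    case (step k)
    have "Rep_zp z (Suc k) mod ?p ^ n = Rep_zp z (Suc k) mod ?p ^ k mod ?p ^ n"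
      using step by (simp add: mod_mod_cancel le_imp_power_dvd)
    also have "Rep_zp z (Suc k) mod ?p ^ k = Rep_zp z k"
      using Rep_zp[of z] by simp
    finally show ?case using step by simp
  qed
  obtain m where m: "Rep_zp x m \<noteq> 0"
    using \<open>x \<noteq> 0\<close> by (metis Rep_zp_inject ext zero_zp.rep_eq)
  obtain n where n: "Rep_zp y n \<noteq> 0"
    using \<open>y \<noteq> 0\<close> by (metis Rep_zp_inject ext zero_zp.rep_eq)
  have x: "\<not> ?p ^ m dvd Rep_zp x (m + n)"
    using m mono[of m "m + n" x] by (simp add: dvd_eq_mod_eq_0)
  have y: "\<not> ?p ^ n dvd Rep_zp y (m + n)"
    using n mono[of n "m + n" y] by (simp add: dvd_eq_mod_eq_0)
  have "\<not> ?p ^ (m + n) dvd Rep_zp x (m + n) * Rep_zp y (m + n)"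
  proof
    assume d: "?p ^ (m + n) dvd Rep_zp x (m + n) * Rep_zp y (m + n)"
    have nz: "Rep_zp x (m + n) \<noteq> 0" "Rep_zp y (m + n) \<noteq> 0"
      using x y by auto
    have pe: "prime_elem ?p" using p by simp
    have "m + n \<le> multiplicity ?p (Rep_zp x (m + n) * Rep_zp y (m + n))"
      using d nz p by (intro multiplicity_geI) auto
    also have "\<dots> = multiplicity ?p (Rep_zp x (m + n)) + multiplicity ?p (Rep_zp y (m + n))"
      using nz pe by (simp add: prime_elem_multiplicity_mult_distrib)
    finally have "m \<le> multiplicity ?p (Rep_zp x (m + n)) \<or> n \<le> multiplicity ?p (Rep_zp y (m + n))"
      by linarith
    then show False
      using x y by (meson multiplicity_dvd')
  qed
  then have "Rep_zp (x * y) (m + n) \<noteq> 0"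
    by (simp add: times_zp.rep_eq dvd_eq_mod_eq_0)
  then show "x * y \<noteq> 0"
    by (metis zero_zp.rep_eq)
qed


section \<open>Rings with finitely generated ideals of definition\<close>

lemma module_mult: "Modules.module ((*) :: 'a::comm_ring_1 \<Rightarrow> 'a \<Rightarrow> 'a)"
  by unfold_locales (simp_all add: algebra_simps)

class ideal_gens =
  fixes ideal_gens :: "'a set"

class adic_ring = comm_ring_1 + ideal_gens +
  assumes ex_proper_ideal: "\<exists>J. ideal_gens \<subseteq> J \<and> 0 \<in> J \<and> (\<forall>x\<in>J. \<forall>y\<in>J. x + y \<in> J)
    \<and> (\<forall>c. \<forall>x\<in>J. c * x \<in> J) \<and> 1 \<notin> J"

lemma ideal_proper: "(1 :: 'a::adic_ring) \<notin> Modules.module.span (*) ideal_gens"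
proof -
  obtain J :: "'a set" where J: "ideal_gens \<subseteq> J" "1 \<notin> J" "Modules.module.subspace (*) J"
    unfolding module.subspace_def[OF module_mult] using ex_proper_ideal by blast
  then show ?thesis
    using module.span_minimal[OF module_mult J(1,3)] by blast
qed

definition ideal_power :: "nat \<Rightarrow> 'a::{comm_ring_1,ideal_gens} set" where
  "ideal_power n =
    Modules.module.span (*) {prod_list gs | gs. length gs = n \<and> set gs \<subseteq> ideal_gens}"

lemma ideal_power_0 [simp]: "0 \<in> ideal_power n"
  unfolding ideal_power_def by (rule module.span_zero[OF module_mult])

lemma ideal_power_add: "x \<in> ideal_power n \<Longrightarrow> y \<in> ideal_power n \<Longrightarrow> x + y \<in> ideal_power n"
  unfolding ideal_power_def by (rule module.span_add[OF module_mult])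

lemma ideal_power_diff: "x \<in> ideal_power n \<Longrightarrow> y \<in> ideal_power n \<Longrightarrow> x - y \<in> ideal_power n"
  unfolding ideal_power_def by (rule module.span_diff[OF module_mult])

lemma ideal_power_mult: "x \<in> ideal_power n \<Longrightarrow> c * x \<in> ideal_power n"
  unfolding ideal_power_def by (rule module.span_scale[OF module_mult])

lemma ideal_power_minus: "x \<in> ideal_power n \<Longrightarrow> - x \<in> ideal_power n"
  using ideal_power_diff[of 0 n x] by simp

lemma ideal_power_1: "ideal_power (Suc 0) = Modules.module.span (*) ideal_gens"
proof -
  have "{prod_list gs | gs. length gs = Suc 0 \<and> set gs \<subseteq> ideal_gens} = (ideal_gens :: 'a set)"
    by (auto simp: length_Suc_conv intro!: exI[of _ "[_]"])
  then show ?thesis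
    by (simp add: ideal_power_def)
qed

lemma ideal_power_Suc_subset: "ideal_power (Suc n) \<subseteq> ideal_power n"
  unfolding ideal_power_def
proof (rule module.span_minimal[OF module_mult])
  show "{prod_list gs | gs. length gs = Suc n \<and> set gs \<subseteq> (ideal_gens :: 'a set)}
    \<subseteq> Modules.module.span (*) {prod_list gs | gs. length gs = n \<and> set gs \<subseteq> ideal_gens}"
    (is "_ \<subseteq> Modules.module.span (*) ?G")
  proof
    fix x :: 'a
    assume "x \<in> {prod_list gs | gs. length gs = Suc n \<and> set gs \<subseteq> ideal_gens}"
    then obtain g gs where "x = g * prod_list gs" "length gs = n" "set gs \<subseteq> ideal_gens"
      by (auto simp: length_Suc_conv)
    then have "prod_list gs \<in> ?G" "x = g * prod_list gs"
      by auto
    then show "x \<in> Modules.module.span (*) ?G"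
      by (simp add: module.span_scale[OF module_mult] module.span_base[OF module_mult])
  qed
qed (rule module.subspace_span[OF module_mult])

lemma ideal_power_antimono: "m \<le> n \<Longrightarrow> ideal_power n \<subseteq> ideal_power m"
  by (rule lift_Suc_antimono_le[of ideal_power, OF ideal_power_Suc_subset])

instantiation zp :: (prime_card) adic_ring
begin

definition ideal_gens_zp :: "'a zp set" where
  "ideal_gens_zp = {of_nat CARD('a)}"

instance
proof (standard, intro exI conjI)
  let ?J = "{k * of_nat CARD('a) | k :: 'a zp. True}"
  show "ideal_gens \<subseteq> ?J"
    by (auto simp: ideal_gens_zp_def intro!: exI[of _ 1])
  show "0 \<in> ?J"
    by (auto intro!: exI[of _ 0])
  show "\<forall>x\<in>?J. \<forall>y\<in>?J. x + y \<in> ?J"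
    by (auto simp flip: distrib_right)
  show "\<forall>c. \<forall>x\<in>?J. c * x \<in> ?J"
    by (auto simp flip: mult.assoc)
  show "1 \<notin> ?J"
  proof
    assume "1 \<in> ?J"
    then obtain k :: "'a zp" where k: "1 = k * of_nat CARD('a)"
      by blast
    have "Rep_zp (1::'a zp) 1 = Rep_zp (k * of_nat CARD('a)) 1"
      by (simp flip: k)
    then show False
      using prime_card_gt_1[where 'p='a]
      by (simp add: one_zp.rep_eq times_zp.rep_eq of_nat_zp)
  qed
qed

end

text \<open>On a power series ring over a ring with ideal of definition \<open>I\<close>, the ideal of definition
  is generated by \<open>I\<close> and the variable.\<close>

instantiation fps :: (adic_ring) adic_ring
begin

definition ideal_gens_fps :: "'a fps set" where
  "ideal_gens_fps = insert fps_X (fps_const ` ideal_gens)"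

instance
proof (standard, intro exI conjI)
  let ?I = "Modules.module.span (*) ideal_gens :: 'a set"
  let ?J = "{f :: 'a fps. fps_nth f 0 \<in> ?I}"
  note span = module.span_zero[OF module_mult] module.span_add[OF module_mult]
    module.span_scale[OF module_mult] module.span_base[OF module_mult]
  show "ideal_gens \<subseteq> ?J"
    by (auto simp: ideal_gens_fps_def span)
  show "0 \<in> ?J" "\<forall>x\<in>?J. \<forall>y\<in>?J. x + y \<in> ?J" "\<forall>c. \<forall>x\<in>?J. c * x \<in> ?J"
    by (auto simp: span)
  show "1 \<notin> ?J"
    using ideal_proper[where 'a='a] by simp
qed

end

section \<open>Adic completion\<close>

text \<open>The inverse limit of the quotients by the powers of the ideal of definition: an element is
  represented by a sequence whose \<open>n\<close>-th term is taken modulo the \<open>n\<close>-th power.\<close>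

definition adic_rel :: "(nat \<Rightarrow> 'a::adic_ring) \<Rightarrow> (nat \<Rightarrow> 'a) \<Rightarrow> bool" where
  "adic_rel x y \<longleftrightarrow> (\<forall>n. x (Suc n) - x n \<in> ideal_power n \<and> y (Suc n) - y n \<in> ideal_power n
     \<and> x n - y n \<in> ideal_power n)"

lemma part_equivp_adic_rel: "part_equivp adic_rel"
proof (rule part_equivpI)
  show "\<exists>x. adic_rel x x"
    by (rule exI[of _ "\<lambda>_. 0"]) (simp add: adic_rel_def)
  show "symp adic_rel"
  proof (rule sympI)
    fix x y :: "nat \<Rightarrow> _"
    assume *: "adic_rel x y"
    have "y n - x n \<in> ideal_power n" for n
      using * ideal_power_minus[of "x n - y n" n] by (auto simp: adic_rel_def)
    with * show "adic_rel y x"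
      by (auto simp: adic_rel_def)
  qed
  show "transp adic_rel"
  proof (rule transpI)
    fix x y z :: "nat \<Rightarrow> _"
    assume *: "adic_rel x y" "adic_rel y z"
    have "x n - z n \<in> ideal_power n" for n
      using * ideal_power_add[of "x n - y n" n "y n - z n"] by (auto simp: adic_rel_def)
    with * show "adic_rel x z"
      by (auto simp: adic_rel_def)
  qed
qed

quotient_type (overloaded) 'a completion = "nat \<Rightarrow> 'a::adic_ring" / partial: adic_rel
  by (rule part_equivp_adic_rel)

lemma ideal_power_add_diff:
  "a - b \<in> ideal_power n \<Longrightarrow> c - d \<in> ideal_power n \<Longrightarrow> (a + c) - (b + d) \<in> ideal_power n"
  using ideal_power_add[of "a - b" n "c - d"] by (simp add: algebra_simps)

lemma ideal_power_diff_diff: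
  "a - b \<in> ideal_power n \<Longrightarrow> c - d \<in> ideal_power n \<Longrightarrow> (a - c) - (b - d) \<in> ideal_power n"
  using ideal_power_diff[of "a - b" n "c - d"] by (simp add: algebra_simps)

lemma ideal_power_minus_diff:
  "a - b \<in> ideal_power n \<Longrightarrow> - a - - b \<in> ideal_power n"
  using ideal_power_minus[of "a - b" n] by simp

lemma ideal_power_mult_diff:
  assumes "a - b \<in> ideal_power n" "c - d \<in> ideal_power n"
  shows "a * c - b * d \<in> ideal_power n"
proof -
  have "a * c - b * d = c * (a - b) + b * (c - d)"
    by (simp add: algebra_simps)
  then show ?thesis
    using assms by (simp add: ideal_power_add ideal_power_mult)
qed

instantiation completion :: (adic_ring) comm_ring_1
begin

lift_definition zero_completion :: "'a completion" is "\<lambda>_. 0"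
  by (simp add: adic_rel_def)
lift_definition one_completion :: "'a completion" is "\<lambda>_. 1"
  by (simp add: adic_rel_def)
lift_definition plus_completion :: "'a completion \<Rightarrow> 'a completion \<Rightarrow> 'a completion"
  is "\<lambda>x y n. x n + y n"
  unfolding adic_rel_def by (intro allI conjI ideal_power_add_diff) auto
lift_definition minus_completion :: "'a completion \<Rightarrow> 'a completion \<Rightarrow> 'a completion"
  is "\<lambda>x y n. x n - y n"
  unfolding adic_rel_def by (intro allI conjI ideal_power_diff_diff) auto
lift_definition uminus_completion :: "'a completion \<Rightarrow> 'a completion" is "\<lambda>x n. - x n"
  unfolding adic_rel_def by (intro allI conjI ideal_power_minus_diff) auto
lift_definition times_completion :: "'a completion \<Rightarrow> 'a completion \<Rightarrow> 'a completion"
  is "\<lambda>x y n. x n * y n"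
  unfolding adic_rel_def by (intro allI conjI ideal_power_mult_diff) auto

instance
proof
  fix a b c :: "'a completion"
  show "a * b * c = a * (b * c)"
    by transfer (simp add: mult.assoc adic_rel_def ideal_power_mult_diff)
  show "a * b = b * a"
    by transfer (simp add: mult.commute adic_rel_def ideal_power_mult_diff)
  show "1 * a = a"
    by transfer simp
  show "(a + b) * c = a * c + b * c"
    by transfer (simp add: distrib_right adic_rel_def ideal_power_mult_diff ideal_power_add_diff)
  show "a + b + c = a + (b + c)"
    by transfer (simp add: add.assoc adic_rel_def ideal_power_add_diff)
  show "a + b = b + a"
    by transfer (simp add: add.commute adic_rel_def ideal_power_add_diff)
  show "0 + a = a"
    by transfer simp
  show "- a + a = 0"
    by transfer (simp add: adic_rel_def)
  show "a - b = a + - b"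
    by transfer (simp add: adic_rel_def ideal_power_diff_diff)
  show "(0::'a completion) \<noteq> 1"
  proof (transfer, rule notI)
    assume "adic_rel (\<lambda>_. 0) (\<lambda>_. 1 :: 'a)"
    then have "0 - 1 \<in> (ideal_power (Suc 0) :: 'a set)"
      unfolding adic_rel_def by blast
    then have "1 \<in> (ideal_power (Suc 0) :: 'a set)"
      using ideal_power_minus by fastforce
    then show False
      using ideal_proper[where 'a='a] by (simp add: ideal_power_1)
  qed
qed

end

lift_definition completion_of :: "'a::adic_ring \<Rightarrow> 'a completion" is "\<lambda>a _. a"
  by (simp add: adic_rel_def)

instantiation completion :: (adic_ring) ideal_gens
begin

definition ideal_gens_completion :: "'a completion set" where
  "ideal_gens_completion = completion_of ` ideal_gens"

instance ..

end

section \<open>Inverting the Hasse polynomial \<open>h(\<lambda>)\<close>\<close>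

definition hasse_poly :: "nat \<Rightarrow> 'c::comm_ring_1 poly" where
  "hasse_poly p = (\<Sum>i\<le>(p - 1) div 2. monom (of_nat (((p - 1) div 2 choose i)\<^sup>2)) i)"

lemma coeff_hasse_poly_0: "coeff (hasse_poly p) 0 = 1"
  by (simp add: hasse_poly_def coeff_sum sum.delta if_distrib cong: if_cong)

lemma coeff_hasse_poly_power_0: "coeff (hasse_poly p ^ n) 0 = 1"
  by (simp add: coeff_0_power coeff_hasse_poly_0)

lemma hasse_poly_neq_0 [simp]: "hasse_poly p \<noteq> 0"
  using coeff_hasse_poly_0[of p] by (metis coeff_0 zero_neq_one)

text \<open>\<open>C[\<lambda>, 1/h(\<lambda>)]\<close> as a subring of the fraction field of \<open>C[\<lambda>]\<close>\<close>

typedef (overloaded) ('p, 'c) hloc =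
  "{x :: 'c::idom poly fract. \<exists>a n. x = Fraction_Field.Fract a (hasse_poly CARD('p::finite) ^ n)}"
  by blast

setup_lifting type_definition_hloc

lemma hloc_closed:
  fixes a b :: "'c::idom poly"
  shows "\<exists>c k. Fraction_Field.Fract a (hasse_poly p ^ m) + Fraction_Field.Fract b (hasse_poly p ^ n)
      = Fraction_Field.Fract c (hasse_poly p ^ k)"
    and "\<exists>c k. Fraction_Field.Fract a (hasse_poly p ^ m) - Fraction_Field.Fract b (hasse_poly p ^ n)
      = Fraction_Field.Fract c (hasse_poly p ^ k)"
    and "\<exists>c k. - Fraction_Field.Fract a (hasse_poly p ^ m) = Fraction_Field.Fract c (hasse_poly p ^ k)"
    and "\<exists>c k. Fraction_Field.Fract a (hasse_poly p ^ m) * Fraction_Field.Fract b (hasse_poly p ^ n)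
      = Fraction_Field.Fract c (hasse_poly p ^ k)"
  by (auto simp flip: power_add intro: minus_fract)

instantiation hloc :: (finite, idom) comm_ring_1
begin

lift_definition zero_hloc :: "('a, 'b) hloc" is 0
  by (rule exI[of _ 0], rule exI[of _ 0]) (simp add: Zero_fract_def)
lift_definition one_hloc :: "('a, 'b) hloc" is 1
  by (rule exI[of _ 1], rule exI[of _ 0]) (simp add: One_fract_def)
lift_definition plus_hloc :: "('a, 'b) hloc \<Rightarrow> ('a, 'b) hloc \<Rightarrow> ('a, 'b) hloc" is "(+)"
  by (auto intro: hloc_closed)
lift_definition minus_hloc :: "('a, 'b) hloc \<Rightarrow> ('a, 'b) hloc \<Rightarrow> ('a, 'b) hloc" is "(-)"
  by (auto intro: hloc_closed)
lift_definition uminus_hloc :: "('a, 'b) hloc \<Rightarrow> ('a, 'b) hloc" is uminus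
  by (auto intro: hloc_closed)
lift_definition times_hloc :: "('a, 'b) hloc \<Rightarrow> ('a, 'b) hloc \<Rightarrow> ('a, 'b) hloc" is "(*)"
  by (auto intro: hloc_closed)

instance
  by standard (transfer; simp add: algebra_simps)+

end

definition hloc_of_poly :: "'c::idom poly \<Rightarrow> ('p::finite, 'c) hloc" where
  "hloc_of_poly a = Abs_hloc (Fraction_Field.Fract a 1)"

lemma Rep_hloc_of_poly:
  "Rep_hloc (hloc_of_poly a :: ('p::finite, 'c::idom) hloc) = Fraction_Field.Fract a 1"
  unfolding hloc_of_poly_def by (rule Abs_hloc_inverse, rule CollectI, rule exI[of _ a], rule exI[of _ 0]) simp

instantiation hloc :: (finite, "{idom, adic_ring}") adic_ring
begin

definition ideal_gens_hloc :: "('a, 'b) hloc set" where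
  "ideal_gens_hloc = (\<lambda>c. hloc_of_poly [:c:]) ` ideal_gens"

instance
proof (standard, intro exI conjI)
  let ?h = "hasse_poly CARD('a) :: 'b poly"
  let ?I = "Modules.module.span (*) ideal_gens :: 'b set"
  let ?J = "{x :: ('a, 'b) hloc. \<exists>a n. Rep_hloc x = Fraction_Field.Fract a (?h ^ n) \<and> coeff a 0 \<in> ?I}"
  note span = module.span_zero[OF module_mult] module.span_add[OF module_mult]
    module.span_scale[OF module_mult] module.span_base[OF module_mult]
  show "ideal_gens \<subseteq> ?J"
  proof
    fix x :: "('a, 'b) hloc"
    assume "x \<in> ideal_gens"
    then obtain c where c: "c \<in> ideal_gens" "x = hloc_of_poly [:c:]"
      by (auto simp: ideal_gens_hloc_def)
    then have "Rep_hloc x = Fraction_Field.Fract [:c:] (?h ^ 0) \<and> coeff [:c:] 0 \<in> ?I"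
      by (simp add: Rep_hloc_of_poly span)
    then show "x \<in> ?J"
      by blast
  qed
  show "0 \<in> ?J"
  proof -
    have "Rep_hloc (0::('a, 'b) hloc) = Fraction_Field.Fract 0 (?h ^ 0) \<and> coeff 0 0 \<in> ?I"
      by (simp add: zero_hloc.rep_eq Zero_fract_def span)
    then show ?thesis
      by blast
  qed
  show "\<forall>x\<in>?J. \<forall>y\<in>?J. x + y \<in> ?J"
  proof (intro ballI)
    fix x y :: "('a, 'b) hloc"
    assume "x \<in> ?J" "y \<in> ?J"
    then obtain a m b n where *: "Rep_hloc x = Fraction_Field.Fract a (?h ^ m)" "coeff a 0 \<in> ?I"
      "Rep_hloc y = Fraction_Field.Fract b (?h ^ n)" "coeff b 0 \<in> ?I"
      by blast
    then have "Rep_hloc (x + y) = Fraction_Field.Fract (a * ?h ^ n + b * ?h ^ m) (?h ^ (m + n))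
        \<and> coeff (a * ?h ^ n + b * ?h ^ m) 0 \<in> ?I"
      by (simp add: plus_hloc.rep_eq power_add coeff_mult_0 coeff_hasse_poly_power_0 span)
    then show "x + y \<in> ?J"
      by blast
  qed
  show "\<forall>c. \<forall>x\<in>?J. c * x \<in> ?J"
  proof (intro allI ballI)
    fix c x :: "('a, 'b) hloc"
    assume "x \<in> ?J"
    then obtain a m where *: "Rep_hloc x = Fraction_Field.Fract a (?h ^ m)" "coeff a 0 \<in> ?I"
      by blast
    obtain b n where b: "Rep_hloc c = Fraction_Field.Fract b (?h ^ n)"
      using Rep_hloc[of c] by blast
    have "Rep_hloc (c * x) = Fraction_Field.Fract (b * a) (?h ^ (n + m)) \<and> coeff (b * a) 0 \<in> ?I"
      using * b by (simp add: times_hloc.rep_eq power_add coeff_mult_0 span)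
    then show "c * x \<in> ?J"
      by blast
  qed
  show "1 \<notin> ?J"
  proof
    assume "1 \<in> ?J"
    then obtain a n where a: "Fraction_Field.Fract 1 1 = Fraction_Field.Fract a (?h ^ n)" "coeff a 0 \<in> ?I"
    by (auto simp: one_hloc.rep_eq One_fract_def)
    then have "a = ?h ^ n"
    by (simp add: eq_fract(1))
    then show False
    using a ideal_proper[where 'a='b] by (simp add: coeff_hasse_poly_power_0)
  qed
qed

end


section \<open>The rings \<open>R\<close>, \<open>S'\<close>, \<open>B'\<close>\<close>

text \<open>In \<open>R = \<int>\<^sub>p[[q - 1]]\<close> the variable \<open>fps_X\<close> stands for \<open>q - 1\<close>, so that the ideal of
  definition of \<open>R\<close> is \<open>(p, q - 1)\<close>.\<close>

type_synonym 'p R = "'p zp fps"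
type_synonym 'p S' = "('p, 'p zp fps) hloc completion"
type_synonym 'p B' = "('p, 'p zp) hloc completion"

definition algebra_map :: "'c::{idom,adic_ring} \<Rightarrow> ('p::finite, 'c) hloc completion" where
  "algebra_map c = completion_of (hloc_of_poly [:c:])"

definition lam :: "('p::finite, 'c::{idom,adic_ring}) hloc completion" where
  "lam = completion_of (hloc_of_poly [:0, 1:])"

abbreviation qS :: "'p::prime_card S'" where
  "qS \<equiv> algebra_map (1 + fps_X)"

text \<open>The inclusion of \<open>\<rat> \<inter> \<int>\<^sub>p\<close> into \<open>\<int>\<^sub>p\<close>; the value is meaningful only if \<open>p\<close> does not divide
  the denominator.\<close>

definition zp_of_rat :: "rat \<Rightarrow> 'p::prime_card zp" where
  "zp_of_rat r = (THE z. of_int (snd (quotient_of r)) * z = of_int (fst (quotient_of r)))"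

text \<open>\<open>[a]\<^sub>q = (q\<^sup>a - 1)/(q - 1)\<close>, where \<open>q\<^sup>a\<close> is the binomial series in \<open>q - 1\<close>\<close>

definition q_bracket :: "rat \<Rightarrow> 'p::prime_card R" where
  "q_bracket a = Abs_fps (\<lambda>i. zp_of_rat (a gchoose Suc i))"

text \<open>Reduction modulo \<open>q - 1\<close>, identifying \<open>S'/(q - 1)\<close> with \<open>B'\<close>\<close>

definition red :: "'p::prime_card S' \<Rightarrow> 'p B'" where
  "red = (THE f. comm_ring_hom f \<and> (\<forall>r. f (algebra_map r) = algebra_map (fps_nth r 0))
     \<and> f lam = lam)"

section \<open>Modules\<close>

text \<open>Modules are subsets \<open>M\<close> of a type carrying a module structure \<open>smul\<close>, closed under the
  module operations.\<close>

definition free_of_rank ::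
    "('s::comm_ring_1 \<Rightarrow> 'm::ab_group_add \<Rightarrow> 'm) \<Rightarrow> nat \<Rightarrow> 'm set \<Rightarrow> bool" where
  "free_of_rank smul n M \<longleftrightarrow> (\<exists>X. finite X \<and> card X = n \<and> \<not> Modules.module.dependent smul X
     \<and> Modules.module.span smul X = M)"

definition direct_factor ::
    "('s::comm_ring_1 \<Rightarrow> 'm::ab_group_add \<Rightarrow> 'm) \<Rightarrow> 'm set \<Rightarrow> 'm set \<Rightarrow> bool" where
  "direct_factor smul U M \<longleftrightarrow> Modules.module.subspace smul U
     \<and> (\<exists>V. Modules.module.subspace smul V \<and> U \<inter> V = {0} \<and> {u + v | u v. u \<in> U \<and> v \<in> V} = M)"

definition semilinear_endo ::
    "('s \<Rightarrow> 's) \<Rightarrow> ('s::comm_ring_1 \<Rightarrow> 'm::ab_group_add \<Rightarrow> 'm) \<Rightarrow> 'm set \<Rightarrow> ('m \<Rightarrow> 'm) \<Rightarrow> bool" where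
  "semilinear_endo \<sigma> smul M f \<longleftrightarrow> f ` M \<subseteq> M \<and> (\<forall>x\<in>M. \<forall>y\<in>M. f (x + y) = f x + f y)
     \<and> (\<forall>a. \<forall>x\<in>M. f (smul a x) = smul (\<sigma> a) (f x))"

definition module_ideal_power ::
    "('s::{comm_ring_1,ideal_gens} \<Rightarrow> 'm::ab_group_add \<Rightarrow> 'm) \<Rightarrow> 'm set \<Rightarrow> nat \<Rightarrow> 'm set" where
  "module_ideal_power smul M n =
     Modules.module.span smul {smul c x | c x. c \<in> ideal_power n \<and> x \<in> M}"

definition adic_topology ::
    "('s::{comm_ring_1,ideal_gens} \<Rightarrow> 'm::ab_group_add \<Rightarrow> 'm) \<Rightarrow> 'm set \<Rightarrow> 'm topology" where
  "adic_topology smul M = topology (\<lambda>U. U \<subseteq> M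
     \<and> (\<forall>x\<in>U. \<exists>n. \<forall>y\<in>M. y - x \<in> module_ideal_power smul M n \<longrightarrow> y \<in> U))"

lemma openin_adic_topology:
  assumes "Modules.module smul"
  shows "openin (adic_topology smul M) U \<longleftrightarrow> U \<subseteq> M
     \<and> (\<forall>x\<in>U. \<exists>n. \<forall>y\<in>M. y - x \<in> module_ideal_power smul M n \<longrightarrow> y \<in> U)"
proof -
  have mono: "module_ideal_power smul M n \<subseteq> module_ideal_power smul M m" if "m \<le> n" for m n
    unfolding module_ideal_power_def
    using ideal_power_antimono[OF that, where 'a='a]
    by (intro module.span_mono[OF assms]) blast
  have "istopology (\<lambda>U. U \<subseteq> M
     \<and> (\<forall>x\<in>U. \<exists>n. \<forall>y\<in>M. y - x \<in> module_ideal_power smul M n \<longrightarrow> y \<in> U))" (is "istopology ?P")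
    unfolding istopology_def
  proof (intro conjI allI impI)
    fix U V
    assume U: "?P U" and V: "?P V"
    then show "U \<inter> V \<subseteq> M"
      by blast
    show "\<forall>x\<in>U \<inter> V. \<exists>n. \<forall>y\<in>M. y - x \<in> module_ideal_power smul M n \<longrightarrow> y \<in> U \<inter> V"
    proof
      fix x
      assume "x \<in> U \<inter> V"
      then obtain m n where "\<forall>y\<in>M. y - x \<in> module_ideal_power smul M m \<longrightarrow> y \<in> U"
        "\<forall>y\<in>M. y - x \<in> module_ideal_power smul M n \<longrightarrow> y \<in> V"
        using U V by blast
      then have "\<forall>y\<in>M. y - x \<in> module_ideal_power smul M (max m n) \<longrightarrow> y \<in> U \<inter> V"
        using mono[of m "max m n"] mono[of n "max m n"] by auto
      then show "\<exists>n. \<forall>y\<in>M. y - x \<in> module_ideal_power smul M n \<longrightarrow> y \<in> U \<inter> V" ..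
    qed
  next
    fix \<K>
    assume K: "\<forall>K\<in>\<K>. ?P K"
    then show "\<Union>\<K> \<subseteq> M"
      by blast
    show "\<forall>x\<in>\<Union>\<K>. \<exists>n. \<forall>y\<in>M. y - x \<in> module_ideal_power smul M n \<longrightarrow> y \<in> \<Union>\<K>"
      using K by (metis Union_iff)
  qed
  then show ?thesis
    unfolding adic_topology_def by (subst topology_inverse') auto
qed

abbreviation pair_scale :: "'s::comm_ring_1 \<Rightarrow> 's \<times> 's \<Rightarrow> 's \<times> 's" where
  "pair_scale \<equiv> module_prod.scale (*) (*)"

lemma module_prod_mult: "module_prod ((*) :: 's::comm_ring_1 \<Rightarrow> 's \<Rightarrow> 's) ((*) :: 's \<Rightarrow> 's \<Rightarrow> 's)"
  by (simp add: module_prod_def module_pair_def module_mult)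

lemma pair_scale: "pair_scale a (x, y) = (a * x, a * y)"
  by (rule module_prod.scale_prod[OF module_prod_mult])

lemma module_pair_scale: "Modules.module (pair_scale :: 's::comm_ring_1 \<Rightarrow> _)"
  by unfold_locales (auto simp: pair_scale algebra_simps)

section \<open>Frobenius, the action of \<open>\<Gamma>\<close>, and \<open>q\<close>-connections\<close>

definition is_frobenius :: "('p::prime_card S' \<Rightarrow> 'p S') \<Rightarrow> bool" where
  "is_frobenius \<phi> \<longleftrightarrow> comm_ring_hom \<phi>
     \<and> continuous_map (adic_topology (*) UNIV) (adic_topology (*) UNIV) \<phi>
     \<and> (\<forall>a. \<phi> (algebra_map (fps_const a)) = algebra_map (fps_const a))
     \<and> \<phi> qS = qS ^ CARD('p) \<and> \<phi> lam = lam ^ CARD('p)"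

text \<open>\<open>\<Gamma>\<close> is the additive group \<open>int\<close>, with generator \<open>\<gamma> = 1\<close> and the discrete topology.\<close>

definition is_Gamma_action :: "(int \<Rightarrow> 'p::prime_card S' \<Rightarrow> 'p S') \<Rightarrow> bool" where
  "is_Gamma_action \<rho> \<longleftrightarrow>
     (\<forall>k. comm_ring_hom (\<rho> k) \<and> (\<forall>r. \<rho> k (algebra_map r) = algebra_map r))
     \<and> \<rho> 0 = id \<and> (\<forall>k l. \<rho> (k + l) = \<rho> k \<circ> \<rho> l)
     \<and> continuous_map (prod_topology (discrete_topology UNIV) (adic_topology (*) UNIV))
          (adic_topology (*) UNIV) (\<lambda>(k, x). \<rho> k x)
     \<and> \<rho> 1 lam = qS * lam"

definition semilinear_Gamma_action ::
    "(int \<Rightarrow> 's \<Rightarrow> 's) \<Rightarrow> ('s::{comm_ring_1,ideal_gens} \<Rightarrow> 'm::ab_group_add \<Rightarrow> 'm) \<Rightarrow> 'm set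
       \<Rightarrow> (int \<Rightarrow> 'm \<Rightarrow> 'm) \<Rightarrow> bool" where
  "semilinear_Gamma_action \<rho> smul M \<rho>M \<longleftrightarrow> (\<forall>k. semilinear_endo (\<rho> k) smul M (\<rho>M k))
     \<and> (\<forall>x\<in>M. \<rho>M 0 x = x) \<and> (\<forall>k l. \<forall>x\<in>M. \<rho>M (k + l) x = \<rho>M k (\<rho>M l x))
     \<and> continuous_map (prod_topology (discrete_topology UNIV) (adic_topology smul M))
          (adic_topology smul M) (\<lambda>(k, x). \<rho>M k x)"

definition d_q :: "(int \<Rightarrow> 'p::prime_card S' \<Rightarrow> 'p S') \<Rightarrow> 'p S' \<Rightarrow> 'p S'" where
  "d_q \<rho> x = (THE y. \<rho> 1 x - x = (qS - 1) * lam * y)"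

text \<open>A \<open>q\<close>-connection with values in \<open>M \<otimes> (1/l) q\<Omega>\<close>.  The module \<open>(1/l) q\<Omega>\<close> is free on
  \<open>(1/l) dlog \<lambda>\<close>, and the map \<open>N\<close> is the coefficient of the \<open>q\<close>-connection with respect to this
  generator: \<open>\<nabla>\<^sub>q(m) = N m \<otimes> (1/l) dlog \<lambda>\<close>.  As \<open>\<delta>\<^sub>q(a) = d\<^sub>q(a) \<lambda> dlog \<lambda>\<close>, the element
  \<open>m \<otimes> \<delta>\<^sub>q(a)\<close> has coefficient \<open>l \<lambda> d\<^sub>q(a) m\<close>.  The submodule \<open>M \<otimes> q\<Omega>\<close> consists of the elements
  whose coefficient lies in \<open>l M\<close>.\<close>

definition q_connection ::
    "(int \<Rightarrow> 'p::prime_card S' \<Rightarrow> 'p S') \<Rightarrow> 'p S' \<Rightarrow> ('p S' \<Rightarrow> 'm::ab_group_add \<Rightarrow> 'm)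
       \<Rightarrow> ('m \<Rightarrow> 'm) \<Rightarrow> bool" where
  "q_connection \<rho> l smul N \<longleftrightarrow> (\<forall>x y. N (x + y) = N x + N y)
     \<and> (\<forall>r x. N (smul (algebra_map r) x) = smul (algebra_map r) (N x))
     \<and> (\<forall>a x. N (smul a x) = smul (l * lam * d_q \<rho> a) x + smul (\<rho> 1 a) (N x))"

text \<open>If \<open>\<nabla>\<^sub>q\<close> maps \<open>U\<close> into \<open>U \<otimes> q\<Omega>\<close>, this is \<open>D\<^sub>q\<^sup>l\<^sup>o\<^sup>g\<close> on \<open>U\<close>.\<close>

definition D_q_log ::
    "'p::prime_card S' \<Rightarrow> ('p S' \<Rightarrow> 'm::ab_group_add \<Rightarrow> 'm) \<Rightarrow> 'm set \<Rightarrow> ('m \<Rightarrow> 'm) \<Rightarrow> 'm \<Rightarrow> 'm" where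
  "D_q_log l smul U N x = (THE y. y \<in> U \<and> N x = smul l y)"

definition associated_action ::
    "(int \<Rightarrow> 'p::prime_card S' \<Rightarrow> 'p S') \<Rightarrow> 'p S' \<Rightarrow> ('p S' \<Rightarrow> 'm::ab_group_add \<Rightarrow> 'm) \<Rightarrow> 'm set
       \<Rightarrow> ('m \<Rightarrow> 'm) \<Rightarrow> (int \<Rightarrow> 'm \<Rightarrow> 'm) \<Rightarrow> bool" where
  "associated_action \<rho> l smul U N \<rho>U \<longleftrightarrow> semilinear_Gamma_action \<rho> smul U \<rho>U
     \<and> (\<forall>x\<in>U. \<rho>U 1 x = x + smul (qS - 1) (D_q_log l smul U N x))"

text \<open>\<open>N\<close> is the \<open>q\<close>-connection of \<open>M' = S' e\<^sub>1' \<oplus> S' e\<^sub>2\<close> with \<open>l = 1 - \<lambda>\<close>.  Since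
  \<open>d\<lambda> = \<lambda> (1 - \<lambda>) \<cdot> (1/(1 - \<lambda>)) dlog \<lambda>\<close>, the coefficients of the defining formulas are multiplied
  by \<open>\<lambda> (1 - \<lambda>)\<close>.\<close>

definition is_q_connection_M' ::
    "(int \<Rightarrow> 'p::prime_card S' \<Rightarrow> 'p S') \<Rightarrow> ('p S' \<times> 'p S' \<Rightarrow> 'p S' \<times> 'p S') \<Rightarrow> bool" where
  "is_q_connection_M' \<rho> N \<longleftrightarrow> q_connection \<rho> (1 - lam) pair_scale N
     \<and> N (1, 0) = (0, - 1)
     \<and> N (0, 1) = (lam * (1 - lam) * - (algebra_map (q_bracket (1/2)))\<^sup>2,
                   lam * (algebra_map (q_bracket (1/2)))\<^sup>2 * (qS - 1))"

section \<open>Classical objects over \<open>B'\<close>\<close>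

definition ddlam :: "'p::prime_card B' \<Rightarrow> 'p B'" where
  "ddlam = (THE d. (\<forall>x y. d (x + y) = d x + d y) \<and> (\<forall>x y. d (x * y) = d x * y + x * d y)
     \<and> (\<forall>c. d (algebra_map c) = 0) \<and> d lam = 1)"

definition frobenius_B' :: "('p::prime_card S' \<Rightarrow> 'p S') \<Rightarrow> 'p B' \<Rightarrow> 'p B'" where
  "frobenius_B' \<phi> b = (THE c. \<exists>x. red x = b \<and> red (\<phi> x) = c)"

text \<open>A connection on \<open>M\<close> with values in \<open>M \<otimes> B' \<theta>\<close> where \<open>d\<lambda> = w \<theta>\<close>; the map \<open>G\<close> is its
  coefficient with respect to \<open>\<theta>\<close>.  For \<open>\<theta> = dlog \<lambda>\<close> one has \<open>w = \<lambda>\<close>, and for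
  \<open>\<theta> = d\<lambda>/(\<lambda>(1 - \<lambda>))\<close> one has \<open>w = \<lambda>(1 - \<lambda>)\<close>.\<close>

definition is_connection ::
    "'p::prime_card B' \<Rightarrow> ('p B' \<Rightarrow> 'n::ab_group_add \<Rightarrow> 'n) \<Rightarrow> 'n set \<Rightarrow> ('n \<Rightarrow> 'n) \<Rightarrow> bool" where
  "is_connection w smul M G \<longleftrightarrow> G ` M \<subseteq> M \<and> (\<forall>x\<in>M. \<forall>y\<in>M. G (x + y) = G x + G y)
     \<and> (\<forall>b. \<forall>x\<in>M. G (smul b x) = smul (w * ddlam b) x + smul b (G x))"

text \<open>The relative log de Rham cohomology of the Legendre family, with the differential \<open>\<omega>\<close> and
  \<open>\<nabla> = G \<otimes> d\<lambda>/(\<lambda>(1 - \<lambda>))\<close>, that is \<open>G = \<lambda>(1 - \<lambda>) D\<close>: the pair \<open>(\<omega>, \<lambda>(1 - \<lambda>) D(\<omega>))\<close> is a basis,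
  and \<open>D(-\<lambda>(1 - \<lambda>) D(\<omega>)) = -\<omega>/4\<close>.  These properties characterise \<open>(H, \<nabla>, \<omega>)\<close> up to unique
  isomorphism.\<close>

definition is_legendre_deRham ::
    "('p::prime_card B' \<Rightarrow> 'h::ab_group_add \<Rightarrow> 'h) \<Rightarrow> ('h \<Rightarrow> 'h) \<Rightarrow> 'h \<Rightarrow> bool" where
  "is_legendre_deRham smul G \<omega> \<longleftrightarrow> Modules.module smul
     \<and> is_connection (lam * (1 - lam)) smul UNIV G
     \<and> bij (\<lambda>(a, b). smul a \<omega> + smul b (G \<omega>))
     \<and> G (- G \<omega>) = smul (lam * (1 - lam)) (- smul (algebra_map (zp_of_rat (1/4))) \<omega>)"

definition hypergeom :: "'p::prime_card zp fps" where
  "hypergeom = Abs_fps (\<lambda>n. zp_of_rat ((\<Prod>i<n. (of_nat i + 1/2) / (of_nat i + 1))\<^sup>2))"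

text \<open>The embedding of \<open>B'\<close> into \<open>\<int>\<^sub>p[[\<lambda>]]\<close>, through which \<open>f/\<phi>(f)\<close> and \<open>f'/f\<close> are regarded as
  elements of \<open>B'\<close>\<close>

definition expansion :: "'p::prime_card B' \<Rightarrow> 'p zp fps" where
  "expansion = (THE g. comm_ring_hom g \<and> (\<forall>c. g (algebra_map c) = fps_const c) \<and> g lam = fps_X)"

definition unit_root_factor :: "'p::prime_card B'" where
  "unit_root_factor =
     (THE u. expansion u * fps_compose hypergeom (fps_X ^ CARD('p)) = hypergeom)"

definition log_deriv :: "'p::prime_card B'" where
  "log_deriv = (THE b. expansion b * hypergeom = fps_deriv hypergeom)"

definition e2bar ::
    "('p::prime_card B' \<Rightarrow> 'h::ab_group_add \<Rightarrow> 'h) \<Rightarrow> ('h \<Rightarrow> 'h) \<Rightarrow> 'h \<Rightarrow> 'h" where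
  "e2bar smul G \<omega> = smul (lam * (1 - lam) * log_deriv) \<omega> - G \<omega>"

text \<open>The map \<open>b e \<mapsto> g(b) e\<close> on the free module spanned by \<open>e\<close>\<close>

definition line_map :: "('s \<Rightarrow> 'm \<Rightarrow> 'm) \<Rightarrow> 'm \<Rightarrow> ('s \<Rightarrow> 's) \<Rightarrow> 'm \<Rightarrow> 'm" where
  "line_map smul e g x = (THE y. \<exists>b. x = smul b e \<and> y = smul (g b) e)"

definition U_B' ::
    "('p::prime_card B' \<Rightarrow> 'h::ab_group_add \<Rightarrow> 'h) \<Rightarrow> ('h \<Rightarrow> 'h) \<Rightarrow> 'h \<Rightarrow> 'h set" where
  "U_B' smul G \<omega> = Modules.module.span smul {e2bar smul G \<omega>}"

definition frobenius_U_B' ::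
    "('p::prime_card S' \<Rightarrow> 'p S') \<Rightarrow> ('p B' \<Rightarrow> 'h::ab_group_add \<Rightarrow> 'h) \<Rightarrow> ('h \<Rightarrow> 'h) \<Rightarrow> 'h
       \<Rightarrow> 'h \<Rightarrow> 'h" where
  "frobenius_U_B' \<phi> smul G \<omega> = line_map smul (e2bar smul G \<omega>)
     (\<lambda>b. frobenius_B' \<phi> b * ((- 1) ^ ((CARD('p) - 1) div 2) * unit_root_factor))"

text \<open>The coefficient with respect to \<open>dlog \<lambda>\<close> of the connection on \<open>U\<^sub>B\<^sub>'\<close>; on the generator
  \<open>e\<close> the connection is \<open>-(f'/f) e \<otimes> d\<lambda>\<close>.\<close>

definition connection_U_B' ::
    "('p::prime_card B' \<Rightarrow> 'h::ab_group_add \<Rightarrow> 'h) \<Rightarrow> ('h \<Rightarrow> 'h) \<Rightarrow> 'h \<Rightarrow> 'h \<Rightarrow> 'h" where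
  "connection_U_B' smul G \<omega> = line_map smul (e2bar smul G \<omega>)
     (\<lambda>b. lam * ddlam b + b * (lam * - log_deriv))"

section \<open>The categories and the reduction functor\<close>

definition MF_object ::
    "('p::prime_card S' \<Rightarrow> 'p S') \<Rightarrow> (int \<Rightarrow> 'p S' \<Rightarrow> 'p S')
       \<Rightarrow> ('p S' \<Rightarrow> 'm::ab_group_add \<Rightarrow> 'm) \<Rightarrow> 'm set \<Rightarrow> ('m \<Rightarrow> 'm) \<Rightarrow> (int \<Rightarrow> 'm \<Rightarrow> 'm) \<Rightarrow> bool" where
  "MF_object \<phi> \<rho> smul M \<phi>M \<rho>M \<longleftrightarrow> Modules.module smul \<and> (\<exists>n. free_of_rank smul n M)
     \<and> semilinear_endo \<phi> smul M \<phi>M \<and> Modules.module.span smul (\<phi>M ` M) = M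
     \<and> semilinear_Gamma_action \<rho> smul M \<rho>M
     \<and> (\<forall>k. \<forall>x\<in>M. \<rho>M k (\<phi>M x) = \<phi>M (\<rho>M k x))
     \<and> (\<forall>x\<in>M. \<exists>y\<in>M. \<rho>M 1 x - x = smul (qS - 1) y)"

text \<open>The connection is \<open>\<nabla> = D \<otimes> dlog \<lambda>\<close>; horizontality of the Frobenius reads
  \<open>D \<circ> \<phi>\<^sub>N = p \<phi>\<^sub>N \<circ> D\<close> because \<open>\<phi>\<^sup>1(dlog \<lambda>) = p dlog \<lambda>\<close>.\<close>

definition MIC_object ::
    "('p::prime_card B' \<Rightarrow> 'p B') \<Rightarrow> ('p B' \<Rightarrow> 'n::ab_group_add \<Rightarrow> 'n) \<Rightarrow> 'n set
       \<Rightarrow> ('n \<Rightarrow> 'n) \<Rightarrow> ('n \<Rightarrow> 'n) \<Rightarrow> bool" where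
  "MIC_object \<phi> smul N \<phi>N D \<longleftrightarrow> Modules.module smul \<and> (\<exists>n. free_of_rank smul n N)
     \<and> semilinear_endo \<phi> smul N \<phi>N \<and> Modules.module.span smul (\<phi>N ` N) = N
     \<and> is_connection lam smul N D
     \<and> (\<forall>x\<in>N. D (\<phi>N x) = smul (of_nat CARD('p)) (\<phi>N (D x)))"

text \<open>The quotient \<open>M/(q - 1)M\<close> is the set of cosets, and the operations on it are induced from
  \<open>M\<close>.  Each of the unions below is a single coset when the operation is well defined.\<close>

definition red_class :: "('p::prime_card S' \<Rightarrow> 'm::ab_group_add \<Rightarrow> 'm) \<Rightarrow> 'm set \<Rightarrow> 'm \<Rightarrow> 'm set" where
  "red_class smul M x = {y \<in> M. \<exists>z\<in>M. y - x = smul (qS - 1) z}"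

definition red_module :: "('p::prime_card S' \<Rightarrow> 'm::ab_group_add \<Rightarrow> 'm) \<Rightarrow> 'm set \<Rightarrow> 'm set set" where
  "red_module smul M = red_class smul M ` M"

definition red_add ::
    "('p::prime_card S' \<Rightarrow> 'm::ab_group_add \<Rightarrow> 'm) \<Rightarrow> 'm set \<Rightarrow> 'm set \<Rightarrow> 'm set \<Rightarrow> 'm set" where
  "red_add smul M C C' = (\<Union>x\<in>C. \<Union>y\<in>C'. red_class smul M (x + y))"

definition red_scale ::
    "('p::prime_card S' \<Rightarrow> 'm::ab_group_add \<Rightarrow> 'm) \<Rightarrow> 'm set \<Rightarrow> 'p B' \<Rightarrow> 'm set \<Rightarrow> 'm set" where
  "red_scale smul M b C = (\<Union>a\<in>{a. red a = b}. \<Union>x\<in>C. red_class smul M (smul a x))"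

definition red_frobenius ::
    "('p::prime_card S' \<Rightarrow> 'm::ab_group_add \<Rightarrow> 'm) \<Rightarrow> 'm set \<Rightarrow> ('m \<Rightarrow> 'm) \<Rightarrow> 'm set \<Rightarrow> 'm set" where
  "red_frobenius smul M \<phi>M C = (\<Union>x\<in>C. red_class smul M (\<phi>M x))"

definition red_connection ::
    "('p::prime_card S' \<Rightarrow> 'm::ab_group_add \<Rightarrow> 'm) \<Rightarrow> 'm set \<Rightarrow> (int \<Rightarrow> 'm \<Rightarrow> 'm)
       \<Rightarrow> 'm set \<Rightarrow> 'm set" where
  "red_connection smul M \<rho>M C =
     (\<Union>x\<in>C. \<Union>y\<in>{y \<in> M. smul (qS - 1) y = \<rho>M 1 x - x}. red_class smul M y)"

definition red_linear_iso ::
    "('p::prime_card S' \<Rightarrow> 'm::ab_group_add \<Rightarrow> 'm) \<Rightarrow> 'm set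
       \<Rightarrow> ('p B' \<Rightarrow> 'n::ab_group_add \<Rightarrow> 'n) \<Rightarrow> 'n set \<Rightarrow> ('m set \<Rightarrow> 'n) \<Rightarrow> bool" where
  "red_linear_iso smul M smulN N F \<longleftrightarrow> bij_betw F (red_module smul M) N
     \<and> (\<forall>C\<in>red_module smul M. \<forall>C'\<in>red_module smul M. F (red_add smul M C C') = F C + F C')
     \<and> (\<forall>b. \<forall>C\<in>red_module smul M. F (red_scale smul M b C) = smulN b (F C))"

text \<open>\<open>F\<close> is an isomorphism from the image of \<open>(M, \<phi>\<^sub>M, \<rho>\<^sub>M)\<close> under the reduction functor to
  \<open>(N, D, \<phi>\<^sub>N)\<close>.\<close>

definition red_MIC_iso ::
    "('p::prime_card S' \<Rightarrow> 'm::ab_group_add \<Rightarrow> 'm) \<Rightarrow> 'm set \<Rightarrow> ('m \<Rightarrow> 'm) \<Rightarrow> (int \<Rightarrow> 'm \<Rightarrow> 'm)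
       \<Rightarrow> ('p B' \<Rightarrow> 'n::ab_group_add \<Rightarrow> 'n) \<Rightarrow> 'n set \<Rightarrow> ('n \<Rightarrow> 'n) \<Rightarrow> ('n \<Rightarrow> 'n)
       \<Rightarrow> ('m set \<Rightarrow> 'n) \<Rightarrow> bool" where
  "red_MIC_iso smul M \<phi>M \<rho>M smulN N \<phi>N D F \<longleftrightarrow> red_linear_iso smul M smulN N F
     \<and> (\<forall>C\<in>red_module smul M. F (red_frobenius smul M \<phi>M C) = \<phi>N (F C))
     \<and> (\<forall>C\<in>red_module smul M. F (red_connection smul M \<rho>M C) = D (F C))"

text \<open>The composite of \<open>M' \<rightarrow> M' \<otimes> B'\<close> with the isomorphism \<open>M' \<otimes> B' \<cong> H\<close> sending \<open>e\<^sub>1'\<close> to \<open>\<omega>\<close>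
  and \<open>e\<^sub>2\<close> to \<open>-\<lambda>(1 - \<lambda>) D(\<omega>) = - G \<omega>\<close>\<close>

definition M'_to_H ::
    "('p::prime_card B' \<Rightarrow> 'h::ab_group_add \<Rightarrow> 'h) \<Rightarrow> ('h \<Rightarrow> 'h) \<Rightarrow> 'h \<Rightarrow> 'p S' \<times> 'p S' \<Rightarrow> 'h" where
  "M'_to_H smul G \<omega> x = smul (red (fst x)) \<omega> + smul (red (snd x)) (- G \<omega>)"

end

theory Submission
  imports Defs "HOL-Computational_Algebra.Polynomial_FPS"
begin

text \<open>Expansion at \<open>\<lambda> = 0\<close> embeds \<open>S'\<close> into \<open>R[[\<lambda>]]\<close>, so that an element of \<open>S'\<close> is a power series
  which modulo each power of \<open>(p, q - 1)\<close> is a polynomial divided by a power of \<open>h\<close>.  Let \<open>F\<close> be the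
  solution \<open>\<Sum> A\<^sub>n \<lambda>\<^sup>n\<close> of the \<open>q\<close>-hypergeometric equation, \<open>A\<^sub>n\<close> being the square of the product of
  the \<open>[i + 1/2]\<^sub>q / [i + 1]\<^sub>q\<close> for \<open>i < n\<close>.  The ratio \<open>A\<^sub>n / \<phi>(A\<^bsub>n div p\<^esub>)\<close> depends on \<open>n\<close> only modulo
  \<open>p ^ s\<close> up to multiples of \<open>[p ^ s]\<^sub>q\<close>.  Call a function \<open>w\<close> with this property a weight and put
  \<open>F\<^sub>w = \<Sum> w\<^sub>n A\<^sub>n \<lambda>\<^sup>n\<close>.  Splitting \<open>F\<^sub>w\<close> according to the residue of \<open>n\<close> modulo \<open>p\<close> gives
  \<open>F\<^sub>w = B \<phi>(F) + [p]\<^sub>q (\<dots>)\<close> where the dots stand for series of the same kind for the Frobenius twist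
  of \<open>F\<close>, and \<open>B\<close> is congruent to \<open>h\<close> if \<open>w = 1\<close>.  By induction on the precision,
  \<open>F\<^sub>w / F\<close> and \<open>F / \<phi>(F)\<close> lie in \<open>S'\<close>.  The weights \<open>[n]\<^sub>q\<close> and \<open>q ^ (k n)\<close> give \<open>\<lambda> d\<^sub>q F / F\<close> and
  \<open>\<gamma>\<^sup>k F / F\<close>.  Hence the horizontal section \<open>\<lambda>(1 - \<lambda>) d\<^sub>q(F) e\<^sub>1' + F e\<^sub>2\<close> divided by \<open>F\<close> lies in \<open>M'\<close>; it
  spans \<open>U'\<close>, on which \<open>\<gamma>\<^sup>k\<close> acts through \<open>F / \<gamma>\<^sup>k F\<close> and the Frobenius is defined through
  \<open>\<plusminus> F / \<phi>(F)\<close>.  The specialisation \<open>q = 1\<close> contains the theorems of Dwork on \<open>f'/f\<close> and \<open>f/\<phi>(f)\<close>.\<close>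

section \<open>Powers of the ideal of definition\<close>

text \<open>The congruence for the ratios uses that p is odd: in base q^(1/2) the numerators and
  denominators have indices 2i + 1 and 2i + 2, and over p^s consecutive i both run through all
  residues modulo p^s. The obstacle to the classical induction is that the modulus [p^s] is not
  fixed by the Frobenius: [p^(s+1)] = [p] \<phi>([p^s]). Weights, moduli and series therefore carry
  a twist index i, and the induction on the precision is uniform in i. Weights are forced because
  the error terms of F itself already have coefficients of the form w_n A_n, where w is a divided
  difference of the ratio. Inverting h makes B a unit for w = 1, so that \<phi>(F) can be eliminated
  between F_w and F. F itself is used only as a power series; what enters the module are its
  quotients. They are coboundaries of F, which is why the Frobenius and the action of the group
  commute. The maps specified by a definite description (\<open>red\<close>, \<open>ddlam\<close>,
  \<open>expansion\<close>, \<open>d_q\<close>) acquire existence from an operation on coefficients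
  that preserves the image of S' or B', and uniqueness from density of the fractions or cancellation
  in a domain.\<close>

lemma ideal_power_0_UNIV: "ideal_power 0 = UNIV"
proof -
  have "x \<in> ideal_power 0" for x :: 'a
  proof -
    have "1 \<in> (ideal_power 0 :: 'a set)"
      unfolding ideal_power_def by (rule module.span_base[OF module_mult]) (auto intro!: exI[of _ "[]"])
    then show ?thesis
      using ideal_power_mult[of 1 0 x] by simp
  qed
  then show ?thesis
    by blast
qed

lemma ideal_gens_power_1: "g \<in> ideal_gens \<Longrightarrow> g \<in> ideal_power (Suc 0)"
  by (simp add: ideal_power_1 module.span_base[OF module_mult])

lemma ideal_power_mult2: "c \<in> ideal_power n \<Longrightarrow> c * x \<in> ideal_power n"
  using ideal_power_mult[of c n x] by (simp add: mult.commute)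

lemma ideal_power_sum: "(\<And>i. i \<in> A \<Longrightarrow> f i \<in> ideal_power n) \<Longrightarrow> sum f A \<in> ideal_power n"
  by (induction A rule: infinite_finite_induct) (auto intro: ideal_power_add)

lemma ideal_power_minus_iff: "- x \<in> ideal_power n \<longleftrightarrow> x \<in> ideal_power n"
  using ideal_power_minus[of x n] ideal_power_minus[of "- x" n] by auto

lemma ideal_power_swap: "x - y \<in> ideal_power n \<longleftrightarrow> y - x \<in> ideal_power n"
  using ideal_power_minus_iff[of "x - y" n] by simp

lemma ideal_power_trans: "x - y \<in> ideal_power n \<Longrightarrow> y - z \<in> ideal_power n \<Longrightarrow> x - z \<in> ideal_power n"
  using ideal_power_add[of "x - y" n "y - z"] by simp

lemma ideal_power_span_induct:
  assumes "x \<in> ideal_power n"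
    and "\<And>gs. length gs = n \<Longrightarrow> set gs \<subseteq> ideal_gens \<Longrightarrow> P (prod_list gs)"
    and "P 0" and "\<And>x y. P x \<Longrightarrow> P y \<Longrightarrow> P (x + y)" and "\<And>c x. P x \<Longrightarrow> P (c * x)"
  shows "P x"
proof -
  have "x \<in> Modules.module.span (*) {prod_list gs | gs. length gs = n \<and> set gs \<subseteq> ideal_gens}"
    using assms(1) by (simp add: ideal_power_def)
  then show ?thesis
  proof (rule module.span_induct[OF module_mult])
    show "Modules.module.subspace (*) (Collect P)"
      using assms(3-) by (simp add: module.subspace_def[OF module_mult])
  qed (use assms(2) in auto)
qed

lemma ideal_power_times:
  assumes "x \<in> ideal_power m" "y \<in> ideal_power n"
  shows "x * y \<in> ideal_power (m + n)"
  using assms(1)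
proof (rule ideal_power_span_induct)
  fix gs :: "'a list"
  assume gs: "length gs = m" "set gs \<subseteq> ideal_gens"
  from assms(2) show "prod_list gs * y \<in> ideal_power (m + n)"
  proof (rule ideal_power_span_induct)
    fix hs :: "'a list"
    assume hs: "length hs = n" "set hs \<subseteq> ideal_gens"
    show "prod_list gs * prod_list hs \<in> ideal_power (m + n)"
      unfolding ideal_power_def
      by (rule module.span_base[OF module_mult]) (use gs hs in \<open>auto intro!: exI[of _ "gs @ hs"]\<close>)
  qed (auto simp: distrib_left mult.left_commute intro: ideal_power_add ideal_power_mult)
qed (auto simp: distrib_right mult.assoc intro: ideal_power_add ideal_power_mult)

lemma ideal_power_power: "x \<in> ideal_power 1 \<Longrightarrow> x ^ n \<in> ideal_power n"
proof (induction n)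
  case (Suc n)
  then show ?case using ideal_power_times[of x 1 "x ^ n" n] by simp
qed (simp add: ideal_power_0_UNIV)

text \<open>A product of n generators climbs one degree of \<open>L\<close> per factor, and
  \<open>L 0\<close> being everything makes each \<open>L n\<close> stable under multiples.
  \<open>L\<close> is abstract so that one induction serves ideal powers, \<open>coeff_ideal\<close>
  and the degree filtration of power series.\<close>

lemma hom_ideal_filtration:
  assumes f: "comm_ring_hom f" and x: "x \<in> ideal_power n"
    and gens: "\<And>g. g \<in> ideal_gens \<Longrightarrow> f g \<in> L 1"
    and L0: "\<And>y. y \<in> L 0"
    and add: "\<And>x y n. x \<in> L n \<Longrightarrow> y \<in> L n \<Longrightarrow> x + y \<in> L n"
    and mult: "\<And>x y m n. x \<in> L m \<Longrightarrow> y \<in> L n \<Longrightarrow> x * y \<in> L (m + n)"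
    and zero: "\<And>n. 0 \<in> L n"
  shows "f x \<in> L n"
proof -
  interpret comm_ring_hom f by fact
  show ?thesis
    using x
  proof (rule ideal_power_span_induct)
    fix gs :: "'a list"
    assume "length gs = n" "set gs \<subseteq> ideal_gens"
    then show "f (prod_list gs) \<in> L n"
    proof (induction gs arbitrary: n)
      case (Cons g gs)
      then show ?case
        using mult[of "f g" 1 "f (prod_list gs)" "length gs"] gens by (auto simp: hom_mult)
    qed (simp add: L0)
  next
    fix c x assume "f x \<in> L n"
    then show "f (c * x) \<in> L n"
      using mult[of "f c" 0 "f x" n] L0 by (simp add: hom_mult)
  qed (auto simp: hom_add intro: zero add)
qed

lemma hom_ideal_power:
  assumes "comm_ring_hom f" "x \<in> ideal_power n"
    and "\<And>g. g \<in> ideal_gens \<Longrightarrow> f g \<in> ideal_power 1"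
  shows "f x \<in> ideal_power n"
  using assms(1,2) by (rule hom_ideal_filtration[where L = ideal_power])
    (auto simp: assms(3)[simplified] ideal_power_0_UNIV intro: ideal_power_add ideal_power_times)

section \<open>Complete and separated adic rings\<close>

definition (in adic_ring) adic_power :: "nat \<Rightarrow> 'a set" where
  "adic_power n = \<Inter>{J. {prod_list gs | gs. length gs = n \<and> set gs \<subseteq> ideal_gens} \<subseteq> J
     \<and> 0 \<in> J \<and> (\<forall>x\<in>J. \<forall>y\<in>J. x + y \<in> J) \<and> (\<forall>c. \<forall>x\<in>J. c * x \<in> J)}"

lemma adic_power_eq: "adic_power n = ideal_power n"
  unfolding adic_power_def ideal_power_def module.span_def[OF module_mult] hull_def
    module.subspace_def[OF module_mult]
  by (intro arg_cong[where f = Inter] Collect_cong) auto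

text \<open>A class axiom may only mention constants that are defined relative to the superclasses, whence
  the detour through \<open>adic_power\<close>.\<close>

class complete_adic_ring = idom + adic_ring +
  assumes adic_power_complete:
      "(\<And>n. x (Suc n) - x n \<in> adic_power n) \<Longrightarrow> \<exists>L. \<forall>n. L - x n \<in> adic_power n"
    and adic_power_separated: "(\<And>n. y \<in> adic_power n) \<Longrightarrow> y = 0"
    and finite_ideal_gens: "finite ideal_gens"

lemmas adic_complete = adic_power_complete[unfolded adic_power_eq]
lemmas adic_separated = adic_power_separated[unfolded adic_power_eq]

subsection \<open>\<open>\<int>\<^sub>p\<close> and \<open>\<int>\<^sub>p[[X]]\<close>\<close>

lemma Rep_zp_mod:
  fixes z :: "'p::prime_card zp"
  assumes "n \<le> k"
  shows "Rep_zp z k mod int CARD('p) ^ n = Rep_zp z n"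
  using assms
proof (induction k rule: dec_induct)
  case base
  then show ?case using Rep_zp[of z] by simp
next
  case (step k)
  have "Rep_zp z (Suc k) mod int CARD('p) ^ n = Rep_zp z (Suc k) mod int CARD('p) ^ k mod int CARD('p) ^ n"
    using step by (simp add: mod_mod_cancel le_imp_power_dvd)
  also have "Rep_zp z (Suc k) mod int CARD('p) ^ k = Rep_zp z k"
    using Rep_zp[of z] by simp
  finally show ?case using step by simp
qed

lemma of_int_zp: "Rep_zp (of_int m :: 'p::prime_card zp) n = m mod int CARD('p) ^ n"
  by (cases m rule: int_cases2) (simp_all add: of_nat_zp uminus_zp.rep_eq mod_minus_eq)

lemma Rep_zp_diff: "Rep_zp (x - y :: 'p::prime_card zp) n = (Rep_zp x n - Rep_zp y n) mod int CARD('p) ^ n"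
  unfolding minus_zp_def plus_zp.rep_eq uminus_zp.rep_eq by (simp add: mod_simps)

lemma p_neq_0_zp: "of_nat CARD('p) \<noteq> (0 :: 'p::prime_card zp)"
proof
  assume "of_nat CARD('p) = (0 :: 'p zp)"
  then have "Rep_zp (of_nat CARD('p) :: 'p zp) 2 = 0"
    by (simp add: zero_zp.rep_eq)
  then show False
    using prime_card_gt_1[where 'p='p] by (simp add: of_nat_zp power2_eq_square)
qed

lemma Rep_zp_eq_0_iff:
  fixes z :: "'p::prime_card zp"
  shows "Rep_zp z n = 0 \<longleftrightarrow> of_nat CARD('p) ^ n dvd z"
proof
  assume "of_nat CARD('p) ^ n dvd z"
  then obtain y where "z = of_nat CARD('p) ^ n * y" by blast
  moreover have "Rep_zp (of_nat CARD('p) ^ n :: 'p zp) n = 0"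
    using of_nat_zp[of "CARD('p) ^ n" n, where 'p = 'p] by simp
  ultimately show "Rep_zp z n = 0"
    by (simp add: times_zp.rep_eq)
next
  let ?p = "int CARD('p)"
  assume z: "Rep_zp z n = 0"
  \<comment> \<open>These residues represent z / p^n: the level is raised by n because dividing by
    p^n costs n digits.\<close>
  define y where "y k = Rep_zp z (k + n) div ?p ^ n" for k
  have zy: "Rep_zp z (k + n) = ?p ^ n * y k" for k
    using Rep_zp_mod[of n "k + n" z] z by (auto simp: y_def)
  have y: "y k \<in> {0..<?p ^ k} \<and> y (Suc k) mod ?p ^ k = y k" for k
  proof -
    have "Rep_zp z (k + n) \<in> {0..<?p ^ (k + n)}"
      using Rep_zp[of z] by auto
    moreover have "?p ^ n * y (Suc k) mod (?p ^ n * ?p ^ k) = ?p ^ n * y k"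
      using Rep_zp_mod[of "k + n" "Suc k + n" z] by (simp only: zy power_add mult.commute)
    moreover have "?p ^ n * y (Suc k) mod (?p ^ n * ?p ^ k) = ?p ^ n * (y (Suc k) mod ?p ^ k)"
      by (rule mult_mod_right[symmetric])
    ultimately show ?thesis
      using prime_card_gt_0[where 'p='p] zero_less_power[OF prime_card_gt_0[where 'p='p], of n]
      by (simp add: zy power_add zero_le_mult_iff mult.commute[of "y k"])
  qed
  have "Rep_zp z k = Rep_zp (of_nat CARD('p) ^ n * Abs_zp y :: 'p zp) k" for k
  proof -
    have "Rep_zp (Abs_zp y :: 'p zp) = y"
      using y by (intro Abs_zp_inverse) auto
    moreover have "Rep_zp (of_nat CARD('p) ^ n :: 'p zp) k = ?p ^ n mod ?p ^ k"
      using of_nat_zp[of "CARD('p) ^ n" k, where 'p = 'p] by simp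
    ultimately have "Rep_zp (of_nat CARD('p) ^ n * Abs_zp y :: 'p zp) k = ?p ^ n * y k mod ?p ^ k"
      by (simp add: times_zp.rep_eq mod_simps)
    also have "\<dots> = Rep_zp z k"
      using Rep_zp_mod[of k "k + n" z] by (simp add: zy)
    finally show ?thesis by simp
  qed
  then have "z = of_nat CARD('p) ^ n * Abs_zp y"
    by (metis Rep_zp_inject ext)
  then show "of_nat CARD('p) ^ n dvd z"
    by simp
qed

lemma ideal_power_principal:
  fixes g :: "'a::{comm_ring_1,ideal_gens}"
  assumes "ideal_gens = {g}"
  shows "ideal_power n = {x. g ^ n dvd x}"
proof (rule subset_antisym; rule subsetI)
  fix x :: 'a assume "x \<in> ideal_power n"
  then show "x \<in> {x. g ^ n dvd x}"
  proof (rule ideal_power_span_induct)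
    fix gs :: "'a list"
    assume "length gs = n" "set gs \<subseteq> ideal_gens"
    then have "prod_list gs = g ^ n"
      unfolding assms by (induction gs arbitrary: n) auto
    then show "prod_list gs \<in> {x. g ^ n dvd x}" by simp
  qed auto
next
  fix x :: 'a assume "x \<in> {x. g ^ n dvd x}"
  moreover have "g ^ n \<in> ideal_power n"
    by (rule ideal_power_power) (simp add: assms ideal_gens_power_1)
  ultimately show "x \<in> ideal_power n"
    by (auto intro: ideal_power_mult2)
qed

lemma ideal_power_zp_dvd: "ideal_power n = {x :: 'p::prime_card zp. of_nat CARD('p) ^ n dvd x}"
  by (rule ideal_power_principal) (simp add: ideal_gens_zp_def)

lemma ideal_power_zp: "x \<in> ideal_power n \<longleftrightarrow> Rep_zp x n = 0"
  by (simp add: ideal_power_zp_dvd Rep_zp_eq_0_iff)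

instance zp :: (prime_card) complete_adic_ring
proof (standard, unfold adic_power_eq)
  show "finite (ideal_gens :: 'a zp set)"
    by (simp add: ideal_gens_zp_def)
next
  fix y :: "'a zp"
  assume "\<And>n. y \<in> ideal_power n"
  then have "Rep_zp y n = Rep_zp 0 n" for n
    by (simp add: ideal_power_zp zero_zp.rep_eq)
  then show "y = 0"
    by (metis Rep_zp_inject ext)
next
  fix x :: "nat \<Rightarrow> 'a zp"
  let ?p = "int CARD('a)"
  assume x: "\<And>n. x (Suc n) - x n \<in> ideal_power n"
  have eq: "Rep_zp (x (Suc n)) n = Rep_zp (x n) n" for n
  proof -
    have "(Rep_zp (x (Suc n)) n - Rep_zp (x n) n) mod ?p ^ n = 0"
      using x[of n] by (simp add: ideal_power_zp Rep_zp_diff)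
    then have "Rep_zp (x (Suc n)) n mod ?p ^ n = Rep_zp (x n) n mod ?p ^ n"
      by (simp add: mod_eq_dvd_iff mod_0_imp_dvd)
    then show ?thesis
      by (simp add: Rep_zp_mod)
  qed
  define l where "l n = Rep_zp (x n) n" for n
  have "l n \<in> {0..<?p ^ n} \<and> l (Suc n) mod ?p ^ n = l n" for n
    using Rep_zp[of "x n"] by (simp add: l_def Rep_zp_mod eq del: power_Suc)
  then have L: "Rep_zp (Abs_zp l :: 'a zp) = l"
    by (intro Abs_zp_inverse) auto
  have "Abs_zp l - x n \<in> ideal_power n" for n
    by (simp add: ideal_power_zp Rep_zp_diff L) (simp add: l_def)
  then show "\<exists>L. \<forall>n. L - x n \<in> ideal_power n"
    by blast
qed

text \<open>The condition on coefficients is a multiplicative filtration that contains X and the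
  constant generators in degree 1. Conversely, splitting off the constant term leaves X times a
  series that satisfies the condition for n - 1. Truncated subtraction leaves the coefficients from
  degree n on free.\<close>

lemma ideal_power_fps:
  "(f :: 'a::{adic_ring} fps) \<in> ideal_power n \<longleftrightarrow> (\<forall>i. fps_nth f i \<in> ideal_power (n - i))"
proof
  have *: "fps_nth f i \<in> ideal_power (n - i)"
    if "f \<in> ideal_power n" for i n and f :: "'a fps"
  proof -
    define L :: "nat \<Rightarrow> 'a fps set" where "L n = {f. \<forall>i. fps_nth f i \<in> ideal_power (n - i)}" for n
    have "id f \<in> L n"
    proof (rule hom_ideal_filtration[where f = id and L = L and x = f and n = n])
      show "comm_ring_hom (id :: 'a fps \<Rightarrow> _)"
        by unfold_locales auto
      show "id g \<in> L 1" if "g \<in> ideal_gens" for g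
      proof -
        have "fps_nth g i \<in> ideal_power (1 - i)" for i
          using that by (cases i) (auto simp: ideal_gens_fps_def ideal_power_0_UNIV ideal_gens_power_1)
        then show ?thesis by (simp add: L_def)
      qed
      show "x * y \<in> L (m + n)" if "x \<in> L m" "y \<in> L n" for x y m n
      proof -
        have "fps_nth (x * y) i \<in> ideal_power (m + n - i)" for i
          unfolding fps_mult_nth
        proof (rule ideal_power_sum)
          fix j assume j: "j \<in> {0..i}"
          have "fps_nth x j * fps_nth y (i - j) \<in> ideal_power ((m - j) + (n - (i - j)))"
            using that by (intro ideal_power_times) (auto simp: L_def)
          moreover have "m + n - i \<le> (m - j) + (n - (i - j))"
            using j by auto
          ultimately show "fps_nth x j * fps_nth y (i - j) \<in> ideal_power (m + n - i)"
            by (rule subsetD[OF ideal_power_antimono, rotated])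
        qed
        then show ?thesis unfolding L_def by blast
      qed
    next
      show "f \<in> ideal_power n" by fact
    qed (simp_all add: L_def ideal_power_0_UNIV ideal_power_add)
    then show ?thesis unfolding L_def by simp
  qed
  assume "f \<in> ideal_power n"
  then show "\<forall>i. fps_nth f i \<in> ideal_power (n - i)"
    by (intro allI *)
next
  assume "\<forall>i. fps_nth f i \<in> ideal_power (n - i)"
  then show "f \<in> ideal_power n"
  proof (induction n arbitrary: f)
    case (Suc n)
    have hom: "comm_ring_hom (fps_const :: 'a \<Rightarrow> _)"
      by unfold_locales simp_all
    have c: "fps_const c \<in> ideal_power m" if "c \<in> ideal_power m" for c :: 'a and m
      by (rule hom_ideal_power[OF hom that]) (simp add: ideal_gens_fps_def ideal_gens_power_1)
    have "fps_shift 1 f \<in> ideal_power n"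
    proof (rule Suc.IH, rule allI)
      fix i show "fps_nth (fps_shift 1 f) i \<in> ideal_power (n - i)"
        using Suc.prems[rule_format, of "Suc i"] by simp
    qed
    then have "fps_X * fps_shift 1 f \<in> ideal_power (1 + n)"
      by (intro ideal_power_times) (simp_all add: ideal_gens_fps_def ideal_gens_power_1)
    moreover have "f = fps_const (fps_nth f 0) + fps_X * fps_shift 1 f"
      by (rule fps_ext) auto
    moreover have "fps_const (fps_nth f 0) \<in> ideal_power (Suc n)"
      using Suc.prems[rule_format, of 0] c by simp
    ultimately show ?case
      by (metis ideal_power_add plus_1_eq_Suc)
  qed (simp add: ideal_power_0_UNIV)
qed

instance fps :: (complete_adic_ring) complete_adic_ring
proof (standard, unfold adic_power_eq)
  show "finite (ideal_gens :: 'a fps set)"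
    by (simp add: ideal_gens_fps_def finite_ideal_gens)
next
  fix y :: "'a fps"
  assume *: "\<And>n. y \<in> ideal_power n"
  have "fps_nth y i = 0" for i
  proof (rule adic_separated)
    fix n show "fps_nth y i \<in> ideal_power n"
      using *[of "n + i"] by (auto simp: ideal_power_fps dest: spec[of _ i])
  qed
  then show "y = 0" by (intro fps_ext) simp
next
  fix x :: "nat \<Rightarrow> 'a fps"
  assume x: "\<And>n. x (Suc n) - x n \<in> ideal_power n"
  \<comment> \<open>The i-th coefficient of \<open>x n\<close> is controlled only modulo the power n
    - i, so the sequence is read from index i on.\<close>
  have "\<exists>L. \<forall>n. L - fps_nth (x (n + i)) i \<in> ideal_power n" for i
  proof (rule adic_complete)
    fix n
    have "fps_nth (x (Suc (n + i)) - x (n + i)) i \<in> ideal_power (n + i - i)"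
      using x[of "n + i"] unfolding ideal_power_fps by blast
    then show "fps_nth (x (Suc n + i)) i - fps_nth (x (n + i)) i \<in> ideal_power n"
      by simp
  qed
  then obtain L where L: "\<And>i n. L i - fps_nth (x (n + i)) i \<in> ideal_power n"
    by metis
  have "Abs_fps L - x n \<in> ideal_power n" for n
    unfolding ideal_power_fps
  proof
    fix i
    show "fps_nth (Abs_fps L - x n) i \<in> ideal_power (n - i)"
    proof (cases "i \<le> n")
      case True
      then show ?thesis using L[of i "n - i"] by simp
    qed (simp add: ideal_power_0_UNIV)
  qed
  then show "\<exists>L. \<forall>n. L - x n \<in> ideal_power n" by blast
qed

section \<open>Power series with coefficients in an ideal\<close>

text \<open>This is not \<open>ideal_power\<close> of the power series ring: there the variable
  belongs to the ideal of definition, whereas \<lambda> is not topologically nilpotent in S'. Only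
  the coefficients are filtered here.\<close>

definition coeff_ideal :: "nat \<Rightarrow> 'c::adic_ring fps set" where
  "coeff_ideal n = {f. \<forall>i. fps_nth f i \<in> ideal_power n}"

lemma coeff_ideal_0_UNIV: "coeff_ideal 0 = UNIV"
  by (simp add: coeff_ideal_def ideal_power_0_UNIV)

lemma coeff_ideal_zero [simp]: "0 \<in> coeff_ideal n"
  by (simp add: coeff_ideal_def)

lemma coeff_ideal_add: "x \<in> coeff_ideal n \<Longrightarrow> y \<in> coeff_ideal n \<Longrightarrow> x + y \<in> coeff_ideal n"
  by (simp add: coeff_ideal_def ideal_power_add)

lemma coeff_ideal_diff: "x \<in> coeff_ideal n \<Longrightarrow> y \<in> coeff_ideal n \<Longrightarrow> x - y \<in> coeff_ideal n"
  by (simp add: coeff_ideal_def ideal_power_diff)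

lemma coeff_ideal_times: "x \<in> coeff_ideal m \<Longrightarrow> y \<in> coeff_ideal n \<Longrightarrow> x * y \<in> coeff_ideal (m + n)"
  by (auto simp: coeff_ideal_def fps_mult_nth intro!: ideal_power_sum ideal_power_times)

lemma coeff_ideal_mult: "x \<in> coeff_ideal n \<Longrightarrow> c * x \<in> coeff_ideal n"
  using coeff_ideal_times[of c 0 x n] by (simp add: coeff_ideal_0_UNIV)

lemma coeff_ideal_mult2: "x \<in> coeff_ideal n \<Longrightarrow> x * c \<in> coeff_ideal n"
  using coeff_ideal_mult[of x n c] by (simp add: mult.commute)

lemma coeff_ideal_sum: "(\<And>i. i \<in> A \<Longrightarrow> f i \<in> coeff_ideal n) \<Longrightarrow> sum f A \<in> coeff_ideal n"
  by (induction A rule: infinite_finite_induct) (auto intro: coeff_ideal_add)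

lemma coeff_ideal_antimono: "m \<le> n \<Longrightarrow> coeff_ideal n \<subseteq> coeff_ideal m"
  using ideal_power_antimono[of m n] by (auto simp: coeff_ideal_def)

lemma coeff_ideal_swap: "x - y \<in> coeff_ideal n \<longleftrightarrow> y - x \<in> coeff_ideal n"
  by (simp add: coeff_ideal_def ideal_power_swap[of "fps_nth x _" "fps_nth y _"])

lemma coeff_ideal_trans: "x - y \<in> coeff_ideal n \<Longrightarrow> y - z \<in> coeff_ideal n \<Longrightarrow> x - z \<in> coeff_ideal n"
  using coeff_ideal_add[of "x - y" n "y - z"] by simp

lemma coeff_ideal_mult_cong:
  assumes "a - b \<in> coeff_ideal n" "c - d \<in> coeff_ideal n"
  shows "a * c - b * d \<in> coeff_ideal n"
proof -
  have "a * c - b * d = c * (a - b) + b * (c - d)"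
    by (simp add: algebra_simps)
  then show ?thesis
    using assms by (simp add: coeff_ideal_add coeff_ideal_mult)
qed

lemma coeff_ideal_const: "c \<in> ideal_power n \<Longrightarrow> fps_const c \<in> coeff_ideal n"
  by (simp add: coeff_ideal_def)

lemma coeff_ideal_separated:
  assumes "\<And>n. x \<in> coeff_ideal n"
  shows "x = (0 :: 'c::complete_adic_ring fps)"
  using assms by (intro fps_ext) (auto simp: coeff_ideal_def intro: adic_separated)

lemma coeff_ideal_separated_eq:
  assumes "\<And>n. x - y \<in> coeff_ideal n"
  shows "x = (y :: 'c::complete_adic_ring fps)"
  using coeff_ideal_separated[OF assms] by simp

section \<open>The expansion of elements of \<open>C[\<lambda>, 1/h(\<lambda>)]\<close> at \<open>\<lambda> = 0\<close>\<close>

text \<open>All presentations a / h^n are quantified over, so that no representative has to be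
  chosen; h has constant term 1 and is a unit among power series.\<close>

definition hloc_exp :: "('p::finite, 'c::idom) hloc \<Rightarrow> 'c fps" where
  "hloc_exp x = (THE y. \<forall>a n. Rep_hloc x = Fraction_Field.Fract a (hasse_poly CARD('p) ^ n)
     \<longrightarrow> fps_of_poly (hasse_poly CARD('p)) ^ n * y = fps_of_poly a)"

lemma fps_of_hasse_poly_neq_0 [simp]: "fps_of_poly (hasse_poly p) \<noteq> 0"
  by (metis fps_of_poly_eq_iff fps_of_poly_0 hasse_poly_neq_0)

lemma fps_of_hasse_poly_inverse: "\<exists>y. fps_of_poly (hasse_poly p) * y = 1"
  by (rule exI[of _ "fps_right_inverse (fps_of_poly (hasse_poly p)) 1"], rule fps_right_inverse)
    (simp add: coeff_hasse_poly_0)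

lemma hloc_exp_eq:
  fixes x :: "('p::finite, 'c::idom) hloc"
  assumes "Rep_hloc x = Fraction_Field.Fract a (hasse_poly CARD('p) ^ n)"
  shows "fps_of_poly (hasse_poly CARD('p)) ^ n * hloc_exp x = fps_of_poly a"
proof -
  let ?h = "hasse_poly CARD('p) :: 'c poly"
  let ?H = "fps_of_poly ?h"
  obtain y where y: "?H * y = 1"
    using fps_of_hasse_poly_inverse by blast
  obtain b m where b: "Rep_hloc x = Fraction_Field.Fract b (?h ^ m)"
    using Rep_hloc[of x] by blast
  have *: "?H ^ k * (fps_of_poly b * y ^ m) = fps_of_poly c"
    if "Rep_hloc x = Fraction_Field.Fract c (?h ^ k)" for c k
  proof -
    have "c * ?h ^ m = b * ?h ^ k"
      using that b by (simp add: eq_fract(1))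
    then have "fps_of_poly c * ?H ^ m = fps_of_poly b * ?H ^ k"
      by (metis fps_of_poly_mult fps_of_poly_power)
    then have "fps_of_poly c * ?H ^ m * y ^ m = ?H ^ k * (fps_of_poly b * y ^ m)"
      by (simp add: ac_simps)
    then show ?thesis
      by (simp add: mult.assoc y flip: power_mult_distrib)
  qed
  have "\<forall>a n. Rep_hloc x = Fraction_Field.Fract a (?h ^ n) \<longrightarrow> ?H ^ n * hloc_exp x = fps_of_poly a"
    unfolding hloc_exp_def
  proof (rule theI[of _ "fps_of_poly b * y ^ m"])
    fix z
    assume "\<forall>a n. Rep_hloc x = Fraction_Field.Fract a (?h ^ n) \<longrightarrow> ?H ^ n * z = fps_of_poly a"
    then have "?H ^ m * z = ?H ^ m * (fps_of_poly b * y ^ m)"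
      using * b by simp
    then show "z = fps_of_poly b * y ^ m"
      by simp
  qed (use * in blast)
  then show ?thesis
    using assms by blast
qed

lemma hloc_expI:
  fixes x :: "('p::finite, 'c::idom) hloc"
  assumes "Rep_hloc x = Fraction_Field.Fract a (hasse_poly CARD('p) ^ n)"
    and "fps_of_poly (hasse_poly CARD('p)) ^ n * y = fps_of_poly a"
  shows "hloc_exp x = y"
proof -
  have "fps_of_poly (hasse_poly CARD('p)) ^ n * hloc_exp x = fps_of_poly (hasse_poly CARD('p)) ^ n * y"
    using hloc_exp_eq[OF assms(1)] assms(2) by simp
  then show ?thesis
    by simp
qed

lemma hloc_exp_of_poly: "hloc_exp (hloc_of_poly a :: ('p::finite, 'c::idom) hloc) = fps_of_poly a"
  by (rule hloc_expI[of _ a 0]) (simp_all add: Rep_hloc_of_poly)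

lemma hloc_exp_hom: "comm_ring_hom (hloc_exp :: ('p::finite, 'c::idom) hloc \<Rightarrow> 'c fps)"
proof
  let ?h = "hasse_poly CARD('p) :: 'c poly"
  fix x y :: "('p, 'c) hloc"
  obtain a m where a: "Rep_hloc x = Fraction_Field.Fract a (?h ^ m)"
    using Rep_hloc[of x] by blast
  obtain b n where b: "Rep_hloc y = Fraction_Field.Fract b (?h ^ n)"
    using Rep_hloc[of y] by blast
  show "hloc_exp (x + y) = hloc_exp x + hloc_exp y"
  proof (rule hloc_expI)
    show "Rep_hloc (x + y) = Fraction_Field.Fract (a * ?h ^ n + b * ?h ^ m) (?h ^ (m + n))"
      by (simp add: plus_hloc.rep_eq a b power_add)
    show "fps_of_poly ?h ^ (m + n) * (hloc_exp x + hloc_exp y) = fps_of_poly (a * ?h ^ n + b * ?h ^ m)"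
      by (simp add: fps_of_poly_add fps_of_poly_mult fps_of_poly_power power_add distrib_left
          flip: hloc_exp_eq[OF a] hloc_exp_eq[OF b])
  qed
  show "hloc_exp (x * y) = hloc_exp x * hloc_exp y"
  proof (rule hloc_expI)
    show "Rep_hloc (x * y) = Fraction_Field.Fract (a * b) (?h ^ (m + n))"
      by (simp add: times_hloc.rep_eq a b power_add)
    show "fps_of_poly ?h ^ (m + n) * (hloc_exp x * hloc_exp y) = fps_of_poly (a * b)"
      by (simp add: fps_of_poly_mult power_add
          flip: hloc_exp_eq[OF a] hloc_exp_eq[OF b])
  qed
next
  show "hloc_exp (1 :: ('p, 'c) hloc) = 1"
    by (rule hloc_expI[of _ 1 0]) (simp_all add: one_hloc.rep_eq One_fract_def)
  show "hloc_exp (0 :: ('p, 'c) hloc) = 0"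
    by (rule hloc_expI[of _ 0 0]) (simp_all add: zero_hloc.rep_eq Zero_fract_def)
qed

interpretation hloc_exp: comm_ring_hom "hloc_exp :: ('p::finite, 'c::idom) hloc \<Rightarrow> 'c fps"
  by (rule hloc_exp_hom)

lemma hloc_of_poly_hom: "comm_ring_hom (hloc_of_poly :: 'c::idom poly \<Rightarrow> ('p::finite, 'c) hloc)"
  by unfold_locales
    (simp_all add: Rep_hloc_inject[symmetric] Rep_hloc_of_poly plus_hloc.rep_eq times_hloc.rep_eq
      one_hloc.rep_eq zero_hloc.rep_eq One_fract_def Zero_fract_def)

interpretation hloc_of_poly: comm_ring_hom "hloc_of_poly :: 'c::idom poly \<Rightarrow> ('p::finite, 'c) hloc"
  by (rule hloc_of_poly_hom)

lemma hloc_h_inverse: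
  "\<exists>y. hloc_of_poly (hasse_poly CARD('p)) * y = (1 :: ('p::finite, 'c::idom) hloc)"
proof -
  let ?y = "Abs_hloc (Fraction_Field.Fract 1 (hasse_poly CARD('p))) :: ('p, 'c) hloc"
  have y: "Rep_hloc ?y = Fraction_Field.Fract 1 (hasse_poly CARD('p))"
    by (rule Abs_hloc_inverse, rule CollectI, rule exI[of _ 1], rule exI[of _ 1]) simp
  have "hloc_of_poly (hasse_poly CARD('p)) * ?y = 1"
    unfolding Rep_hloc_inject[symmetric] times_hloc.rep_eq one_hloc.rep_eq Rep_hloc_of_poly y
    by (simp add: One_fract_def eq_fract(1))
  then show ?thesis ..
qed

lemma hloc_cases:
  fixes x :: "('p::finite, 'c::idom) hloc"
  obtains a n where "hloc_of_poly (hasse_poly CARD('p)) ^ n * x = hloc_of_poly a"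
proof -
  obtain a n where a: "Rep_hloc x = Fraction_Field.Fract a (hasse_poly CARD('p) ^ n)"
    using Rep_hloc[of x] by blast
  have "hloc_of_poly (hasse_poly CARD('p)) ^ n * x = hloc_of_poly a"
    unfolding Rep_hloc_inject[symmetric] hloc_of_poly.hom_power[symmetric] times_hloc.rep_eq Rep_hloc_of_poly a
    by (simp add: eq_fract(1))
  then show ?thesis by (rule that)
qed

lemma poly_eq_sum_const: "(a :: 'a::comm_ring_1 poly) = (\<Sum>i\<le>degree a. [:coeff a i:] * monom 1 i)"
  using poly_as_sum_of_monoms[of a] by (simp add: smult_monom)

lemma hloc_of_poly_ideal_power:
  assumes "\<And>i. coeff a i \<in> ideal_power n"
  shows "(hloc_of_poly a :: ('p::finite, 'c::{idom,adic_ring}) hloc) \<in> ideal_power n"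
proof -
  have hom: "comm_ring_hom (\<lambda>c. hloc_of_poly [:c:] :: ('p, 'c) hloc)"
    by unfold_locales (simp_all flip: hloc_of_poly.hom_add hloc_of_poly.hom_mult
        hloc_of_poly.hom_one hloc_of_poly.hom_zero add: one_pCons mult.commute)
  have c: "(hloc_of_poly [:c:] :: ('p, 'c) hloc) \<in> ideal_power n" if "c \<in> ideal_power n" for c
    by (rule hom_ideal_power[OF hom that]) (simp add: ideal_gens_hloc_def ideal_gens_power_1)
  have "hloc_of_poly a = (\<Sum>i\<le>degree a. hloc_of_poly [:coeff a i:] * hloc_of_poly (monom 1 i) :: ('p, 'c) hloc)"
    by (subst poly_eq_sum_const[of a]) (simp only: hloc_of_poly.hom_sum hloc_of_poly.hom_mult)
  also have "\<dots> \<in> ideal_power n"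
    by (intro ideal_power_sum ideal_power_mult2 c assms)
  finally show ?thesis .
qed

text \<open>Since h is invertible on both sides, it suffices to look at the numerator, whose
  coefficients are the same as a polynomial and as a series. This equivalence makes the expansion of
  the completion injective and its image closed.\<close>

lemma hloc_exp_ideal_power_iff:
  fixes x :: "('p::finite, 'c::{idom,adic_ring}) hloc"
  shows "hloc_exp x \<in> coeff_ideal n \<longleftrightarrow> x \<in> ideal_power n"
proof
  assume "x \<in> ideal_power n"
  with hloc_exp_hom show "hloc_exp x \<in> coeff_ideal n"
    by (rule hom_ideal_filtration[where L = coeff_ideal])
      (auto simp: ideal_gens_hloc_def hloc_exp_of_poly coeff_ideal_0_UNIV fps_of_poly_const
        intro!: coeff_ideal_add coeff_ideal_times coeff_ideal_const ideal_gens_power_1[simplified])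
next
  assume x: "hloc_exp x \<in> coeff_ideal n"
  obtain a k where a: "hloc_of_poly (hasse_poly CARD('p)) ^ k * x = hloc_of_poly a"
    by (rule hloc_cases)
  then have "hloc_exp (hloc_of_poly a :: ('p, 'c) hloc) = hloc_exp (hloc_of_poly (hasse_poly CARD('p)) ^ k * x)"
    by simp
  then have "fps_of_poly a = fps_of_poly (hasse_poly CARD('p)) ^ k * hloc_exp x"
    by (simp add: hloc_exp_of_poly hloc_exp.hom_mult hloc_exp.hom_power)
  then have "fps_of_poly a \<in> coeff_ideal n"
    using x by (simp add: coeff_ideal_mult)
  then have "(hloc_of_poly a :: ('p, 'c) hloc) \<in> ideal_power n"
    by (intro hloc_of_poly_ideal_power) (auto simp: coeff_ideal_def)
  moreover obtain y :: "('p, 'c) hloc" where "hloc_of_poly (hasse_poly CARD('p)) * y = 1"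
    using hloc_h_inverse by blast
  then have "x = y ^ k * hloc_of_poly a"
    by (simp flip: a power_mult_distrib mult.assoc add: mult.commute[of y])
  ultimately show "x \<in> ideal_power n"
    by (simp add: ideal_power_mult)
qed

section \<open>The expansion of elements of the completion\<close>

definition adic_lim :: "(nat \<Rightarrow> 'c::complete_adic_ring) \<Rightarrow> 'c" where
  "adic_lim x = (THE L. \<forall>n. L - x n \<in> ideal_power n)"

lemma adic_lim_eqI: "(\<And>n. L - x n \<in> ideal_power n) \<Longrightarrow> adic_lim x = L"
  unfolding adic_lim_def
proof (rule the_equality)
  fix L' assume *: "\<And>n. L - x n \<in> ideal_power n" "\<forall>n. L' - x n \<in> ideal_power n"
  have "L' - L \<in> ideal_power n" for n
    using * by (intro ideal_power_trans[of L' "x n" n L]) (auto simp: ideal_power_swap[of "x n"])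
  then show "L' = L"
    using adic_separated[of "L' - L"] by simp
qed blast

lemma adic_lim:
  assumes "\<And>n. x (Suc n) - x n \<in> ideal_power n"
  shows "adic_lim x - x n \<in> ideal_power n"
  using adic_complete[of x, OF assms] adic_lim_eqI[of _ x] by metis

lemma hloc_exp_diff_ideal_power:
  fixes x y :: "('p::finite, 'c::{idom,adic_ring}) hloc"
  shows "hloc_exp x - hloc_exp y \<in> coeff_ideal n \<longleftrightarrow> x - y \<in> ideal_power n"
  by (simp flip: hloc_exp.hom_minus hloc_exp_ideal_power_iff)

lift_definition lexp :: "('p::finite, 'c::complete_adic_ring) hloc completion \<Rightarrow> 'c fps"
  is "\<lambda>x. Abs_fps (\<lambda>i. adic_lim (\<lambda>n. fps_nth (hloc_exp (x n)) i))"
proof -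
  fix x y :: "nat \<Rightarrow> ('p, 'c) hloc"
  assume xy: "adic_rel x y"
  have "adic_lim (\<lambda>n. fps_nth (hloc_exp (x n)) i) = adic_lim (\<lambda>n. fps_nth (hloc_exp (y n)) i)" for i
  proof (rule sym, rule adic_lim_eqI)
    fix n
    have "adic_lim (\<lambda>n. fps_nth (hloc_exp (x n)) i) - fps_nth (hloc_exp (x n)) i \<in> ideal_power n"
    proof (rule adic_lim)
      fix n
      have "hloc_exp (x (Suc n)) - hloc_exp (x n) \<in> coeff_ideal n"
        using xy by (simp add: adic_rel_def hloc_exp_diff_ideal_power)
      then show "fps_nth (hloc_exp (x (Suc n))) i - fps_nth (hloc_exp (x n)) i \<in> ideal_power n"
        by (simp add: coeff_ideal_def)
    qed
    moreover have "hloc_exp (x n) - hloc_exp (y n) \<in> coeff_ideal n"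
      using xy by (simp add: adic_rel_def hloc_exp_diff_ideal_power)
    then have "fps_nth (hloc_exp (x n)) i - fps_nth (hloc_exp (y n)) i \<in> ideal_power n"
      by (simp add: coeff_ideal_def)
    ultimately show "adic_lim (\<lambda>n. fps_nth (hloc_exp (x n)) i) - fps_nth (hloc_exp (y n)) i \<in> ideal_power n"
      by (rule ideal_power_trans)
  qed
  then show "Abs_fps (\<lambda>i. adic_lim (\<lambda>n. fps_nth (hloc_exp (x n)) i))
      = Abs_fps (\<lambda>i. adic_lim (\<lambda>n. fps_nth (hloc_exp (y n)) i))"
    by simp
qed

lemma abs_completion_cases:
  fixes z :: "'a::adic_ring completion"
  obtains x where "adic_rel x x" "z = abs_completion x"
  using Quotient_abs_rep[OF Quotient_completion, of z] Quotient_rep_reflp[OF Quotient_completion, of z]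
  by metis

lemma abs_completion_eq_iff:
  "adic_rel x x \<Longrightarrow> adic_rel y y \<Longrightarrow> abs_completion x = abs_completion y \<longleftrightarrow> adic_rel x y"
  using Quotient_rel[OF Quotient_completion] by metis

lemma lexp_abs_completion:
  fixes x :: "nat \<Rightarrow> ('p::finite, 'c::complete_adic_ring) hloc"
  assumes "adic_rel x x"
  shows "lexp (abs_completion x) - hloc_exp (x n) \<in> coeff_ideal n"
proof -
  have "adic_lim (\<lambda>n. fps_nth (hloc_exp (x n)) i) - fps_nth (hloc_exp (x n)) i \<in> ideal_power n" for i
  proof (rule adic_lim)
    fix n
    have "hloc_exp (x (Suc n)) - hloc_exp (x n) \<in> coeff_ideal n"
      using assms by (simp add: adic_rel_def hloc_exp_diff_ideal_power)
    then show "fps_nth (hloc_exp (x (Suc n))) i - fps_nth (hloc_exp (x n)) i \<in> ideal_power n"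
      by (simp add: coeff_ideal_def)
  qed
  then show ?thesis
    using assms by (simp add: coeff_ideal_def lexp.abs_eq)
qed

lemma lexp_approx:
  fixes z :: "('p::finite, 'c::complete_adic_ring) hloc completion"
  shows "\<exists>x :: ('p, 'c) hloc. lexp z - hloc_exp x \<in> coeff_ideal n"
proof -
  obtain x where "adic_rel x x" "z = abs_completion x" by (rule abs_completion_cases)
  then show ?thesis using lexp_abs_completion[of x n] by auto
qed

lemma lexp_eqI:
  fixes x :: "nat \<Rightarrow> ('p::finite, 'c::complete_adic_ring) hloc"
  assumes "adic_rel x x" "\<And>n. y - hloc_exp (x n) \<in> coeff_ideal n"
  shows "lexp (abs_completion x) = y"
proof (rule coeff_ideal_separated_eq)
  fix n show "lexp (abs_completion x) - y \<in> coeff_ideal n"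
    using lexp_abs_completion[OF assms(1), of n] assms(2)[of n]
    by (auto intro: coeff_ideal_trans simp: coeff_ideal_swap[of y])
qed

lemma lexp_completion_of: "lexp (completion_of x) = hloc_exp x"
  unfolding completion_of.abs_eq by (rule lexp_eqI) (auto simp: adic_rel_def)

lemma lexp_hom: "comm_ring_hom (lexp :: ('p::finite, 'c::complete_adic_ring) hloc completion \<Rightarrow> 'c fps)"
proof
  fix z w :: "('p, 'c) hloc completion"
  obtain x where x: "adic_rel x x" "z = abs_completion x" by (rule abs_completion_cases)
  obtain y where y: "adic_rel y y" "w = abs_completion y" by (rule abs_completion_cases)
  note * = lexp_abs_completion[OF x(1)] lexp_abs_completion[OF y(1)]
  show "lexp (z + w) = lexp z + lexp w"
    unfolding x y plus_completion.abs_eq[OF x(1) y(1)]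
    by (rule lexp_eqI)
      (use x(1) y(1) coeff_ideal_add[OF *] in \<open>auto simp: adic_rel_def hloc_exp.hom_add ideal_power_add_diff algebra_simps\<close>)
  show "lexp (z * w) = lexp z * lexp w"
    unfolding x y times_completion.abs_eq[OF x(1) y(1)]
    by (rule lexp_eqI)
      (use x(1) y(1) coeff_ideal_mult_cong[OF *] in \<open>auto simp: adic_rel_def hloc_exp.hom_mult ideal_power_mult_diff\<close>)
next
  show "lexp (1 :: ('p, 'c) hloc completion) = 1" "lexp (0 :: ('p, 'c) hloc completion) = 0"
    using lexp_completion_of[of 1] lexp_completion_of[of 0]
    by (simp_all add: completion_of_def one_completion_def zero_completion_def hloc_exp.hom_one)
qed

interpretation lexp: comm_ring_hom "lexp :: ('p::finite, 'c::complete_adic_ring) hloc completion \<Rightarrow> 'c fps"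
  by (rule lexp_hom)

lemma lexp_algebra_map: "lexp (algebra_map c) = fps_const c"
  by (simp add: algebra_map_def lexp_completion_of hloc_exp_of_poly)

lemma lexp_lam: "lexp lam = fps_X"
  by (simp add: lam_def lexp_completion_of hloc_exp_of_poly fps_of_poly_pCons)

text \<open>Expansions of fractions reflect ideal powers, so two sequences with the same limit agree
  at every stage. Identities in S' and B' can thus be proved for power series.\<close>

lemma lexp_inj: "lexp z = lexp w \<longleftrightarrow> z = w"
proof
  assume "lexp z = lexp w"
  obtain x where x: "adic_rel x x" "z = abs_completion x" by (rule abs_completion_cases)
  obtain y where y: "adic_rel y y" "w = abs_completion y" by (rule abs_completion_cases)
  have "x n - y n \<in> ideal_power n" for n
    unfolding hloc_exp_diff_ideal_power[symmetric]
    using lexp_abs_completion[OF x(1), of n] lexp_abs_completion[OF y(1), of n] \<open>lexp z = lexp w\<close> x(2) y(2)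
    by (metis coeff_ideal_swap coeff_ideal_trans)
  then show "z = w"
    unfolding x y using x(1) y(1) by (subst abs_completion_eq_iff) (auto simp: adic_rel_def)
qed simp

lemma range_lexp_iff:
  "y \<in> range (lexp :: ('p::finite, 'c::complete_adic_ring) hloc completion \<Rightarrow> 'c fps)
    \<longleftrightarrow> (\<forall>n. \<exists>x :: ('p, 'c) hloc. y - hloc_exp x \<in> coeff_ideal n)"
proof
  assume "\<forall>n. \<exists>x :: ('p, 'c) hloc. y - hloc_exp x \<in> coeff_ideal n"
  then obtain x :: "nat \<Rightarrow> ('p, 'c) hloc" where x: "\<And>n. y - hloc_exp (x n) \<in> coeff_ideal n"
    by metis
  have "x (Suc n) - x n \<in> ideal_power n" for n
    unfolding hloc_exp_diff_ideal_power[symmetric]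
    using x[of n] coeff_ideal_antimono[of n "Suc n"] x[of "Suc n"]
    by (meson coeff_ideal_swap coeff_ideal_trans le_SucI order_refl subsetD)
  then have "adic_rel x x"
    by (simp add: adic_rel_def)
  then have "lexp (abs_completion x) = y"
    using x by (rule lexp_eqI)
  then show "y \<in> range (lexp :: ('p, 'c) hloc completion \<Rightarrow> 'c fps)" by blast
qed (use lexp_approx in blast)


section \<open>Continuity\<close>

lemma completion_of_hom: "comm_ring_hom (completion_of :: 'a::adic_ring \<Rightarrow> 'a completion)"
  by unfold_locales (transfer, simp add: adic_rel_def)+

interpretation completion_of: comm_ring_hom "completion_of :: 'a::adic_ring \<Rightarrow> 'a completion"
  by (rule completion_of_hom)

lemma completion_of_ideal_power: "x \<in> ideal_power n \<Longrightarrow> completion_of x \<in> ideal_power n"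
  by (rule hom_ideal_power[OF completion_of_hom])
    (auto simp: ideal_gens_completion_def intro!: ideal_gens_power_1[simplified])

lemma algebra_map_hom: "comm_ring_hom (algebra_map :: 'c::{idom,adic_ring} \<Rightarrow> ('p::finite, 'c) hloc completion)"
proof -
  have "comm_ring_hom (\<lambda>c. hloc_of_poly [:c:] :: ('p, 'c) hloc)"
    by unfold_locales (simp_all flip: hloc_of_poly.hom_add hloc_of_poly.hom_mult
        hloc_of_poly.hom_one hloc_of_poly.hom_zero add: one_pCons mult.commute)
  then interpret comm_ring_hom "\<lambda>c. hloc_of_poly [:c:] :: ('p, 'c) hloc" .
  show ?thesis
    unfolding algebra_map_def
    by unfold_locales (simp_all add: hom_add hom_mult completion_of.hom_add completion_of.hom_mult)
qed

interpretation algebra_map: comm_ring_hom "algebra_map :: 'c::{idom,adic_ring} \<Rightarrow> ('p::finite, 'c) hloc completion"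
  by (rule algebra_map_hom)

lemma ideal_gens_hloc_completion:
  "(ideal_gens :: ('p::finite, 'c::{idom,adic_ring}) hloc completion set) = algebra_map ` ideal_gens"
  by (simp add: ideal_gens_completion_def ideal_gens_hloc_def algebra_map_def image_image)

section \<open>Ideal powers and density in the completion\<close>

definition gen_products :: "nat \<Rightarrow> 'a::{comm_ring_1,ideal_gens} set" where
  "gen_products n = {prod_list gs | gs. length gs = n \<and> set gs \<subseteq> ideal_gens}"

lemma gen_products_ideal_power: "g \<in> gen_products n \<Longrightarrow> g \<in> ideal_power n"
  unfolding ideal_power_def gen_products_def by (rule module.span_base[OF module_mult])

lemma finite_gen_products:
  assumes "finite (ideal_gens :: 'a::{comm_ring_1,ideal_gens} set)"
  shows "finite (gen_products n :: 'a set)"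
proof -
  have "gen_products n = prod_list ` {gs :: 'a list. set gs \<subseteq> ideal_gens \<and> length gs = n}"
    by (auto simp: gen_products_def)
  then show ?thesis
    using finite_lists_length_eq[OF assms, of n] by simp
qed

text \<open>Products of n + m generators are cut after n factors. The finite family of monomials is
  the same for all m, so the coefficients of each monomial can later be summed to a limit.\<close>

lemma ideal_power_decomp:
  fixes w :: "'a::{comm_ring_1,ideal_gens}"
  assumes fin: "finite (ideal_gens :: 'a set)" and w: "w \<in> ideal_power (n + m)"
  shows "\<exists>y. (\<forall>g. y g \<in> ideal_power m) \<and> w = (\<Sum>g\<in>gen_products n. g * y g)"
  using w
proof (rule ideal_power_span_induct)
  fix gs :: "'a list"
  assume gs: "length gs = n + m" "set gs \<subseteq> ideal_gens"
  let ?g = "prod_list (take n gs)" and ?h = "prod_list (drop n gs)"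
  have "?g \<in> gen_products n" "?h \<in> gen_products m"
    using gs set_take_subset[of n gs] set_drop_subset[of n gs] unfolding gen_products_def
    by (force intro!: exI[of _ "take n gs"], force intro!: exI[of _ "drop n gs"])
  moreover have "prod_list gs = ?g * ?h"
    by (metis append_take_drop_id prod_list.append)
  ultimately show "\<exists>y. (\<forall>g. y g \<in> ideal_power m) \<and> prod_list gs = (\<Sum>g\<in>gen_products n. g * y g)"
    by (intro exI[of _ "\<lambda>g. if g = ?g then ?h else 0"])
      (simp add: gen_products_ideal_power if_distrib sum.delta finite_gen_products[OF fin] cong: if_cong)
next
  show "\<exists>y. (\<forall>g. y g \<in> ideal_power m) \<and> 0 = (\<Sum>g\<in>gen_products n. g * y g :: 'a)"
    by (intro exI[of _ "\<lambda>_. 0"]) simp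
next
  fix u v :: 'a
  assume "\<exists>y. (\<forall>g. y g \<in> ideal_power m) \<and> u = (\<Sum>g\<in>gen_products n. g * y g)"
    "\<exists>y. (\<forall>g. y g \<in> ideal_power m) \<and> v = (\<Sum>g\<in>gen_products n. g * y g)"
  then obtain y z where "\<And>g. y g \<in> ideal_power m" "u = (\<Sum>g\<in>gen_products n. g * y g)"
    "\<And>g. z g \<in> ideal_power m" "v = (\<Sum>g\<in>gen_products n. g * z g)"
    by blast
  then show "\<exists>y. (\<forall>g. y g \<in> ideal_power m) \<and> u + v = (\<Sum>g\<in>gen_products n. g * y g)"
    by (intro exI[of _ "\<lambda>g. y g + z g"]) (simp add: ideal_power_add distrib_left sum.distrib)
next
  fix c u :: 'a
  assume "\<exists>y. (\<forall>g. y g \<in> ideal_power m) \<and> u = (\<Sum>g\<in>gen_products n. g * y g)"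
  then obtain y where "\<And>g. y g \<in> ideal_power m" "u = (\<Sum>g\<in>gen_products n. g * y g)"
    by blast
  then show "\<exists>y. (\<forall>g. y g \<in> ideal_power m) \<and> c * u = (\<Sum>g\<in>gen_products n. g * y g)"
    by (intro exI[of _ "\<lambda>g. c * y g"]) (simp add: ideal_power_mult sum_distrib_left mult.left_commute)
qed

lemma sum_telescope_nat: "(\<Sum>k<n. f (Suc k) - f k) = f n - (f 0 :: 'a::ab_group_add)"
  by (induction n) auto

lemma abs_completion_sum:
  fixes Y :: "'b \<Rightarrow> nat \<Rightarrow> 'a::adic_ring"
  assumes "finite A" "\<And>g. adic_rel (Y g) (Y g)"
  shows "adic_rel (\<lambda>k. \<Sum>g\<in>A. c g * Y g k) (\<lambda>k. \<Sum>g\<in>A. c g * Y g k) \<and>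
    (\<Sum>g\<in>A. completion_of (c g) * abs_completion (Y g)) = abs_completion (\<lambda>k. \<Sum>g\<in>A. c g * Y g k)"
  using assms(1)
proof induction
  case empty
  then show ?case by (simp add: adic_rel_def zero_completion_def)
next
  case (insert x F)
  have "adic_rel (\<lambda>_. c x) (\<lambda>_. c x)"
    by (simp add: adic_rel_def)
  then have 1: "completion_of (c x) * abs_completion (Y x) = abs_completion (\<lambda>k. c x * Y x k)"
    by (simp add: completion_of.abs_eq times_completion.abs_eq assms(2))
  have 2: "adic_rel (\<lambda>k. c x * Y x k) (\<lambda>k. c x * Y x k)"
    using assms(2)[of x] by (auto simp: adic_rel_def intro: ideal_power_mult simp flip: right_diff_distrib)
  have 3: "adic_rel (\<lambda>k. \<Sum>g\<in>F. c g * Y g k) (\<lambda>k. \<Sum>g\<in>F. c g * Y g k)"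
    using insert by blast
  show ?case
    using insert 1 2 3 plus_completion.abs_eq[OF 2 3]
    by (auto simp: adic_rel_def ideal_power_add_diff)
qed

text \<open>The kernel of the projection of the completion onto the quotient by the \<open>n\<close>-th power of the
  ideal is generated by that power because the ideal is finitely generated.\<close>

lemma abs_completion_ideal_power:
  fixes x :: "nat \<Rightarrow> 'a::adic_ring"
  assumes fin: "finite (ideal_gens :: 'a set)" and x: "adic_rel x x" "x n \<in> ideal_power n"
  shows "abs_completion x \<in> ideal_power n"
proof -
  have "x (Suc (n + k)) - x (n + k) \<in> ideal_power (n + k)" for k
    using x(1) by (simp add: adic_rel_def)
  from ideal_power_decomp[OF fin this]
  obtain y where y: "\<And>k g. y k g \<in> ideal_power k"
    "\<And>k. x (Suc (n + k)) - x (n + k) = (\<Sum>g\<in>gen_products n. g * y k g)"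
    by metis
  obtain y0 where y0: "x n = (\<Sum>g\<in>gen_products n. g * y0 g)"
    using ideal_power_decomp[OF fin, of "x n" n 0] x(2) by auto
  \<comment> \<open>The sequence is telescoped from its n-th term on. For a fixed monomial g the
    coefficients add up to the Cauchy sequence \<open>Y g\<close>, so the limit is a combination of
    the finitely many g.\<close>
  define Y where "Y g k = (\<Sum>j<k. y j g) + y0 g" for g k
  have Y: "adic_rel (Y g) (Y g)" for g
    by (simp add: adic_rel_def Y_def y)
  have "(\<Sum>g\<in>gen_products n. g * Y g k) = x (n + k)" for k
  proof -
    have "(\<Sum>g\<in>gen_products n. g * Y g k) = (\<Sum>j<k. \<Sum>g\<in>gen_products n. g * y j g) + x n"
      unfolding Y_def y0 by (simp add: distrib_left sum.distrib sum_distrib_left sum.swap[of _ "{..<k}"])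
    also have "(\<Sum>j<k. \<Sum>g\<in>gen_products n. g * y j g) = x (n + k) - x n"
      using sum_telescope_nat[of "\<lambda>k. x (n + k)" k] by (simp add: y(2)[symmetric])
    finally show ?thesis by simp
  qed
  then have sum: "(\<Sum>g\<in>gen_products n. completion_of g * abs_completion (Y g)) = abs_completion (\<lambda>k. x (n + k))"
    "adic_rel (\<lambda>k. x (n + k)) (\<lambda>k. x (n + k))"
    using abs_completion_sum[of "gen_products n" Y "\<lambda>g. g", OF finite_gen_products[OF fin] Y] by simp_all
  have "x k - x (n + k) \<in> ideal_power k" for k
  proof (induction n)
    case (Suc n)
    have "x (n + k) - x (Suc n + k) \<in> ideal_power k"
      using x(1) ideal_power_antimono[of k "n + k"] by (auto simp: adic_rel_def ideal_power_swap[of "x (n + k)"])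
    with Suc show ?case by (rule ideal_power_trans)
  qed simp
  then have "abs_completion x = abs_completion (\<lambda>k. x (n + k))"
    using x(1) sum(2) by (subst abs_completion_eq_iff) (auto simp: adic_rel_def)
  also have "\<dots> \<in> ideal_power n"
    unfolding sum(1)[symmetric]
    by (intro ideal_power_sum ideal_power_mult2 completion_of_ideal_power gen_products_ideal_power)
  finally show ?thesis .
qed

lemma finite_ideal_gens_hloc: "finite (ideal_gens :: ('p::finite, 'c::complete_adic_ring) hloc set)"
  by (simp add: ideal_gens_hloc_def finite_ideal_gens)

lemma completion_approx:
  fixes z :: "('p::finite, 'c::complete_adic_ring) hloc completion"
  shows "\<exists>x. z - completion_of x \<in> ideal_power n"
proof -
  obtain x where x: "adic_rel x x" "z = abs_completion x" by (rule abs_completion_cases)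
  have c: "adic_rel (\<lambda>_. x n) (\<lambda>_. x n)"
    by (simp add: adic_rel_def)
  have "abs_completion (\<lambda>k. x k - x n) \<in> ideal_power n"
    using x(1) by (intro abs_completion_ideal_power finite_ideal_gens_hloc) (auto simp: adic_rel_def)
  then have "z - completion_of (x n) \<in> ideal_power n"
    by (simp add: x(2) completion_of.abs_eq minus_completion.abs_eq[OF x(1) c])
  then show ?thesis ..
qed

text \<open>Agreement spreads from constants and \<lambda> to polynomials, to fractions by
  cancelling the nonzero image of h, and to the completion by density. Continuity comes from
  \<open>gens\<close>, because the neighbourhoods of 0 are honest powers of a finitely generated
  ideal.\<close>

lemma completion_hom_eqI:
  fixes f g :: "('p::finite, 'c::complete_adic_ring) hloc completion \<Rightarrow> 'd::complete_adic_ring fps"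
  assumes f: "comm_ring_hom f" and g: "comm_ring_hom g"
    and const: "\<And>c. f (algebra_map c) = g (algebra_map c)" and lam: "f lam = g lam"
    and gens: "\<And>c. c \<in> ideal_gens \<Longrightarrow> f (algebra_map c) \<in> coeff_ideal 1"
  shows "f z = g z"
proof -
  interpret f: comm_ring_hom f by fact
  interpret g: comm_ring_hom g by fact
  have poly: "f (completion_of (hloc_of_poly a)) = g (completion_of (hloc_of_poly a))" for a
  proof (induction a)
    case (pCons c a)
    have "completion_of (hloc_of_poly (pCons c a)) =
        algebra_map c + lam * completion_of (hloc_of_poly a :: ('p, 'c) hloc)"
    proof -
      have "pCons c a = [:c:] + [:0, 1:] * a" by simp
      then show ?thesis
        by (simp only: hloc_of_poly.hom_add hloc_of_poly.hom_mult completion_of.hom_add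
            completion_of.hom_mult algebra_map_def lam_def)
    qed
    then show ?case
      by (simp add: f.hom_add f.hom_mult g.hom_add g.hom_mult const lam pCons)
  qed simp
  have loc: "f (completion_of x) = g (completion_of x)" for x
  proof -
    obtain a n where a: "hloc_of_poly (hasse_poly CARD('p)) ^ n * x = hloc_of_poly a"
      by (rule hloc_cases)
    let ?h = "completion_of (hloc_of_poly (hasse_poly CARD('p)) :: ('p, 'c) hloc)"
    have eq: "completion_of (hloc_of_poly a) = ?h ^ n * completion_of x"
      by (simp flip: a add: completion_of.hom_mult completion_of.hom_power)
    have "f ?h ^ n * f (completion_of x) = g ?h ^ n * g (completion_of x)"
      using poly[of a] unfolding eq by (simp add: f.hom_mult g.hom_mult f.hom_power g.hom_power)
    moreover obtain y where "hloc_of_poly (hasse_poly CARD('p)) * y = (1 :: ('p, 'c) hloc)"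
      using hloc_h_inverse by blast
    then have "f ?h * f (completion_of y) = 1"
      by (simp flip: f.hom_mult completion_of.hom_mult)
    then have "f ?h \<noteq> 0"
      by auto
    ultimately show ?thesis
      by (simp add: poly)
  qed
  have cont: "k w \<in> coeff_ideal n" if k: "comm_ring_hom k" and w: "w \<in> ideal_power n"
      and gens: "\<And>c. c \<in> ideal_gens \<Longrightarrow> k (algebra_map c) \<in> coeff_ideal 1" for w n
      and k :: "('p, 'c) hloc completion \<Rightarrow> 'd fps"
    by (rule hom_ideal_filtration[OF k w, where L = coeff_ideal])
      (use gens in \<open>auto simp: ideal_gens_hloc_completion coeff_ideal_0_UNIV coeff_ideal_add coeff_ideal_times\<close>)
  show ?thesis
  proof (rule coeff_ideal_separated_eq)
    fix n
    obtain x where "z - completion_of x \<in> ideal_power n"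
      using completion_approx by blast
    then have "f (z - completion_of x) \<in> coeff_ideal n" "g (z - completion_of x) \<in> coeff_ideal n"
      using cont[OF f] cont[OF g] gens by (simp_all flip: const)
    then have "f (z - completion_of x) - g (z - completion_of x) \<in> coeff_ideal n"
      by (rule coeff_ideal_diff)
    then show "f z - g z \<in> coeff_ideal n"
      by (simp add: f.hom_minus g.hom_minus loc)
  qed
qed

section \<open>The image of the expansion map\<close>

lemma hloc_exp_fraction:
  fixes x :: "('p::finite, 'c::{idom,adic_ring}) hloc"
  obtains a k where "fps_of_poly (hasse_poly CARD('p)) ^ k * hloc_exp x = fps_of_poly a"
proof -
  obtain a k where a: "hloc_of_poly (hasse_poly CARD('p)) ^ k * x = hloc_of_poly a"
    by (rule hloc_cases)
  have "hloc_exp (hloc_of_poly (hasse_poly CARD('p)) ^ k * x) = fps_of_poly a"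
    unfolding a by (rule hloc_exp_of_poly)
  then show ?thesis
    by (intro that) (simp add: hloc_exp.hom_mult hloc_exp.hom_power hloc_exp_of_poly)
qed

lemma hloc_exp_cancel:
  obtains u :: "('p::finite, 'c::{idom,adic_ring}) hloc"
  where "\<And>k y. hloc_exp u ^ k * (fps_of_poly (hasse_poly CARD('p)) ^ k * y) = y"
proof -
  obtain u :: "('p, 'c) hloc" where u: "hloc_of_poly (hasse_poly CARD('p)) * u = 1"
    using hloc_h_inverse by blast
  have "hloc_exp (hloc_of_poly (hasse_poly CARD('p)) * u) = 1"
    unfolding u by simp
  then have "hloc_exp u * fps_of_poly (hasse_poly CARD('p)) = 1"
    by (simp add: hloc_exp.hom_mult hloc_exp_of_poly mult.commute)
  then have "hloc_exp u ^ k * (fps_of_poly (hasse_poly CARD('p)) ^ k * y) = y" for k y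
    by (simp flip: mult.assoc power_mult_distrib)
  then show ?thesis by (rule that)
qed

lemma range_lexp_limit:
  assumes "\<And>n. \<exists>z\<in>range (lexp :: ('p::finite, 'c::complete_adic_ring) hloc completion \<Rightarrow> 'c fps).
      y - z \<in> coeff_ideal n"
  shows "y \<in> range (lexp :: ('p, 'c) hloc completion \<Rightarrow> 'c fps)"
  unfolding range_lexp_iff
proof
  fix n
  obtain z where z: "y - lexp (z :: ('p, 'c) hloc completion) \<in> coeff_ideal n"
    using assms by blast
  obtain x :: "('p, 'c) hloc" where "lexp z - hloc_exp x \<in> coeff_ideal n"
    using lexp_approx by blast
  with z show "\<exists>x :: ('p, 'c) hloc. y - hloc_exp x \<in> coeff_ideal n"
    by (blast intro: coeff_ideal_trans)
qed

text \<open>Clearing denominators puts membership in terms of polynomials alone. The stability of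
  the image under shifts, derivation and change of coefficients is then read off the
  numerators.\<close>

lemma range_lexp_iff_fraction:
  "y \<in> range (lexp :: ('p::finite, 'c::complete_adic_ring) hloc completion \<Rightarrow> 'c fps) \<longleftrightarrow>
    (\<forall>n. \<exists>k a. fps_of_poly (hasse_poly CARD('p)) ^ k * y - fps_of_poly a \<in> coeff_ideal n)"
proof (intro iffI allI)
  let ?H = "fps_of_poly (hasse_poly CARD('p)) :: 'c fps"
  fix n assume "y \<in> range (lexp :: ('p, 'c) hloc completion \<Rightarrow> 'c fps)"
  then obtain x :: "('p, 'c) hloc" where x: "y - hloc_exp x \<in> coeff_ideal n"
    unfolding range_lexp_iff by blast
  obtain a k where "?H ^ k * hloc_exp x = fps_of_poly a"
    by (rule hloc_exp_fraction)
  then show "\<exists>k a. ?H ^ k * y - fps_of_poly a \<in> coeff_ideal n"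
    using coeff_ideal_mult[OF x, of "?H ^ k"] by (auto simp: right_diff_distrib)
next
  let ?H = "fps_of_poly (hasse_poly CARD('p)) :: 'c fps"
  assume *: "\<forall>n. \<exists>k a. ?H ^ k * y - fps_of_poly a \<in> coeff_ideal n"
  show "y \<in> range (lexp :: ('p, 'c) hloc completion \<Rightarrow> 'c fps)"
    unfolding range_lexp_iff
  proof
    fix n
    obtain k a where a: "?H ^ k * y - fps_of_poly a \<in> coeff_ideal n"
      using * by blast
    obtain u :: "('p, 'c) hloc" where u: "\<And>k y. hloc_exp u ^ k * (?H ^ k * y) = y"
      using hloc_exp_cancel by metis
    have "y - hloc_exp (u ^ k * hloc_of_poly a) \<in> coeff_ideal n"
      using coeff_ideal_mult[OF a, of "hloc_exp u ^ k"]
      by (simp add: right_diff_distrib u hloc_exp.hom_mult hloc_exp.hom_power hloc_exp_of_poly)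
    then show "\<exists>x :: ('p, 'c) hloc. y - hloc_exp x \<in> coeff_ideal n" ..
  qed
qed

lemma lexp_complete:
  fixes z :: "nat \<Rightarrow> ('p::finite, 'c::complete_adic_ring) hloc completion"
  assumes "\<And>n. lexp (z (Suc n)) - lexp (z n) \<in> coeff_ideal n"
  shows "\<exists>w :: ('p, 'c) hloc completion. \<forall>n. lexp w - lexp (z n) \<in> coeff_ideal n"
proof -
  have "\<exists>L. \<forall>n. L - fps_nth (lexp (z n)) i \<in> ideal_power n" for i
    by (rule adic_complete) (use assms in \<open>simp add: coeff_ideal_def\<close>)
  then obtain L where "\<And>i n. L i - fps_nth (lexp (z n)) i \<in> ideal_power n"
    by metis
  then have L: "Abs_fps L - lexp (z n) \<in> coeff_ideal n" for n
    by (simp add: coeff_ideal_def)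
  then have "Abs_fps L \<in> range (lexp :: ('p, 'c) hloc completion \<Rightarrow> 'c fps)"
    by (intro range_lexp_limit) blast
  then obtain w :: "('p, 'c) hloc completion" where "Abs_fps L = lexp w"
    by blast
  then show ?thesis
    using L by (intro exI[of _ w]) simp
qed

lemma lexp_of_poly: "lexp (completion_of (hloc_of_poly a)) = fps_of_poly a"
  by (simp add: lexp_completion_of hloc_exp_of_poly)

text \<open>Modulo the ideal, z is a power of the unit h. Hence 1 - z h^(-m) is topologically
  nilpotent and the geometric series converges inside the completion.\<close>

lemma lexp_unit:
  fixes z :: "('p::finite, 'c::complete_adic_ring) hloc completion"
  assumes "lexp z - fps_of_poly (hasse_poly CARD('p)) ^ m \<in> coeff_ideal 1"
  shows "\<exists>w. z * w = 1"
proof -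
  let ?h = "completion_of (hloc_of_poly (hasse_poly CARD('p))) :: ('p, 'c) hloc completion"
  obtain y :: "('p, 'c) hloc" where y: "hloc_of_poly (hasse_poly CARD('p)) * y = 1"
    using hloc_h_inverse by blast
  define k where "k = completion_of y ^ m"
  have hk: "?h ^ m * k = 1"
    by (simp add: k_def y flip: power_mult_distrib completion_of.hom_mult)
  define e where "e = 1 - z * k"
  have "lexp (z * k - ?h ^ m * k) \<in> coeff_ideal 1"
    using coeff_ideal_mult2[OF assms, of "lexp k"]
    by (simp add: lexp.hom_minus lexp.hom_mult lexp.hom_power lexp_of_poly left_diff_distrib)
  then have e: "lexp e \<in> coeff_ideal 1"
    using coeff_ideal_swap[of "lexp (z * k)" 1 1] by (simp add: hk e_def lexp.hom_minus)
  have en: "lexp e ^ n \<in> coeff_ideal n" for n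
  proof (induction n)
    case (Suc n)
    then show ?case using coeff_ideal_times[OF e Suc] by simp
  qed (simp add: coeff_ideal_0_UNIV)
  have "\<exists>w :: ('p, 'c) hloc completion. \<forall>n. lexp w - lexp (\<Sum>i<n. e ^ i) \<in> coeff_ideal n"
    by (rule lexp_complete) (simp add: lexp.hom_add lexp.hom_power en)
  then obtain w :: "('p, 'c) hloc completion" where w: "\<And>n. lexp w - lexp (\<Sum>i<n. e ^ i) \<in> coeff_ideal n"
    by blast
  have "lexp ((1 - e) * w) = 1"
  proof (rule coeff_ideal_separated_eq)
    fix n
    have "(1 - e) * (\<Sum>i<n. e ^ i) = 1 - e ^ n"
      by (simp add: one_diff_power_eq)
    then have "lexp ((1 - e) * (\<Sum>i<n. e ^ i)) = 1 - lexp e ^ n"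
      by (simp add: lexp.hom_minus lexp.hom_power)
    then have "lexp ((1 - e) * w) - 1 = lexp (1 - e) * (lexp w - lexp (\<Sum>i<n. e ^ i)) - lexp e ^ n"
      by (simp add: lexp.hom_mult right_diff_distrib)
    then show "lexp ((1 - e) * w) - 1 \<in> coeff_ideal n"
      by (simp add: coeff_ideal_diff coeff_ideal_mult[OF w] en)
  qed
  then have "lexp (z * (k * w)) = lexp (1 :: ('p, 'c) hloc completion)"
    by (simp add: e_def mult.assoc)
  then have "z * (k * w) = 1"
    unfolding lexp_inj .
  then show ?thesis ..
qed

text \<open>Shifting the numerator drops its constant term, which is compared with the constant term
  0 of \<open>fps_X * y\<close> and is therefore small. This permits division by \<lambda> in S' and
  B'.\<close>

lemma range_lexp_X_mult:
  assumes "fps_X * y \<in> range (lexp :: ('p::finite, 'c::complete_adic_ring) hloc completion \<Rightarrow> 'c fps)"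
  shows "y \<in> range (lexp :: ('p, 'c) hloc completion \<Rightarrow> 'c fps)"
  unfolding range_lexp_iff_fraction
proof
  let ?H = "fps_of_poly (hasse_poly CARD('p)) :: 'c fps"
  fix n
  obtain k a where d: "?H ^ k * (fps_X * y) - fps_of_poly a \<in> coeff_ideal n"
    using assms unfolding range_lexp_iff_fraction by blast
  have "?H ^ k * y - fps_of_poly (poly_shift 1 a) \<in> coeff_ideal n"
    unfolding coeff_ideal_def
  proof (rule CollectI, rule allI)
    fix i
    have "fps_nth (fps_X * (?H ^ k * y) - fps_of_poly a) (Suc i) \<in> ideal_power n"
      using d unfolding coeff_ideal_def by (simp only: mem_Collect_eq mult.left_commute[of fps_X])
    then show "fps_nth (?H ^ k * y - fps_of_poly (poly_shift 1 a)) i \<in> ideal_power n"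
      by simp
  qed
  then show "\<exists>k a. ?H ^ k * y - fps_of_poly a \<in> coeff_ideal n" by blast
qed

subsection \<open>Change of coefficients\<close>

definition fps_map :: "('a::zero \<Rightarrow> 'b::zero) \<Rightarrow> 'a fps \<Rightarrow> 'b fps" where
  "fps_map f F = Abs_fps (\<lambda>i. f (fps_nth F i))"

lemma fps_nth_map [simp]: "fps_nth (fps_map f F) i = f (fps_nth F i)"
  by (simp add: fps_map_def)

lemma fps_map_hom:
  assumes "comm_ring_hom f"
  shows "comm_ring_hom (fps_map f)"
proof -
  interpret comm_ring_hom f by fact
  show ?thesis
    by unfold_locales (auto intro!: fps_ext simp: hom_add hom_mult hom_sum fps_mult_nth)
qed

lemma fps_map_coeff_ideal:
  assumes f: "comm_ring_hom f" and gens: "\<And>g. g \<in> ideal_gens \<Longrightarrow> f g \<in> ideal_power 1"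
    and F: "F \<in> coeff_ideal n"
  shows "fps_map f F \<in> coeff_ideal n"
  using F hom_ideal_power[OF f _ gens] by (auto simp: coeff_ideal_def)

lemma fps_map_hasse_poly:
  assumes "comm_ring_hom f"
  shows "fps_map f (fps_of_poly (hasse_poly p)) = fps_of_poly (hasse_poly p)"
proof -
  interpret comm_ring_hom f by fact
  show ?thesis
    by (rule fps_ext) (simp add: hasse_poly_def coeff_sum hom_sum hom_power hom_of_nat if_distrib cong: if_cong)
qed

text \<open>The coefficients of h are natural numbers, hence fixed by every ring homomorphism. The
  lemma is applied to reduction modulo q - 1 and to the inclusion of the constants.\<close>

lemma range_lexp_fps_map:
  fixes f :: "'c::complete_adic_ring \<Rightarrow> 'd::complete_adic_ring"
  assumes f: "comm_ring_hom f" and gens: "\<And>g. g \<in> ideal_gens \<Longrightarrow> f g \<in> ideal_power 1"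
    and y: "y \<in> range (lexp :: ('p::finite, 'c) hloc completion \<Rightarrow> 'c fps)"
  shows "fps_map f y \<in> range (lexp :: ('p, 'd) hloc completion \<Rightarrow> 'd fps)"
  unfolding range_lexp_iff_fraction
proof
  fix n
  interpret f: comm_ring_hom f by fact
  interpret F: comm_ring_hom "fps_map f" by (rule fps_map_hom[OF f])
  obtain k a where a: "fps_of_poly (hasse_poly CARD('p)) ^ k * y - fps_of_poly a \<in> coeff_ideal n"
    using y unfolding range_lexp_iff_fraction by blast
  have "fps_map f (fps_of_poly a) = fps_of_poly (map_poly f a)"
    by (rule fps_ext) (simp add: coeff_map_poly)
  then have "fps_of_poly (hasse_poly CARD('p)) ^ k * fps_map f y - fps_of_poly (map_poly f a) \<in> coeff_ideal n"
    using fps_map_coeff_ideal[OF f gens a]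
    by (simp add: F.hom_minus F.hom_mult F.hom_power fps_map_hasse_poly[OF f])
  then show "\<exists>k a. fps_of_poly (hasse_poly CARD('p)) ^ k * fps_map f y - fps_of_poly a \<in> coeff_ideal n"
    by blast
qed

lemma fps_const_hom: "comm_ring_hom (fps_const :: 'a::comm_ring_1 \<Rightarrow> 'a fps)"
  by unfold_locales simp_all

lemma fps_nth_0_hom: "comm_ring_hom (\<lambda>f :: 'a::comm_ring_1 fps. fps_nth f 0)"
  by unfold_locales simp_all

lemma fps_const_ideal_gens: "g \<in> ideal_gens \<Longrightarrow> fps_const g \<in> ideal_power 1"
  by (simp add: ideal_gens_fps_def ideal_gens_power_1)

lemma fps_nth_0_ideal_gens: "g \<in> ideal_gens \<Longrightarrow> fps_nth g 0 \<in> ideal_power 1"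
  by (auto simp: ideal_gens_fps_def intro: ideal_gens_power_1)

lemma fps_decompose_coeffs:
  fixes F :: "'c::comm_ring_1 fps fps"
  shows "F = fps_map fps_const (fps_map (\<lambda>r. fps_nth r 0) F) + fps_const fps_X * fps_map (fps_shift 1) F"
  by (rule fps_ext, rule fps_ext) auto

lemma range_lexp_const_X_mult:
  fixes y :: "'c::complete_adic_ring fps fps"
  assumes "fps_const fps_X * y \<in> range (lexp :: ('p::finite, 'c fps) hloc completion \<Rightarrow> 'c fps fps)"
  shows "y \<in> range (lexp :: ('p, 'c fps) hloc completion \<Rightarrow> 'c fps fps)"
  unfolding range_lexp_iff_fraction
proof
  fix n
  let ?X = "fps_const fps_X :: 'c fps fps"
  let ?H = "fps_of_poly (hasse_poly CARD('p)) :: 'c fps fps"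
  \<comment> \<open>Division by q - 1 lowers the order by one, whence the precision
    \<open>Suc n\<close>.\<close>
  obtain k a where d: "?H ^ k * (?X * y) - fps_of_poly a \<in> coeff_ideal (Suc n)"
    using assms unfolding range_lexp_iff_fraction by blast
  have "?H ^ k * y - fps_of_poly (map_poly (fps_shift 1) a) \<in> coeff_ideal n"
    unfolding coeff_ideal_def ideal_power_fps
  proof (rule CollectI, intro allI)
    fix i j
    have "fps_nth (fps_nth (?X * (?H ^ k * y) - fps_of_poly a) i) (Suc j) \<in> ideal_power (Suc n - Suc j)"
      using d unfolding coeff_ideal_def ideal_power_fps
      by (simp only: mem_Collect_eq mult.left_commute[of ?X])
    then show "fps_nth (fps_nth (?H ^ k * y - fps_of_poly (map_poly (fps_shift 1) a)) i) j \<in> ideal_power (n - j)"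
      by (simp add: coeff_map_poly)
  qed
  then show "\<exists>k a. ?H ^ k * y - fps_of_poly a \<in> coeff_ideal n" by blast
qed

subsection \<open>Derivation and the substitution of \<open>\<lambda> ^ p\<close> for \<open>\<lambda>\<close>\<close>

lemma fps_deriv_coeff_ideal: "F \<in> coeff_ideal n \<Longrightarrow> fps_deriv F \<in> coeff_ideal n"
  by (auto simp: coeff_ideal_def intro!: ideal_power_mult)

lemma range_lexp_deriv:
  assumes "y \<in> range (lexp :: ('p::finite, 'c::complete_adic_ring) hloc completion \<Rightarrow> 'c fps)"
  shows "fps_deriv y \<in> range (lexp :: ('p, 'c) hloc completion \<Rightarrow> 'c fps)"
  unfolding range_lexp_iff_fraction
proof
  fix n
  let ?h = "hasse_poly CARD('p) :: 'c poly"
  let ?H = "fps_of_poly ?h"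
  obtain k a where a: "?H ^ k * y - fps_of_poly a \<in> coeff_ideal n"
    using assms unfolding range_lexp_iff_fraction by blast
  \<comment> \<open>The numerator given by the quotient rule for a / h^k over the denominator
    h^(2k).\<close>
  let ?b = "?h ^ k * pderiv a - pderiv (?h ^ k) * a"
  have "?H ^ (k + k) * fps_deriv y - fps_of_poly ?b =
      ?H ^ k * fps_deriv (?H ^ k * y - fps_of_poly a) - fps_deriv (?H ^ k) * (?H ^ k * y - fps_of_poly a)"
    by (simp add: fps_of_poly_diff fps_of_poly_mult fps_of_poly_pderiv fps_of_poly_power power_add algebra_simps)
  also have "\<dots> \<in> coeff_ideal n"
    by (intro coeff_ideal_diff coeff_ideal_mult[OF fps_deriv_coeff_ideal[OF a]] coeff_ideal_mult[OF a])
  finally show "\<exists>k a. ?H ^ k * fps_deriv y - fps_of_poly a \<in> coeff_ideal n" by blast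
qed

definition dil :: "nat \<Rightarrow> 'a::zero fps \<Rightarrow> 'a fps" where
  "dil k F = Abs_fps (\<lambda>n. if k dvd n then fps_nth F (n div k) else 0)"

lemma dil_nth: "fps_nth (dil k F) n = (if k dvd n then fps_nth F (n div k) else 0)"
  by (simp add: dil_def)

lemma dil_eq_compose:
  fixes F :: "'a::comm_ring_1 fps"
  assumes "k > 0"
  shows "dil k F = fps_compose F (fps_X ^ k)"
proof (rule fps_ext)
  fix n
  have "fps_nth (fps_compose F (fps_X ^ k)) n = (\<Sum>i\<in>{0..n}. if n = k * i then fps_nth F i else 0)"
    unfolding fps_compose_nth by (intro sum.cong refl) (simp flip: power_mult)
  also have "\<dots> = (if k dvd n then fps_nth F (n div k) else 0)"
  proof (cases "k dvd n")
    case True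
    then obtain m where m: "n = k * m" by blast
    have "(\<Sum>i\<in>{0..n}. if n = k * i then fps_nth F i else 0) = (\<Sum>i\<in>{0..n}. if i = m then fps_nth F i else 0)"
      using assms m by (intro sum.cong) auto
    then show ?thesis
      using assms by (simp add: m)
  qed (auto intro!: sum.neutral)
  finally show "fps_nth (dil k F) n = fps_nth (fps_compose F (fps_X ^ k)) n"
    by (simp add: dil_nth)
qed

lemma dil_hom:
  assumes "k > 0"
  shows "comm_ring_hom (dil k :: 'a::idom fps \<Rightarrow> 'a fps)"
  using assms by unfold_locales (simp_all add: dil_eq_compose fps_compose_add_distrib fps_compose_mult_distrib)

lemma dil_coeff_ideal: "F \<in> coeff_ideal n \<Longrightarrow> dil k F \<in> coeff_ideal n"
  by (simp add: coeff_ideal_def dil_nth)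

lemma dil_fps_X: "k > 0 \<Longrightarrow> dil k (fps_X :: 'a::comm_ring_1 fps) = fps_X ^ k"
  by (simp add: dil_eq_compose)

section \<open>Stability of the image under \<lambda> \<mapsto> \<lambda>^p\<close>

lemma freshman:
  fixes x y :: "'a::comm_ring_1"
  assumes p: "prime p"
  shows "\<exists>z. (x + y) ^ p = x ^ p + y ^ p + of_nat p * z"
proof -
  let ?f = "\<lambda>k. of_nat (p choose k) * x ^ k * y ^ (p - k)"
  have p0: "p > 0" using p by (rule prime_gt_0_nat)
  have "\<exists>z. ?f k = of_nat p * z" if "k \<in> {1..<p}" for k
  proof -
    have "p dvd (p choose k)"
      using that p by (intro dvd_choose_prime) auto
    then obtain m where "p choose k = p * m" ..
    then show ?thesis by (auto simp: mult.assoc)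
  qed
  then obtain g where g: "\<And>k. k \<in> {1..<p} \<Longrightarrow> ?f k = of_nat p * g k"
    by metis
  have "{..p} = insert 0 (insert p {1..<p})"
    using p0 by auto
  then have "(x + y) ^ p = (\<Sum>k\<in>insert 0 (insert p {1..<p}). ?f k)"
    by (simp add: binomial_ring)
  also have "\<dots> = y ^ p + (x ^ p + (\<Sum>k\<in>{1..<p}. ?f k))"
    using p0 by simp
  also have "(\<Sum>k\<in>{1..<p}. ?f k) = of_nat p * (\<Sum>k\<in>{1..<p}. g k)"
    by (simp add: sum_distrib_left g)
  finally have "(x + y) ^ p = x ^ p + y ^ p + of_nat p * (\<Sum>k\<in>{1..<p}. g k)"
    by (simp add: ac_simps)
  then show ?thesis ..
qed

text \<open>The series with F(\<lambda>^p) \<equiv> F(\<lambda>)^p are closed under products, and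
  under sums by the binomial theorem modulo p. They contain \<lambda> and the natural numbers, hence
  h.\<close>

lemma dil_hasse_poly:
  assumes p: "prime p" "of_nat p \<in> (ideal_power 1 :: 'c::{idom,adic_ring} set)"
  shows "dil p (fps_of_poly (hasse_poly n)) - fps_of_poly (hasse_poly n) ^ p \<in> (coeff_ideal 1 :: 'c fps set)"
proof -
  have p0: "p > 0" using p(1) by (rule prime_gt_0_nat)
  interpret comm_ring_hom "dil p :: 'c fps \<Rightarrow> 'c fps" by (rule dil_hom[OF p0])
  define S where "S = {F :: 'c fps. dil p F - F ^ p \<in> coeff_ideal 1}"
  have mult: "F * G \<in> S" if "F \<in> S" "G \<in> S" for F G
    using that by (auto simp: S_def hom_mult power_mult_distrib intro: coeff_ideal_mult_cong)
  have add: "F + G \<in> S" if "F \<in> S" "G \<in> S" for F G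
  proof -
    obtain z where z: "(F + G) ^ p = F ^ p + G ^ p + of_nat p * z"
      using freshman[OF p(1)] by blast
    have "of_nat p * z \<in> coeff_ideal 1"
      using p(2) by (intro coeff_ideal_mult2) (auto simp: coeff_ideal_def fps_of_nat[symmetric])
    moreover have "dil p F - F ^ p + (dil p G - G ^ p) \<in> coeff_ideal 1"
      using that by (intro coeff_ideal_add) (simp_all add: S_def)
    ultimately have "dil p F - F ^ p + (dil p G - G ^ p) - of_nat p * z \<in> coeff_ideal 1"
      by (intro coeff_ideal_diff)
    then show ?thesis
      by (simp add: S_def z hom_add algebra_simps)
  qed
  have S01: "0 \<in> S" "1 \<in> S" "fps_X \<in> S"
    using p0 by (auto simp: S_def dil_fps_X power_0_left)
  have nat: "of_nat m \<in> S" for m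
    by (induction m) (auto intro: S01 add)
  have X: "fps_X ^ i \<in> S" for i
    by (induction i) (auto intro: S01 mult)
  have sum: "(\<Sum>i\<in>A. F i) \<in> S" if "\<And>i. i \<in> A \<Longrightarrow> F i \<in> S" for A :: "nat set" and F
    using that by (induction A rule: infinite_finite_induct) (auto intro: S01 add)
  have "fps_of_poly (hasse_poly n) \<in> S"
    unfolding hasse_poly_def fps_of_poly_sum fps_of_poly_monom fps_of_nat
    by (rule sum) (rule mult[OF nat X])
  then show ?thesis
    by (simp add: S_def)
qed

text \<open>The substitution turns a denominator h(\<lambda>) into h(\<lambda>^p), which is
  congruent to h^p and therefore a unit by \<open>lexp_unit\<close>.\<close>

lemma range_lexp_dil:
  assumes p: "prime CARD('p)" "of_nat CARD('p) \<in> (ideal_power 1 :: 'c::complete_adic_ring set)"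
    and y: "y \<in> range (lexp :: ('p::finite, 'c) hloc completion \<Rightarrow> 'c fps)"
  shows "dil CARD('p) y \<in> range (lexp :: ('p, 'c) hloc completion \<Rightarrow> 'c fps)"
proof (rule range_lexp_limit)
  fix n
  let ?h = "hasse_poly CARD('p) :: 'c poly"
  let ?H = "fps_of_poly ?h"
  let ?C = "range (lexp :: ('p, 'c) hloc completion \<Rightarrow> 'c fps)"
  have p0: "CARD('p) > 0" using p(1) by (rule prime_gt_0_nat)
  interpret D: comm_ring_hom "dil CARD('p) :: 'c fps \<Rightarrow> 'c fps" by (rule dil_hom[OF p0])
  have poly: "dil CARD('p) (fps_of_poly a) \<in> ?C" for a
  proof -
    have "dil CARD('p) (fps_of_poly a) = fps_of_poly (pcompose a (monom 1 CARD('p)))"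
      using p0 by (subst fps_of_poly_pcompose) (simp_all add: fps_of_poly_monom' dil_eq_compose)
    then show ?thesis
      by (metis lexp_of_poly rangeI)
  qed
  obtain z where z: "lexp (z :: ('p, 'c) hloc completion) = dil CARD('p) ?H"
    using poly[of ?h] by (metis imageE)
  have "lexp z - ?H ^ CARD('p) \<in> coeff_ideal 1"
    unfolding z by (rule dil_hasse_poly[OF p])
  then obtain w where w: "z * w = 1"
    using lexp_unit by blast
  obtain k a where a: "?H ^ k * y - fps_of_poly a \<in> coeff_ideal n"
    using y unfolding range_lexp_iff_fraction by blast
  obtain b where b: "lexp (b :: ('p, 'c) hloc completion) = dil CARD('p) (fps_of_poly a)"
    using poly[of a] by (metis imageE)
  have d: "lexp (z ^ k) * dil CARD('p) y - lexp b \<in> coeff_ideal n"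
    using dil_coeff_ideal[OF a, of "CARD('p)"] by (simp add: D.hom_minus D.hom_mult D.hom_power z b lexp.hom_power)
  have "w ^ k * z ^ k = 1"
    using w by (simp flip: power_mult_distrib add: mult.commute[of w])
  then have wz: "lexp (w ^ k) * lexp (z ^ k) = 1"
    by (simp flip: lexp.hom_mult)
  have "dil CARD('p) y - lexp (w ^ k * b) = lexp (w ^ k) * (lexp (z ^ k) * dil CARD('p) y - lexp b)"
    using wz by (simp add: right_diff_distrib lexp.hom_mult flip: mult.assoc)
  also have "\<dots> \<in> coeff_ideal n"
    by (rule coeff_ideal_mult[OF d])
  finally show "\<exists>z\<in>?C. dil CARD('p) y - z \<in> coeff_ideal n"
    by blast
qed

section \<open>Units\<close>

lemma geometric_inverse:
  fixes e :: "'c::complete_adic_ring"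
  assumes e: "e \<in> ideal_power 1"
  shows "\<exists>w. (1 - e) * w = 1"
proof -
  have en: "e ^ n \<in> ideal_power n" for n
    using e by (rule ideal_power_power)
  have "\<exists>w. \<forall>n. w - (\<Sum>i<n. e ^ i) \<in> ideal_power n"
    by (rule adic_complete) (simp add: en)
  then obtain w where w: "\<And>n. w - (\<Sum>i<n. e ^ i) \<in> ideal_power n"
    by blast
  have "(1 - e) * w - 1 \<in> ideal_power n" for n
  proof -
    have "(1 - e) * w - 1 = (1 - e) * (w - (\<Sum>i<n. e ^ i)) - e ^ n"
      by (simp add: right_diff_distrib[of "1 - e"] one_diff_power_eq[symmetric])
    then show ?thesis
      by (simp add: ideal_power_diff ideal_power_mult[OF w] en)
  qed
  then have "(1 - e) * w - 1 = 0"
    by (rule adic_separated)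
  then show ?thesis by auto
qed

lemma unit_of_coprime:
  fixes x :: "'c::complete_adic_ring"
  assumes p: "of_nat p \<in> (ideal_power 1 :: 'c set)" and k: "coprime k p"
    and x: "x - of_nat k \<in> ideal_power 1"
  shows "\<exists>w. x * w = 1"
proof -
  obtain u v :: int where uv: "u * int k + v * int p = 1"
    using k bezout_int[of "int k" "int p"] by auto
  have "of_int u * of_nat k + of_int v * of_nat p = (of_int (u * int k + v * int p) :: 'c)"
    by simp
  then have 1: "of_int u * of_nat k + of_int v * of_nat p = (1 :: 'c)"
    by (simp only: uv of_int_1)
  \<comment> \<open>By the Bezout relation, 1 - e is x times the integer u, with e in the
    ideal.\<close>
  define e where "e = of_int v * of_nat p - of_int u * (x - of_nat k)"
  have "1 - e = x * of_int u"
    unfolding e_def using 1 by (simp add: algebra_simps)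
  moreover have "e \<in> ideal_power 1"
    unfolding e_def by (rule ideal_power_diff; rule ideal_power_mult; fact)
  then obtain w where "(1 - e) * w = 1"
    using geometric_inverse by blast
  ultimately have "x * (of_int u * w) = 1"
    by (simp add: mult.assoc)
  then show ?thesis ..
qed

definition unit_inv :: "'a::comm_ring_1 \<Rightarrow> 'a" where
  "unit_inv x = (SOME y. x * y = 1)"

lemma unit_inv: "\<exists>y. x * y = 1 \<Longrightarrow> x * unit_inv x = 1"
  unfolding unit_inv_def by (rule someI_ex)

lemma unit_inv_1 [simp]: "unit_inv 1 = 1"
  using unit_inv[of 1] by auto

lemma p_ideal_zp: "of_nat CARD('p) \<in> (ideal_power 1 :: 'p::prime_card zp set)"
  by (simp add: ideal_power_zp_dvd)

lemma of_nat_fps_ideal_power: "of_nat k \<in> (ideal_power n :: 'c::adic_ring set) \<Longrightarrow> of_nat k \<in> (ideal_power n :: 'c fps set)"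
  unfolding ideal_power_fps by (auto simp flip: fps_of_nat)

lemma p_ideal_R: "of_nat CARD('p) \<in> (ideal_power 1 :: 'p::prime_card R set)"
  by (rule of_nat_fps_ideal_power[OF p_ideal_zp])

lemma of_int_zp_eq_0_iff: "of_int m = (0 :: 'p::prime_card zp) \<longleftrightarrow> m = 0"
proof
  assume *: "of_int m = (0 :: 'p zp)"
  obtain n where n: "\<bar>m\<bar> < int CARD('p) ^ n"
    using real_arch_pow[of "real CARD('p)" "of_int \<bar>m\<bar>"] prime_card_gt_1[where 'p='p]
    by (metis of_int_less_iff of_int_of_nat_eq of_int_power of_nat_1 of_nat_less_iff of_int_1)
  have "Rep_zp (of_int m :: 'p zp) n = 0"
    by (simp add: * zero_zp.rep_eq)
  then have "int CARD('p) ^ n dvd m"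
    by (simp add: of_int_zp mod_0_imp_dvd)
  then show "m = 0"
    using n zdvd_not_zless[of "\<bar>m\<bar>" "int CARD('p) ^ n"] by (cases "m = 0") auto
qed simp

section \<open>Rational numbers as \<open>p\<close>-adic integers\<close>

text \<open>\<open>zp_of_rat\<close> is not additive where it takes junk values; the following relation avoids them.\<close>

definition zp_represents :: "rat \<Rightarrow> 'p::prime_card zp \<Rightarrow> bool" where
  "zp_represents r z \<longleftrightarrow> (\<exists>m n. m \<noteq> 0 \<and> r = of_int n / of_int m \<and> of_int m * z = of_int n)"

lemma zp_represents_cross:
  assumes "zp_represents r (z :: 'p::prime_card zp)" "r = of_int n / of_int m" "m \<noteq> 0"
  shows "of_int m * z = of_int n"
proof -
  obtain m' n' where *: "m' \<noteq> 0" "r = of_int n' / of_int m'" "of_int m' * z = of_int n'"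
    using assms(1) by (auto simp: zp_represents_def)
  have "(of_int (n * m') :: rat) = of_int (n' * m)"
    using assms(2,3) * by (simp add: field_simps)
  then have "n * m' = n' * m"
    by (simp only: of_int_eq_iff)
  then have eq: "(of_int n * of_int m' :: 'p zp) = of_int n' * of_int m"
    by (simp only: of_int_mult[symmetric])
  have "of_int m' * (of_int m * z) = of_int m * (of_int m' * z)"
    by (simp add: ac_simps)
  also have "\<dots> = of_int m' * of_int n"
    unfolding *(3) using eq by (simp add: ac_simps)
  finally show ?thesis
    using *(1) by (simp add: of_int_zp_eq_0_iff)
qed

lemma zp_represents_unique:
  assumes "zp_represents r z" "zp_represents r (w :: 'p::prime_card zp)"
  shows "z = w"
proof -
  obtain m n where *: "m \<noteq> 0" "r = of_int n / of_int m" "of_int m * z = of_int n"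
    using assms(1) by (auto simp: zp_represents_def)
  have "of_int m * z = of_int m * w"
    using zp_represents_cross[OF assms(2) *(2,1)] *(3) by simp
  then show ?thesis
    using *(1) by (simp add: of_int_zp_eq_0_iff)
qed

lemma zp_of_rat_eqI:
  assumes "zp_represents r (z :: 'p::prime_card zp)"
  shows "zp_of_rat r = z"
proof -
  obtain m n where q: "quotient_of r = (n, m)"
    by (cases "quotient_of r")
  then have r: "r = of_int n / of_int m" "m \<noteq> 0"
    using quotient_of_div[OF q] quotient_of_denom_pos[OF q] by auto
  show ?thesis
    unfolding zp_of_rat_def q fst_conv snd_conv
  proof (rule the_equality)
    show "of_int m * z = of_int n"
      by (rule zp_represents_cross[OF assms r])
    fix w :: "'p zp" assume "of_int m * w = of_int n"
    then have "zp_represents r w"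
      using r by (auto simp: zp_represents_def)
    then show "w = z"
      using assms by (rule zp_represents_unique)
  qed
qed

lemma zp_represents_of_int: "zp_represents (of_int k) (of_int k)"
  unfolding zp_represents_def by (intro exI[of _ 1] exI[of _ k]) simp

lemma zp_represents_add:
  assumes "zp_represents r z" "zp_represents s w"
  shows "zp_represents (r + s) (z + w)"
proof -
  obtain m n where 1: "m \<noteq> 0" "r = of_int n / of_int m" "of_int m * z = of_int n"
    using assms(1) by (auto simp: zp_represents_def)
  obtain k l where 2: "k \<noteq> 0" "s = of_int l / of_int k" "of_int k * w = of_int l"
    using assms(2) by (auto simp: zp_represents_def)
  have "of_int (m * k) * (z + w) = of_int k * (of_int m * z) + of_int m * (of_int k * w)"
    by (simp add: algebra_simps)
  also have "\<dots> = of_int (k * n + m * l)"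
    by (simp add: 1 2)
  finally have "of_int (m * k) * (z + w) = of_int (k * n + m * l)" .
  moreover have "r + s = of_int (k * n + m * l) / of_int (m * k)"
    using 1(1,2) 2(1,2) by (simp add: field_simps)
  ultimately show ?thesis
    using 1(1) 2(1) unfolding zp_represents_def
    by (intro exI[of _ "m * k"] exI[of _ "k * n + m * l"]) simp
qed

lemma zp_represents_mult:
  assumes "zp_represents r z" "zp_represents s w"
  shows "zp_represents (r * s) (z * w)"
proof -
  obtain m n where 1: "m \<noteq> 0" "r = of_int n / of_int m" "of_int m * z = of_int n"
    using assms(1) by (auto simp: zp_represents_def)
  obtain k l where 2: "k \<noteq> 0" "s = of_int l / of_int k" "of_int k * w = of_int l"
    using assms(2) by (auto simp: zp_represents_def)
  have "of_int (m * k) * (z * w) = (of_int m * z) * (of_int k * w)"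
    by (simp add: algebra_simps)
  also have "\<dots> = of_int (n * l)"
    by (simp add: 1 2)
  finally have "of_int (m * k) * (z * w) = of_int (n * l)" .
  moreover have "r * s = of_int (n * l) / of_int (m * k)"
    using 1(2) 2(2) by simp
  ultimately show ?thesis
    using 1(1) 2(1) unfolding zp_represents_def
    by (intro exI[of _ "m * k"] exI[of _ "n * l"]) simp
qed

lemma zp_represents_sum:
  assumes "\<And>i. i \<in> A \<Longrightarrow> zp_represents (f i) (g i)"
  shows "zp_represents (sum f A) (sum g A)"
  using assms
proof (induction A rule: infinite_finite_induct)
  case (insert x F)
  then show ?case by (simp add: zp_represents_add)
qed (use zp_represents_of_int[of 0] in simp_all)

lemma zp_represents_cancel:
  assumes "k \<noteq> 0" "zp_represents (of_int k * r) (of_int k * z)"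
  shows "zp_represents r z"
proof -
  obtain m n where 1: "m \<noteq> 0" "of_int k * r = of_int n / of_int m" "of_int m * (of_int k * z) = of_int n"
    using assms(2) by (auto simp: zp_represents_def)
  have "of_int (m * k) * z = of_int n"
    using 1(3) by (simp add: mult.assoc)
  moreover have "r = of_int n / of_int (m * k)"
    using 1(1,2) assms(1) by (simp add: field_simps)
  ultimately show ?thesis
    using 1(1) assms(1) unfolding zp_represents_def by (intro exI[of _ "m * k"] exI[of _ n]) auto
qed

section \<open>\<open>q\<close>-numbers\<close>

locale odd_prime_card =
  fixes P :: "'p::prime_card itself"
  assumes odd_p: "odd CARD('p)"
begin

lemma p_prime: "prime CARD('p)"
  by (rule prime_card)

lemma p_ge_3: "CARD('p) \<ge> 3"
proof -
  have "CARD('p) \<ge> 2" "CARD('p) \<noteq> 2"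
    using prime_ge_2_nat[OF p_prime] odd_p by auto
  then show ?thesis by linarith
qed

lemma two_unit_zp: "\<exists>w. 2 * w = (1 :: 'p zp)"
proof (rule unit_of_coprime[OF p_ideal_zp])
  show "coprime 2 CARD('p)"
    using odd_p by simp
qed simp

text \<open>Squaring the binomial series of q^(1/2) gives q. Vandermonde's identity thus expresses
  twice the n-th coefficient through an integer and products of earlier coefficients, and 2 is a
  unit for odd p.\<close>

lemma half_gchoose_integral: "\<exists>z :: 'p zp. zp_represents ((1 / 2) gchoose n) z"
proof (induction n rule: less_induct)
  case (less n)
  obtain u where u: "2 * u = (1 :: 'p zp)"
    using two_unit_zp by blast
  show ?case
  proof (cases "n = 0")
    case True
    then show ?thesis using zp_represents_of_int[of 1] by auto
  next
    case False
    let ?c = "\<lambda>k. (1 / 2 :: rat) gchoose k"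
    obtain z :: "nat \<Rightarrow> 'p zp" where z: "\<And>k. k < n \<Longrightarrow> zp_represents (?c k) (z k)"
      using less by metis
    have split: "{0..n} = insert 0 (insert n {1..<n})"
      using False by auto
    have "1 gchoose n = (\<Sum>k\<in>{0..n}. ?c k * ?c (n - k))"
      by (simp add: gbinomial_Vandermonde)
    also have "\<dots> = 2 * ?c n + (\<Sum>k\<in>{1..<n}. ?c k * ?c (n - k))"
      unfolding split using False by simp
    finally have eq: "of_int 2 * ?c n = of_int (int (1 choose n)) + of_int (-1) * (\<Sum>k\<in>{1..<n}. ?c k * ?c (n - k))"
      by (simp add: binomial_gbinomial)
    define w where "w = of_int (int (1 choose n)) + of_int (-1) * (\<Sum>k\<in>{1..<n}. z k * z (n - k))"
    have "zp_represents (of_int 2 * ?c n) w"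
      unfolding eq w_def using z
      by (intro zp_represents_add zp_represents_mult zp_represents_of_int zp_represents_sum) auto
    also have "w = of_int 2 * (u * w)"
      using u by (simp flip: mult.assoc)
    finally have "zp_represents (?c n) (u * w)"
      by (rule zp_represents_cancel[rotated]) simp
    then show ?thesis ..
  qed
qed

lemma zp_of_rat_half_gchoose: "zp_represents ((1 / 2) gchoose n) (zp_of_rat ((1 / 2) gchoose n) :: 'p zp)"
  using half_gchoose_integral[of n] zp_of_rat_eqI by metis

end

definition sqrt_q :: "'p::prime_card R" where
  "sqrt_q = 1 + fps_X * q_bracket (1 / 2)"

definition frob_R :: "'p::prime_card R \<Rightarrow> 'p R" where
  "frob_R r = fps_compose r ((1 + fps_X) ^ CARD('p) - 1)"

text \<open>The \<open>q\<close>-number of \<open>k\<close> in base \<open>q ^ (1/2)\<close>; in this base the half-integral \<open>q\<close>-numbers of the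
  \<open>q\<close>-hypergeometric coefficients become quotients of integral ones.\<close>

definition qnum :: "nat \<Rightarrow> 'p::prime_card R" where
  "qnum k = (\<Sum>i<k. sqrt_q ^ i)"

lemma frob_R_hom: "comm_ring_hom (frob_R :: 'p::prime_card R \<Rightarrow> 'p R)"
  unfolding frob_R_def
  by unfold_locales (simp_all add: fps_compose_add_distrib fps_compose_mult_distrib fps_nth_power_0)

interpretation frob_R: comm_ring_hom "frob_R :: 'p::prime_card R \<Rightarrow> 'p R"
  by (rule frob_R_hom)

lemma frob_R_const: "frob_R (fps_const c) = fps_const c"
  by (simp add: frob_R_def)

lemma frob_R_X: "frob_R fps_X = (1 + fps_X) ^ CARD('p) - (1 :: 'p::prime_card R)"
  by (simp add: frob_R_def fps_nth_power_0)

lemma frob_R_nth_0: "fps_nth (frob_R r) 0 = fps_nth r 0"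
  by (simp add: frob_R_def)

lemma fps_X_ideal: "fps_X \<in> (ideal_power 1 :: 'c::adic_ring fps set)"
  by (simp add: ideal_gens_fps_def ideal_gens_power_1)

lemma fps_nth_0_ideal_iff: "(f :: 'c::adic_ring fps) \<in> ideal_power 1 \<longleftrightarrow> fps_nth f 0 \<in> ideal_power 1"
proof
  assume *: "fps_nth f 0 \<in> ideal_power 1"
  have "fps_nth f i \<in> ideal_power (1 - i)" for i
    using * by (cases i) (simp_all add: ideal_power_0_UNIV)
  then show "f \<in> ideal_power 1"
    unfolding ideal_power_fps by blast
qed (auto simp: ideal_power_fps dest: spec[of _ 0])

lemma frob_R_ideal: "r \<in> ideal_power n \<Longrightarrow> frob_R r \<in> ideal_power n"
proof (rule hom_ideal_power[OF frob_R_hom])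
  fix g :: "'a R" assume "g \<in> ideal_gens"
  then have "fps_nth g 0 \<in> ideal_power 1"
    by (rule fps_nth_0_ideal_gens)
  then show "frob_R g \<in> ideal_power 1"
    by (simp only: fps_nth_0_ideal_iff frob_R_nth_0)
qed

context odd_prime_card
begin

lemma sqrt_q_square: "sqrt_q ^ 2 = (1 + fps_X :: 'p R)"
proof (rule fps_ext)
  fix n
  have nth: "fps_nth sqrt_q k = (zp_of_rat ((1 / 2) gchoose k) :: 'p zp)" for k
    using zp_of_rat_eqI[OF zp_represents_of_int[of 1], where 'p = 'p]
    by (cases k) (simp_all add: sqrt_q_def q_bracket_def)
  have "zp_represents (\<Sum>i\<in>{0..n}. ((1 / 2) gchoose i) * ((1 / 2) gchoose (n - i))) (fps_nth (sqrt_q ^ 2 :: 'p R) n)"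
    unfolding power2_eq_square fps_mult_nth nth
    by (intro zp_represents_sum zp_represents_mult zp_of_rat_half_gchoose)
  also have "(\<Sum>i\<in>{0..n}. ((1 / 2) gchoose i) * ((1 / 2 :: rat) gchoose (n - i))) = of_int (int (1 choose n))"
    by (simp add: gbinomial_Vandermonde binomial_gbinomial)
  finally have "fps_nth (sqrt_q ^ 2 :: 'p R) n = of_int (int (1 choose n))"
    using zp_represents_of_int by (rule zp_represents_unique)
  then show "fps_nth (sqrt_q ^ 2 :: 'p R) n = fps_nth (1 + fps_X) n"
    by (cases n; cases "n - 1") auto
qed

lemma sqrt_q_nth_0 [simp]: "fps_nth (sqrt_q :: 'p R) 0 = 1"
  by (simp add: sqrt_q_def)

lemma sqrt_q_neq_1: "sqrt_q \<noteq> (1 :: 'p R)"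
proof
  assume "sqrt_q = (1 :: 'p R)"
  then have "1 + fps_X = (1 :: 'p R)"
    using sqrt_q_square by simp
  then show False by simp
qed

lemma two_neq_0_zp: "(2 :: 'p zp) \<noteq> 0"
  using two_unit_zp by auto

text \<open>Both sides are square roots of q^p. The opposite sign is excluded because both have
  constant term 1 and 2 is nonzero.\<close>

lemma frob_R_sqrt_q: "frob_R sqrt_q = (sqrt_q ^ CARD('p) :: 'p R)"
proof -
  have "(frob_R sqrt_q) ^ 2 = frob_R (1 + fps_X :: 'p R)"
    by (simp flip: frob_R.hom_power sqrt_q_square)
  also have "\<dots> = (1 + fps_X) ^ CARD('p)"
    by (simp add: frob_R.hom_add frob_R_X)
  also have "\<dots> = (sqrt_q ^ 2) ^ CARD('p)"
    by (simp only: sqrt_q_square)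
  also have "\<dots> = (sqrt_q ^ CARD('p)) ^ 2"
    by (simp flip: power_mult add: mult.commute)
  finally have "(frob_R sqrt_q - sqrt_q ^ CARD('p)) * (frob_R sqrt_q + sqrt_q ^ CARD('p)) = (0 :: 'p R)"
    by (simp add: power2_eq_square algebra_simps)
  moreover have "fps_nth (frob_R sqrt_q + sqrt_q ^ CARD('p) :: 'p R) 0 = 2"
    by (simp add: frob_R_nth_0 fps_nth_power_0)
  then have "frob_R sqrt_q + sqrt_q ^ CARD('p) \<noteq> (0 :: 'p R)"
    using two_neq_0_zp by (metis fps_zero_nth)
  ultimately show ?thesis by simp
qed

lemma qnum_mult: "(sqrt_q - 1) * qnum k = (sqrt_q ^ k - 1 :: 'p R)"
  unfolding qnum_def by (rule power_diff_1_eq[symmetric])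

lemma qnum_eqI: "(sqrt_q - 1) * x = sqrt_q ^ k - 1 \<Longrightarrow> qnum k = (x :: 'p R)"
  using sqrt_q_neq_1 by (simp flip: qnum_mult)

lemma qnum_0 [simp]: "qnum 0 = 0"
  by (simp add: qnum_def)

lemma qnum_1 [simp]: "qnum (Suc 0) = 1"
  by (simp add: qnum_def)

lemma qnum_add: "qnum (a + b) = qnum a + sqrt_q ^ a * (qnum b :: 'p R)"
  by (rule qnum_eqI) (simp add: distrib_left mult.left_commute[of "sqrt_q - 1"] qnum_mult,
    simp add: algebra_simps power_add)

text \<open>The Frobenius changes the base t = q^(1/2) into t^p, so this is the product formula [p]
  in base t times [m] in base t^p.\<close>

lemma frob_R_qnum: "qnum CARD('p) * frob_R (qnum m) = (qnum (CARD('p) * m) :: 'p R)"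
proof (rule sym, rule qnum_eqI)
  have "frob_R ((sqrt_q - 1) * qnum m) = frob_R (sqrt_q ^ m - 1 :: 'p R)"
    by (simp add: qnum_mult)
  then have *: "(sqrt_q ^ CARD('p) - 1) * frob_R (qnum m) = sqrt_q ^ (CARD('p) * m) - (1 :: 'p R)"
    by (simp add: frob_R.hom_mult frob_R.hom_minus frob_R.hom_power frob_R_sqrt_q power_mult)
  show "(sqrt_q - 1) * (qnum CARD('p) * frob_R (qnum m)) = sqrt_q ^ (CARD('p) * m) - (1 :: 'p R)"
    unfolding mult.assoc[symmetric] qnum_mult * ..
qed

lemma qnum_dvd: "a dvd b \<Longrightarrow> qnum a dvd (qnum b :: 'p R)"
proof (elim dvdE)
  fix k assume b: "b = a * k"
  show "qnum a dvd (qnum b :: 'p R)"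
    unfolding b by (induction k) (auto simp: qnum_add)
qed

lemma qnum_nth_0: "fps_nth (qnum k :: 'p R) 0 = of_nat k"
  by (simp add: qnum_def fps_sum_nth fps_nth_power_0)

lemma qnum_cong: "qnum k - of_nat k \<in> (ideal_power 1 :: 'p R set)"
  by (simp add: fps_nth_0_ideal_iff[simplified] qnum_nth_0 flip: fps_of_nat)

lemma qnum_p_ideal: "qnum CARD('p) \<in> (ideal_power 1 :: 'p R set)"
  using ideal_power_add[OF qnum_cong[of "CARD('p)"] p_ideal_R] by simp

lemma qnum_unit: "\<not> CARD('p) dvd k \<Longrightarrow> \<exists>w. qnum k * w = (1 :: 'p R)"
  using p_prime by (intro unit_of_coprime[OF p_ideal_R _ qnum_cong])
    (metis coprime_commute prime_imp_coprime_nat)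

end

section \<open>The coefficients of the \<open>q\<close>-hypergeometric series\<close>

text \<open>Indices divisible by p contribute 1, as in the product defining Morita's p-adic gamma
  function, of whose factors this is a q-analogue. The omitted factors reappear through the
  Frobenius.\<close>

definition qnum_coprime :: "nat \<Rightarrow> 'p::prime_card R" where
  "qnum_coprime k = (if CARD('p) dvd k then 1 else qnum k)"

definition hyp_block :: "nat \<Rightarrow> 'p::prime_card R" where
  "hyp_block n = (\<Prod>i<n. qnum_coprime (2 * i + 1) * unit_inv (qnum_coprime (2 * i + 2)))"

text \<open>Put m = n div p. Below n the multiples of p among the 2i + 1 are p(2j + 1) for j < m,
  and also p(2m + 1) once n mod p exceeds (p - 1)/2; among the 2i + 2 they are p(2j + 2) for j < m.
  The pairs with j < m give the Frobenius image of the product for m, and the unpaired numerator is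
  the jump.\<close>

definition hyp_jump :: "nat \<Rightarrow> 'p::prime_card R" where
  "hyp_jump n = (if n mod CARD('p) > (CARD('p) - 1) div 2
     then qnum (CARD('p) * (2 * (n div CARD('p)) + 1)) else 1)"

text \<open>\<open>hyp_root n\<close> is the product of the \<open>[i + 1/2]\<^sub>q / [i + 1]\<^sub>q\<close> for \<open>i < n\<close>, and \<open>hyp_ratio n\<close> its
  quotient by the image under the Frobenius of the corresponding product for \<open>n div p\<close>.\<close>

definition hyp_ratio :: "nat \<Rightarrow> 'p::prime_card R" where
  "hyp_ratio n = hyp_block n * hyp_jump n"

function hyp_root :: "nat \<Rightarrow> 'p::prime_card R" where
  "hyp_root n = (if n = 0 then 1 else hyp_ratio n * frob_R (hyp_root (n div CARD('p))))"
  by auto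

termination
proof (relation "measure id")
  fix n :: nat assume "n \<noteq> 0"
  then show "(n div CARD('p::prime_card), n) \<in> measure id"
    using prime_gt_1_nat[OF prime_card[where 'a='p]] by simp
qed simp

declare hyp_root.simps [simp del]

context odd_prime_card
begin

lemma qnum_coprime_unit: "qnum_coprime k * unit_inv (qnum_coprime k) = (1 :: 'p R)"
  by (rule unit_inv) (auto simp: qnum_coprime_def intro: qnum_unit)

lemma hyp_block_0 [simp]: "hyp_block 0 = (1 :: 'p R)"
  by (simp add: hyp_block_def)

lemma hyp_block_Suc:
  "hyp_block (Suc n) = hyp_block n * (qnum_coprime (2 * n + 1) * unit_inv (qnum_coprime (2 * n + 2)))"
  by (simp add: hyp_block_def)

lemma hyp_root_eq: "hyp_root n = hyp_ratio n * (frob_R (hyp_root (n div CARD('p))) :: 'p R)"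
  by (cases "n = 0") (simp_all add: hyp_root.simps[of n] hyp_root.simps[of 0] hyp_ratio_def hyp_jump_def)

text \<open>A direct product would divide by \<open>qnum (2 * n + 2)\<close>, which lies in the
  ideal when p divides n + 1. The base-p recursion builds in integrality, and this lemma recovers
  the product. The cases are: p divides 2n + 2, p divides 2n + 1, or neither.\<close>

lemma hyp_root_Suc: "qnum (2 * n + 2) * hyp_root (Suc n) = qnum (2 * n + 1) * (hyp_root n :: 'p R)"
proof (induction n rule: less_induct)
  case (less n)
  define m where "m = n div CARD('p)"
  define a where "a = n mod CARD('p)"
  define h where "h = (CARD('p) - 1) div 2"
  have ph: "CARD('p) = 2 * h + 1" "h \<ge> 1"
    using odd_p p_ge_3 unfolding h_def by presburger+
  have n: "n = CARD('p) * m + a" and a: "a < CARD('p)"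
    using p_prime by (simp_all add: m_def a_def prime_gt_0_nat)
  have cop: "qnum_coprime k = (qnum k :: 'p R)" if "\<not> CARD('p) dvd k" for k
    using that by (simp add: qnum_coprime_def)
  have inv: "qnum k * unit_inv (qnum k) = (1 :: 'p R)" if "\<not> CARD('p) dvd k" for k
    using qnum_coprime_unit[of k] cop[OF that] by simp
  consider "a = CARD('p) - 1" | "a = h" | "a \<noteq> CARD('p) - 1" "a \<noteq> h" by blast
  then show ?case
  proof cases
    case 1
    then have Sn: "Suc n = CARD('p) * (m + 1)"
      using n a by simp
    then have Sn_mod: "Suc n mod CARD('p) = 0" "Suc n div CARD('p) = Suc m"
      using p_prime by (simp_all add: prime_gt_0_nat del: mult_Suc_right add_Suc_right)
    have n2: "2 * n + 2 = CARD('p) * (2 * m + 2)"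
      using Sn by (simp add: algebra_simps)
    have n1: "\<not> CARD('p) dvd 2 * n + 1"
    proof
      assume "CARD('p) dvd 2 * n + 1"
      moreover have "CARD('p) dvd 2 * n + 2" by (simp only: n2 dvd_triv_left)
      ultimately have "CARD('p) dvd (2 * n + 2) - (2 * n + 1)" by (rule dvd_diff_nat[rotated])
      then show False using p_ge_3 by simp
    qed
    have "m < n"
      using n 1 ph by (cases m) auto
    \<comment> \<open>Only in this case does the quotient by p advance from n to n + 1, so the
      recursion for m is carried over by the Frobenius; the factor [p] comes from [2n + 2] on one
      side and from the jump at n on the other.\<close>
    then have IH: "frob_R (qnum (2 * m + 2) * hyp_root (Suc m)) = frob_R (qnum (2 * m + 1) * (hyp_root m :: 'p R))"
      using less by simp
    have "h < a"
      using 1 ph by simp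
    then have jump: "hyp_jump (Suc n) = (1 :: 'p R)" "hyp_jump n = (qnum CARD('p) * frob_R (qnum (2 * m + 1)) :: 'p R)"
      unfolding hyp_jump_def frob_R_qnum a_def[symmetric] m_def[symmetric] h_def[symmetric] Sn_mod
      using \<open>h < a\<close> by simp_all
    have block: "hyp_block (Suc n) = hyp_block n * (qnum (2 * n + 1) :: 'p R)"
      unfolding hyp_block_Suc cop[OF n1] n2 by (simp add: qnum_coprime_def)
    have "qnum (2 * n + 2) * hyp_root (Suc n) = (qnum CARD('p) * frob_R (qnum (2 * m + 2))) *
        (hyp_block n * qnum (2 * n + 1) * frob_R (hyp_root (Suc m)) :: 'p R)"
      by (simp only: n2 frob_R_qnum hyp_root_eq[of "Suc n"] hyp_ratio_def jump block Sn_mod mult_1_right)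
    also have "\<dots> = qnum CARD('p) * hyp_block n * qnum (2 * n + 1) * frob_R (qnum (2 * m + 2) * hyp_root (Suc m))"
      by (simp add: frob_R.hom_mult ac_simps)
    also have "\<dots> = qnum (2 * n + 1) * (hyp_block n * (qnum CARD('p) * frob_R (qnum (2 * m + 1))) * frob_R (hyp_root m))"
      unfolding IH by (simp add: frob_R.hom_mult ac_simps)
    also have "\<dots> = qnum (2 * n + 1) * hyp_root n"
      by (simp only: hyp_root_eq[of n] hyp_ratio_def jump m_def)
    finally show ?thesis .
  next
    case 2
    have n1: "2 * n + 1 = CARD('p) * (2 * m + 1)"
      unfolding n 2 by (simp add: ph(1) algebra_simps)
    have n2: "\<not> CARD('p) dvd 2 * n + 2"
    proof
      assume "CARD('p) dvd 2 * n + 2"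
      moreover have "CARD('p) dvd 2 * n + 1" by (simp only: n1 dvd_triv_left)
      ultimately have "CARD('p) dvd (2 * n + 2) - (2 * n + 1)" by (rule dvd_diff_nat)
      then show False using p_ge_3 by simp
    qed
    have "Suc n = CARD('p) * m + Suc h" "Suc h < CARD('p)"
      using n 2 ph by auto
    then have Sn_mod: "Suc n mod CARD('p) = Suc h" "Suc n div CARD('p) = m"
      by (simp_all only: mod_mult_self4 mod_less div_mult_self4) (simp_all)
    have jump: "hyp_jump (Suc n) = (qnum (2 * n + 1) :: 'p R)" "hyp_jump n = (1 :: 'p R)"
      unfolding hyp_jump_def n1 a_def[symmetric] m_def[symmetric] h_def[symmetric] Sn_mod
      using 2 by simp_all
    have block: "hyp_block (Suc n) = hyp_block n * (unit_inv (qnum (2 * n + 2)) :: 'p R)"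
      unfolding hyp_block_Suc cop[OF n2] n1 by (simp add: qnum_coprime_def)
    have "qnum (2 * n + 2) * hyp_root (Suc n) = (qnum (2 * n + 2) * unit_inv (qnum (2 * n + 2))) *
        (qnum (2 * n + 1) * (hyp_block n * frob_R (hyp_root m)) :: 'p R)"
      by (simp only: hyp_root_eq[of "Suc n"] hyp_ratio_def jump block Sn_mod ac_simps)
    also have "\<dots> = qnum (2 * n + 1) * hyp_root n"
      by (simp only: inv[OF n2] hyp_root_eq[of n] hyp_ratio_def jump m_def mult_1_left mult_1_right)
    finally show ?thesis .
  next
    case 3
    then have "Suc n = CARD('p) * m + Suc a" "Suc a < CARD('p)"
      using n a by auto
    then have Sn_mod: "Suc n mod CARD('p) = Suc a" "Suc n div CARD('p) = m"
      by (simp_all only: mod_mult_self4 mod_less div_mult_self4) (simp_all)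
    have n1: "\<not> CARD('p) dvd 2 * n + 1"
    proof
      assume "CARD('p) dvd 2 * n + 1"
      also have "2 * n + 1 = CARD('p) * (2 * m) + (2 * a + 1)"
        by (simp add: n)
      finally have "CARD('p) dvd 2 * a + 1"
        by (simp only: dvd_add_right_iff[OF dvd_triv_left])
      then obtain c where c: "2 * a + 1 = CARD('p) * c" ..
      have "c = 1"
      proof -
        have "c < 2"
        proof (rule ccontr)
          assume "\<not> c < 2"
          then have "CARD('p) * 2 \<le> CARD('p) * c" by (intro mult_le_mono2) simp
          then show False using c a by linarith
        qed
        moreover have "c \<noteq> 0" using c by (intro notI) simp
        ultimately show ?thesis by simp
      qed
      then show False using c 3 ph by simp
    qed
    have n2: "\<not> CARD('p) dvd 2 * n + 2"
    proof
      assume "CARD('p) dvd 2 * n + 2"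
      also have "2 * n + 2 = CARD('p) * (2 * m) + 2 * (a + 1)"
        by (simp add: n)
      finally have "CARD('p) dvd 2 * (a + 1)"
        by (simp only: dvd_add_right_iff[OF dvd_triv_left])
      then have "CARD('p) dvd a + 1"
        using p_prime odd_p by (metis coprime_dvd_mult_right_iff coprime_right_2_iff_odd)
      then have "CARD('p) \<le> a + 1" by (rule dvd_imp_le) simp
      then show False using 3 a by linarith
    qed
    have jump: "hyp_jump (Suc n) = (hyp_jump n :: 'p R)"
      unfolding hyp_jump_def a_def[symmetric] m_def[symmetric] h_def[symmetric] Sn_mod
      using 3 by (simp add: less_Suc_eq)
    have block: "hyp_block (Suc n) = hyp_block n * (qnum (2 * n + 1) * unit_inv (qnum (2 * n + 2)) :: 'p R)"
      unfolding hyp_block_Suc cop[OF n2] cop[OF n1] ..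
    have "qnum (2 * n + 2) * hyp_root (Suc n) = (qnum (2 * n + 2) * unit_inv (qnum (2 * n + 2))) *
        (qnum (2 * n + 1) * (hyp_block n * hyp_jump n * frob_R (hyp_root m)) :: 'p R)"
      by (simp only: hyp_root_eq[of "Suc n"] hyp_ratio_def jump block Sn_mod ac_simps)
    also have "\<dots> = qnum (2 * n + 1) * hyp_root n"
      by (simp only: inv[OF n2] hyp_root_eq[of n] hyp_ratio_def jump m_def mult_1_left)
    finally show ?thesis .
  qed
qed

end

section \<open>Congruences modulo [p^s] for the ratios of coefficients\<close>

lemma dvd_prod_diff:
  fixes f g :: "'b \<Rightarrow> 'a::comm_ring_1"
  assumes "\<And>i. i \<in> A \<Longrightarrow> d dvd f i - g i"
  shows "d dvd prod f A - prod g A"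
  using assms
proof (induction A rule: infinite_finite_induct)
  case (insert x F)
  have "prod f (insert x F) - prod g (insert x F) = f x * (prod f F - prod g F) + (f x - g x) * prod g F"
    using insert by (simp add: algebra_simps)
  then show ?case
    using insert by (simp add: dvd_add)
qed simp_all

lemma dvd_mult_diff:
  fixes a b c d e :: "'a::comm_ring_1"
  assumes "e dvd a - b" "e dvd c - d"
  shows "e dvd a * c - b * d"
proof -
  have "a * c - b * d = a * (c - d) + (a - b) * d"
    by (simp add: algebra_simps)
  then show ?thesis
    using assms by (simp add: dvd_add)
qed

lemma bij_betw_double_mod:
  fixes N n c :: nat
  assumes "odd N"
  shows "bij_betw (\<lambda>i. (2 * i + c) mod N) {n..<n + N} {..<N}"
proof -
  have N: "N > 0" using assms by (rule odd_pos)
  have inj: "inj_on (\<lambda>i. (2 * i + c) mod N) {n..<n + N}"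
  proof (rule linorder_inj_onI)
    fix i j assume ij: "i < j" "i \<in> {n..<n + N}" "j \<in> {n..<n + N}"
    show "(2 * i + c) mod N \<noteq> (2 * j + c) mod N"
    proof
      assume "(2 * i + c) mod N = (2 * j + c) mod N"
      then have "N dvd (2 * j + c) - (2 * i + c)"
        using ij(1) by (intro mod_eq_dvd_iff_nat[THEN iffD1]) auto
      then have "N dvd 2 * (j - i)"
        by (simp add: diff_mult_distrib2)
      then have "N dvd j - i"
        using assms by (metis coprime_dvd_mult_right_iff coprime_right_2_iff_odd)
      then show False
        using ij by (auto dest: dvd_imp_le)
    qed
  qed auto
  moreover have "(\<lambda>i. (2 * i + c) mod N) ` {n..<n + N} = {..<N}"
    using N by (intro card_subset_eq) (auto simp: card_image[OF inj])
  ultimately show ?thesis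
    by (simp add: bij_betw_def)
qed

context odd_prime_card
begin

lemma qnum_coprime_cong:
  assumes "s > 0"
  shows "qnum (CARD('p) ^ s) dvd qnum_coprime (x + CARD('p) ^ s * y) - (qnum_coprime x :: 'p R)"
proof -
  have "CARD('p) dvd x + CARD('p) ^ s * y \<longleftrightarrow> CARD('p) dvd x"
    using assms by (intro dvd_add_left_iff dvd_mult2 dvd_power) auto
  moreover have "qnum (CARD('p) ^ s) dvd sqrt_q ^ x * (qnum (CARD('p) ^ s * y) :: 'p R)"
    by (rule dvd_mult, rule qnum_dvd) simp
  ultimately show ?thesis
    by (simp add: qnum_coprime_def qnum_add)
qed

lemma qnum_coprime_cong_mod:
  assumes "s > 0"
  shows "qnum (CARD('p) ^ s) dvd qnum_coprime x - (qnum_coprime (x mod CARD('p) ^ s) :: 'p R)"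
  using qnum_coprime_cong[OF assms, of "x mod CARD('p) ^ s" "x div CARD('p) ^ s"] by simp

text \<open>Over p^s consecutive i the indices 2i + 1 and 2i + 2 both run through all residues
  modulo the odd number p^s. Numerators and denominators then have congruent products, so each
  further block contributes a factor congruent to 1. For s > 0 the residue also decides divisibility
  by p.\<close>

lemma hyp_block_cong:
  assumes s: "s > 0"
  shows "qnum (CARD('p) ^ s) dvd hyp_block (n + CARD('p) ^ s * k) - (hyp_block n :: 'p R)"
proof (induction k)
  case (Suc k)
  let ?P = "CARD('p) ^ s"
  let ?n = "n + ?P * k"
  let ?M = "qnum ?P :: 'p R"
  define D where "D c = (\<Prod>i\<in>{?n..<?n + ?P}. qnum_coprime (2 * i + c) :: 'p R)" for c
  define E where "E = (\<Prod>y<?P. qnum_coprime y :: 'p R)"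
  define I where "I = (\<Prod>i\<in>{?n..<?n + ?P}. unit_inv (qnum_coprime (2 * i + 2)) :: 'p R)"
  have "?M dvd D c - E" for c
  proof -
    have "odd ?P" using odd_p by simp
    then have "E = (\<Prod>i\<in>{?n..<?n + ?P}. qnum_coprime ((2 * i + c) mod ?P))"
      unfolding E_def by (rule prod.reindex_bij_betw[OF bij_betw_double_mod, symmetric])
    then show ?thesis
      unfolding D_def by (simp only:) (rule dvd_prod_diff, rule qnum_coprime_cong_mod[OF s])
  qed
  from dvd_diff[OF this[of 1] this[of 2]] have D: "?M dvd D 1 - D 2"
    by simp
  have DI: "D 2 * I = 1"
    unfolding D_def I_def prod.distrib[symmetric] qnum_coprime_unit by simp
  have "{..<?n + ?P} = {..<?n} \<union> {?n..<?n + ?P}"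
    by auto
  then have "hyp_block (?n + ?P) = hyp_block ?n * (D 1 * I)"
    unfolding hyp_block_def D_def I_def by (simp add: prod.union_disjoint prod.distrib ivl_disj_int)
  then have "hyp_block (?n + ?P) - hyp_block ?n = hyp_block ?n * ((D 1 - D 2) * I)"
    by (simp add: left_diff_distrib DI right_diff_distrib)
  then have "?M dvd hyp_block (?n + ?P) - hyp_block ?n"
    using D by simp
  from dvd_add[OF this Suc] show ?case
    by (simp add: ac_simps)
qed simp

lemma hyp_jump_cong:
  assumes s: "s > 0"
  shows "qnum (CARD('p) ^ s) dvd hyp_jump (n + CARD('p) ^ s * k) - (hyp_jump n :: 'p R)"
proof -
  obtain r where r: "s = Suc r" using s by (cases s) auto
  have p0: "CARD('p) > 0" using p_prime by (rule prime_gt_0_nat)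
  have eq: "n + CARD('p) ^ s * k = n + CARD('p) * (CARD('p) ^ r * k)"
    by (simp add: r)
  have mod: "(n + CARD('p) ^ s * k) mod CARD('p) = n mod CARD('p)"
    "(n + CARD('p) ^ s * k) div CARD('p) = n div CARD('p) + CARD('p) ^ r * k"
    unfolding eq using p0 by simp_all
  have "CARD('p) * (2 * (n div CARD('p) + CARD('p) ^ r * k) + 1) =
      CARD('p) * (2 * (n div CARD('p)) + 1) + CARD('p) ^ s * (2 * k)"
    by (simp add: r algebra_simps)
  then have "qnum (CARD('p) ^ s) dvd qnum (CARD('p) * (2 * (n div CARD('p) + CARD('p) ^ r * k) + 1)) -
      (qnum (CARD('p) * (2 * (n div CARD('p)) + 1)) :: 'p R)"
    by (simp only: qnum_add) (simp add: qnum_dvd)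
  then show ?thesis
    by (simp add: hyp_jump_def mod)
qed

end

section \<open>Dwork congruences\<close>

text \<open>The i-fold Frobenius twist of [p^s]. Passing to a residue class modulo p divides the
  modulus by its value at s = 1 and replaces i by i + 1.\<close>

definition dwork_modulus :: "nat \<Rightarrow> nat \<Rightarrow> 'p::prime_card R" where
  "dwork_modulus i s = (frob_R ^^ i) (qnum (CARD('p) ^ s))"

definition dwork_weight :: "nat \<Rightarrow> (nat \<Rightarrow> 'p::prime_card R) \<Rightarrow> bool" where
  "dwork_weight i w \<longleftrightarrow> (\<forall>s n k. dwork_modulus i s dvd w (n + CARD('p) ^ s * k) - w n)"

definition hyp_coeff :: "nat \<Rightarrow> nat \<Rightarrow> 'p::prime_card R" where
  "hyp_coeff i n = (frob_R ^^ i) (hyp_root n ^ 2)"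

definition hyp_series :: "nat \<Rightarrow> (nat \<Rightarrow> 'p::prime_card R) \<Rightarrow> 'p R fps" where
  "hyp_series i w = Abs_fps (\<lambda>n. w n * hyp_coeff i n)"

lemma frob_R_funpow_hom: "comm_ring_hom (frob_R ^^ i :: 'p::prime_card R \<Rightarrow> 'p R)"
proof (induction i)
  case (Suc i)
  then interpret h: comm_ring_hom "frob_R ^^ i :: 'p R \<Rightarrow> 'p R" .
  show ?case
    by unfold_locales (simp_all add: h.hom_add h.hom_mult frob_R.hom_add frob_R.hom_mult)
qed (unfold_locales, simp_all)

lemma dwork_weight_mult:
  "dwork_weight i v \<Longrightarrow> dwork_weight i w \<Longrightarrow> dwork_weight i (\<lambda>n. v n * w n)"
  by (simp add: dwork_weight_def dvd_mult_diff)

lemma dwork_weight_const: "dwork_weight i (\<lambda>_. c)"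
  by (simp add: dwork_weight_def)

lemma fps_sections:
  fixes F :: "'a::comm_ring_1 fps"
  assumes "p > 0"
  shows "F = (\<Sum>a<p. fps_X ^ a * dil p (Abs_fps (\<lambda>m. fps_nth F (a + p * m))))"
proof (rule fps_ext)
  fix n
  have "fps_nth (\<Sum>a<p. fps_X ^ a * dil p (Abs_fps (\<lambda>m. fps_nth F (a + p * m)))) n =
      (\<Sum>a<p. if a = n mod p then fps_nth F n else 0)"
    unfolding fps_sum_nth
  proof (intro sum.cong refl)
    fix a assume a: "a \<in> {..<p}"
    show "fps_nth (fps_X ^ a * dil p (Abs_fps (\<lambda>m. fps_nth F (a + p * m)))) n = (if a = n mod p then fps_nth F n else 0)"
    proof (cases "a = n mod p")
      case True
      then have "a \<le> n" "p dvd n - a" "a + p * ((n - a) div p) = n"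
        by (auto simp: dvd_minus_mod)
      then show ?thesis
        using True mod_less_eq_dividend[of n p] by (simp add: fps_X_power_mult_nth dil_nth not_less[symmetric] del: mod_less_eq_dividend)
    next
      case False
      have "\<not> p dvd n - a" if "a \<le> n"
      proof
        assume "p dvd n - a"
        then have "n mod p = a mod p"
          using that by (simp add: mod_eq_dvd_iff_nat)
        then show False using False a by simp
      qed
      then show ?thesis
        using False by (simp add: fps_X_power_mult_nth dil_nth)
    qed
  qed
  also have "\<dots> = fps_nth F n"
    using assms by simp
  finally show "fps_nth F n = fps_nth (\<Sum>a<p. fps_X ^ a * dil p (Abs_fps (\<lambda>m. fps_nth F (a + p * m)))) n" ..
qed

context odd_prime_card
begin

lemma dwork_modulus_0: "dwork_modulus i 0 = (1 :: 'p R)"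
proof -
  interpret comm_ring_hom "frob_R ^^ i :: 'p R \<Rightarrow> 'p R" by (rule frob_R_funpow_hom)
  show ?thesis by (simp add: dwork_modulus_def)
qed

lemma dwork_modulus_Suc: "dwork_modulus i (Suc s) = dwork_modulus i 1 * (dwork_modulus (Suc i) s :: 'p R)"
proof -
  interpret comm_ring_hom "frob_R ^^ i :: 'p R \<Rightarrow> 'p R" by (rule frob_R_funpow_hom)
  show ?thesis
    unfolding dwork_modulus_def by (simp add: funpow_swap1 flip: hom_mult frob_R_qnum)
qed

lemma frob_R_funpow_ideal: "r \<in> ideal_power n \<Longrightarrow> (frob_R ^^ i) r \<in> (ideal_power n :: 'p R set)"
  by (induction i) (auto intro: frob_R_ideal)

lemma dwork_modulus_1_ideal: "dwork_modulus i 1 \<in> (ideal_power 1 :: 'p R set)"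
  unfolding dwork_modulus_def by (rule frob_R_funpow_ideal) (use qnum_p_ideal in simp)

lemma dwork_modulus_1_neq_0: "dwork_modulus i 1 \<noteq> (0 :: 'p R)"
proof -
  have "fps_nth ((frob_R ^^ i) r) 0 = fps_nth r 0" for r :: "'p R"
    by (induction i) (simp_all add: frob_R_nth_0)
  then have "fps_nth (dwork_modulus i 1) 0 = (of_nat CARD('p) :: 'p zp)"
    by (simp add: dwork_modulus_def qnum_nth_0)
  then show ?thesis
    using p_neq_0_zp[where 'p='p] by auto
qed

lemma frob_R_funpow_dvd: "a dvd b \<Longrightarrow> (frob_R ^^ i) a dvd ((frob_R ^^ i) b :: 'p R)"
proof -
  interpret comm_ring_hom "frob_R ^^ i :: 'p R \<Rightarrow> 'p R" by (rule frob_R_funpow_hom)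
  show "a dvd b \<Longrightarrow> (frob_R ^^ i) a dvd ((frob_R ^^ i) b :: 'p R)"
    by (auto simp: hom_mult)
qed

lemma dwork_weight_frob:
  assumes "\<And>s n k. s > 0 \<Longrightarrow> qnum (CARD('p) ^ s) dvd w (n + CARD('p) ^ s * k) - (w n :: 'p R)"
  shows "dwork_weight i (\<lambda>n. (frob_R ^^ i) (w n))"
  unfolding dwork_weight_def
proof (intro allI)
  interpret comm_ring_hom "frob_R ^^ i :: 'p R \<Rightarrow> 'p R" by (rule frob_R_funpow_hom)
  fix s n k
  show "dwork_modulus i s dvd (frob_R ^^ i) (w (n + CARD('p) ^ s * k)) - (frob_R ^^ i) (w n)"
  proof (cases "s = 0")
    case True
    then show ?thesis by (simp add: dwork_modulus_0)
  next
    case False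
    then show ?thesis
      using frob_R_funpow_dvd[OF assms, of s i n k] by (simp add: dwork_modulus_def hom_minus)
  qed
qed

lemma dwork_weight_ratio: "dwork_weight i (\<lambda>n. (frob_R ^^ i) (hyp_ratio n ^ 2 :: 'p R))"
  unfolding power2_eq_square hyp_ratio_def
  by (rule dwork_weight_frob) (intro dvd_mult_diff hyp_block_cong hyp_jump_cong)

lemma hyp_coeff_rec:
  "hyp_coeff i n = (frob_R ^^ i) (hyp_ratio n ^ 2) * (hyp_coeff (Suc i) (n div CARD('p)) :: 'p R)"
proof -
  interpret comm_ring_hom "frob_R ^^ i :: 'p R \<Rightarrow> 'p R" by (rule frob_R_funpow_hom)
  show ?thesis
    unfolding hyp_coeff_def
    by (subst hyp_root_eq) (simp add: hom_mult hom_power frob_R.hom_power funpow_swap1 power_mult_distrib)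
qed

lemma hyp_root_0 [simp]: "hyp_root 0 = (1 :: 'p R)"
  by (simp add: hyp_root.simps[of 0])

lemma hyp_coeff_0 [simp]: "hyp_coeff i 0 = (1 :: 'p R)"
proof -
  interpret comm_ring_hom "frob_R ^^ i :: 'p R \<Rightarrow> 'p R" by (rule frob_R_funpow_hom)
  show ?thesis by (simp add: hyp_coeff_def)
qed

text \<open>The divided difference w' is again a weight: modulo level s + 1, w determines w' modulo
  level s of the next twist, because the moduli factor and the first factor is nonzero in a
  domain.\<close>

lemma dwork_weight_section:
  assumes w: "dwork_weight i (w :: nat \<Rightarrow> 'p R)"
  shows "\<exists>w'. dwork_weight (Suc i) w' \<and> (\<forall>m. w (a + CARD('p) * m) = w a + dwork_modulus i 1 * w' m)"
proof -
  have 1: "dwork_modulus i 1 dvd w (a + CARD('p) * m) - w a" for m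
    using w[unfolded dwork_weight_def, rule_format, of 1 a m] by simp
  then have "\<forall>m. \<exists>c. w (a + CARD('p) * m) - w a = dwork_modulus i 1 * c"
    by (blast elim: dvdE)
  then obtain w' where w': "\<And>m. w (a + CARD('p) * m) - w a = dwork_modulus i 1 * w' m"
    by metis
  have "dwork_weight (Suc i) w'"
    unfolding dwork_weight_def
  proof (intro allI)
    fix s n k
    have "dwork_modulus i (Suc s) dvd w (a + CARD('p) * n + CARD('p) ^ Suc s * k) - w (a + CARD('p) * n)"
      using w unfolding dwork_weight_def by blast
    also have "w (a + CARD('p) * n + CARD('p) ^ Suc s * k) - w (a + CARD('p) * n) =
        (w (a + CARD('p) * (n + CARD('p) ^ s * k)) - w a) - (w (a + CARD('p) * n) - w a)"
      by (simp add: algebra_simps)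
    also have "\<dots> = dwork_modulus i 1 * (w' (n + CARD('p) ^ s * k) - w' n)"
      by (simp only: w' right_diff_distrib)
    finally show "dwork_modulus (Suc i) s dvd w' (n + CARD('p) ^ s * k) - w' n"
      unfolding dwork_modulus_Suc[of i s] using dwork_modulus_1_neq_0 by simp
  qed
  then show ?thesis
    using w' by (metis add.commute diff_add_cancel)
qed


section \<open>Induction on the precision\<close>

abbreviation SR :: "'p R fps set" where
  "SR \<equiv> range (lexp :: 'p S' \<Rightarrow> 'p R fps)"

lemma SR_add: "x \<in> SR \<Longrightarrow> y \<in> SR \<Longrightarrow> x + y \<in> SR"
  by (auto simp flip: lexp.hom_add)

lemma SR_mult: "x \<in> SR \<Longrightarrow> y \<in> SR \<Longrightarrow> x * y \<in> SR"
  by (auto simp flip: lexp.hom_mult)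

lemma SR_const: "fps_const c \<in> SR"
  by (rule range_eqI, rule lexp_algebra_map[symmetric])

lemma SR_X_power: "fps_X ^ n \<in> SR"
  by (rule range_eqI[of _ _ "lam ^ n"]) (simp add: lexp.hom_power lexp_lam)

lemma SR_sum: "(\<And>i. i \<in> A \<Longrightarrow> f i \<in> SR) \<Longrightarrow> sum f A \<in> SR"
proof (induction A rule: infinite_finite_induct)
  case (insert x F)
  then show ?case by (simp add: SR_add)
qed (use SR_const[of 0] in simp_all)

lemma SR_dil: "x \<in> SR \<Longrightarrow> dil CARD('p) x \<in> SR"
  by (rule range_lexp_dil[OF p_prime p_ideal_R])

abbreviation hyp :: "nat \<Rightarrow> 'p R fps" where
  "hyp i \<equiv> hyp_series i (\<lambda>_. 1)"

text \<open>With v = w times the squared ratio, the section of the series at residue a has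
  coefficients v(a + pk) A_k for the next twist. Writing v(a + pk) = v(a) + m w'(k) leaves an error
  m times a weighted series known to precision K. The factor m lies in the ideal, which gains one
  power and makes B congruent to the truncation in degrees below p.\<close>

lemma dwork_step:
  assumes w: "dwork_weight i w"
    and IH: "\<And>w'. dwork_weight (Suc i) w' \<Longrightarrow>
      \<exists>e\<in>SR. hyp_series (Suc i) w' - e * hyp (Suc i) \<in> coeff_ideal K"
  shows "\<exists>B\<in>SR. hyp_series i w - B * dil CARD('p) (hyp (Suc i)) \<in> coeff_ideal (Suc K)
    \<and> B - (\<Sum>a<CARD('p). fps_X ^ a * fps_const (w a * hyp_coeff i a)) \<in> coeff_ideal 1"
proof -
  let ?d = "dil CARD('p) :: 'p R fps \<Rightarrow> 'p R fps"
  have p0: "CARD('p) > 0" using p_prime by (rule prime_gt_0_nat)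
  interpret D: comm_ring_hom ?d by (rule dil_hom[OF p0])
  define m where "m = (dwork_modulus i 1 :: 'p R)"
  define v where "v n = w n * (frob_R ^^ i) (hyp_ratio n ^ 2)" for n
  have v: "dwork_weight i v"
    unfolding v_def using w dwork_weight_ratio by (rule dwork_weight_mult)
  have va: "v a = w a * hyp_coeff i a" if "a < CARD('p)" for a
    unfolding v_def using that by (simp add: hyp_coeff_rec[of i a])
  obtain w' where w': "\<And>a. dwork_weight (Suc i) (w' a)" "\<And>a k. v (a + CARD('p) * k) = v a + m * w' a k"
    using dwork_weight_section[OF v] unfolding m_def by metis
  obtain e where e: "\<And>a. e a \<in> SR"
    "\<And>a. hyp_series (Suc i) (w' a) - e a * hyp (Suc i) \<in> coeff_ideal K"
    using IH[OF w'(1)] by metis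
  define B where "B = (\<Sum>a<CARD('p). fps_X ^ a * (fps_const (v a) + fps_const m * ?d (e a)))"
  have B: "B \<in> SR"
    unfolding B_def by (intro SR_sum SR_mult SR_X_power SR_add SR_const SR_dil e(1))
  have m: "fps_const m \<in> coeff_ideal 1"
    unfolding m_def by (intro coeff_ideal_const dwork_modulus_1_ideal)
  have sec: "Abs_fps (\<lambda>k. fps_nth (hyp_series i w) (a + CARD('p) * k)) =
      fps_const (v a) * hyp (Suc i) + fps_const m * hyp_series (Suc i) (w' a)" if "a < CARD('p)" for a
  proof (rule fps_ext)
    fix k
    have "(a + CARD('p) * k) div CARD('p) = k"
      using that by simp
    then have "w (a + CARD('p) * k) * hyp_coeff i (a + CARD('p) * k) = v (a + CARD('p) * k) * hyp_coeff (Suc i) k"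
      by (subst hyp_coeff_rec) (simp add: v_def mult.assoc)
    also have "\<dots> = (v a + m * w' a k) * hyp_coeff (Suc i) k"
      by (simp only: w'(2))
    finally have "w (a + CARD('p) * k) * hyp_coeff i (a + CARD('p) * k) = (v a + m * w' a k) * hyp_coeff (Suc i) k" .
    then show "fps_nth (Abs_fps (\<lambda>k. fps_nth (hyp_series i w) (a + CARD('p) * k))) k =
        fps_nth (fps_const (v a) * hyp (Suc i) + fps_const m * hyp_series (Suc i) (w' a)) k"
      by (simp add: hyp_series_def algebra_simps)
  qed
  have const: "?d (fps_const c) = fps_const c" for c
    using p0 by (simp add: dil_eq_compose)
  have "hyp_series i w = (\<Sum>a<CARD('p). fps_X ^ a * ?d (Abs_fps (\<lambda>k. fps_nth (hyp_series i w) (a + CARD('p) * k))))"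
    by (rule fps_sections[OF p0])
  also have "\<dots> = (\<Sum>a<CARD('p). fps_X ^ a * (fps_const (v a) * ?d (hyp (Suc i)) + fps_const m * ?d (hyp_series (Suc i) (w' a))))"
    by (intro sum.cong refl) (simp add: sec D.hom_add D.hom_mult const)
  finally have "hyp_series i w - B * ?d (hyp (Suc i)) =
      (\<Sum>a<CARD('p). fps_X ^ a * (fps_const (v a) * ?d (hyp (Suc i)) + fps_const m * ?d (hyp_series (Suc i) (w' a)))) -
      (\<Sum>a<CARD('p). fps_X ^ a * (fps_const (v a) + fps_const m * ?d (e a))) * ?d (hyp (Suc i))"
    unfolding B_def by (rule arg_cong2[where f = minus]) simp
  also have "\<dots> = (\<Sum>a<CARD('p). fps_X ^ a * (fps_const m * ?d (hyp_series (Suc i) (w' a) - e a * hyp (Suc i))))"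
    unfolding sum_distrib_right sum_subtractf[symmetric]
    by (intro sum.cong refl) (simp add: D.hom_minus D.hom_mult algebra_simps)
  also have "\<dots> \<in> coeff_ideal (Suc K)"
    using coeff_ideal_times[OF m dil_coeff_ideal[OF e(2)]]
    by (intro coeff_ideal_sum, rule_tac coeff_ideal_mult) simp
  finally have 1: "hyp_series i w - B * ?d (hyp (Suc i)) \<in> coeff_ideal (Suc K)" .
  have "B - (\<Sum>a<CARD('p). fps_X ^ a * fps_const (w a * hyp_coeff i a)) =
      (\<Sum>a<CARD('p). fps_X ^ a * (fps_const m * ?d (e a)))"
    unfolding B_def sum_subtractf[symmetric]
    by (intro sum.cong refl) (simp add: va algebra_simps)
  also have "\<dots> \<in> coeff_ideal 1"
    by (intro coeff_ideal_sum coeff_ideal_mult coeff_ideal_mult2[OF m])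
  finally show ?thesis
    using B 1 by blast
qed

text \<open>At q = 1 the product is (-1)^a times the binomial coefficient of -1/2 over a, and -1/2
  \<equiv> (p - 1)/2 modulo p. This is where the polynomial h comes from.\<close>

lemma hyp_root_cong:
  assumes "a < CARD('p)"
  shows "hyp_root a - of_int ((-1) ^ a * int (((CARD('p) - 1) div 2) choose a)) \<in> (ideal_power 1 :: 'p R set)"
  using assms
proof (induction a)
  case 0
  then show ?case by simp
next
  case (Suc a)
  define h where "h = (CARD('p) - 1) div 2"
  have ph: "int CARD('p) = 2 * int h + 1"
    using odd_p p_ge_3 unfolding h_def by presburger
  define c where "c k = (-1) ^ k * int (h choose k)" for k
  have binom: "(int a + 1) * int (h choose Suc a) = (int h - int a) * int (h choose a)"
  proof (cases "a \<le> h")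
    case True
    have "Suc a * (h choose Suc a) = (h - a) * (h choose a)"
      by (simp only: binomial_absorption binomial_absorb_comp)
    then have "int (Suc a * (h choose Suc a)) = int ((h - a) * (h choose a))"
      by (simp only:)
    then show ?thesis using True by (simp add: of_nat_diff algebra_simps)
  qed (simp add: binomial_eq_0)
  \<comment> \<open>From 2h = p - 1: the signed binomials obey the recursion of
    \<open>hyp_root\<close> up to a multiple of p.\<close>
  have "(2 * int a + 2) * c (Suc a) = - 2 * (-1) ^ a * ((int a + 1) * int (h choose Suc a))"
    by (simp add: c_def algebra_simps)
  also have "\<dots> = (2 * int a + 1) * c a - int CARD('p) * c a"
    unfolding binom by (simp add: c_def ph algebra_simps)
  finally have "(2 * int a + 2) * c (Suc a) = (2 * int a + 1) * c a - int CARD('p) * c a" .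
  then have "of_int ((2 * int a + 2) * c (Suc a)) = (of_int ((2 * int a + 1) * c a - int CARD('p) * c a) :: 'p R)"
    by (rule arg_cong)
  then have c: "of_nat (2 * a + 2) * of_int (c (Suc a)) = of_nat (2 * a + 1) * of_int (c a) - of_nat CARD('p) * (of_int (c a) :: 'p R)"
    by (simp add: ac_simps)
  have IH: "hyp_root a - of_int (c a) \<in> (ideal_power 1 :: 'p R set)"
    using Suc by (simp add: c_def h_def)
  have "qnum (2 * a + 2) * (hyp_root (Suc a) - of_int (c (Suc a))) =
      qnum (2 * a + 1) * (hyp_root a - of_int (c a)) + (qnum (2 * a + 1) - of_nat (2 * a + 1)) * of_int (c a)
      - (qnum (2 * a + 2) - of_nat (2 * a + 2)) * of_int (c (Suc a)) + of_nat CARD('p) * (of_int (c a) :: 'p R)"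
    unfolding right_diff_distrib left_diff_distrib c hyp_root_Suc by simp
  also have "\<dots> \<in> ideal_power 1"
    by (intro ideal_power_add ideal_power_mult[OF IH] ideal_power_diff[OF ideal_power_add] ideal_power_mult2 qnum_cong p_ideal_R)
  finally have *: "qnum (2 * a + 2) * (hyp_root (Suc a) - of_int (c (Suc a))) \<in> (ideal_power 1 :: 'p R set)" .
  have "\<not> CARD('p) dvd 2 * a + 2"
  proof
    assume "CARD('p) dvd 2 * a + 2"
    then have "CARD('p) dvd 2 * (a + 1)" by simp
    then have "CARD('p) dvd a + 1"
      using p_prime odd_p by (metis coprime_dvd_mult_right_iff coprime_right_2_iff_odd)
    then have "CARD('p) \<le> a + 1" by (rule dvd_imp_le) simp
    then show False using Suc.prems by simp
  qed
  then obtain u where "qnum (2 * a + 2) * u = (1 :: 'p R)"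
    using qnum_unit by blast
  then have "hyp_root (Suc a) - of_int (c (Suc a)) = u * (qnum (2 * a + 2) * (hyp_root (Suc a) - of_int (c (Suc a))))"
    by (simp flip: mult.assoc add: mult.commute[of u])
  also have "\<dots> \<in> ideal_power 1"
    using * by (rule ideal_power_mult)
  finally show ?case
    by (simp add: c_def h_def)
qed

lemma hyp_coeff_cong:
  assumes "a < CARD('p)"
  shows "hyp_coeff i a - of_nat ((((CARD('p) - 1) div 2) choose a)\<^sup>2) \<in> (ideal_power 1 :: 'p R set)"
proof -
  interpret h: comm_ring_hom "frob_R ^^ i :: 'p R \<Rightarrow> 'p R" by (rule frob_R_funpow_hom)
  define c where "c = ((CARD('p) - 1) div 2) choose a"
  have c: "of_int (((-1) ^ a * int c) ^ 2) = (of_nat (c ^ 2) :: 'p R)"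
    by (simp add: power_mult_distrib flip: power_mult)
  have "hyp_root a ^ 2 - of_nat (c ^ 2) = (hyp_root a + of_int ((-1) ^ a * int c)) * (hyp_root a - of_int ((-1) ^ a * int c) :: 'p R)"
    unfolding c[symmetric] by (simp add: power2_eq_square algebra_simps)
  also have "\<dots> \<in> ideal_power 1"
    using hyp_root_cong[OF assms] unfolding c_def by (rule ideal_power_mult)
  finally have "(frob_R ^^ i) (hyp_root a ^ 2 - of_nat (c ^ 2)) \<in> (ideal_power 1 :: 'p R set)"
    by (rule frob_R_funpow_ideal)
  then show ?thesis
    by (simp only: hyp_coeff_def c_def h.hom_minus h.hom_of_nat)
qed

lemma hyp_polynomial_cong:
  "(\<Sum>a<CARD('p). fps_X ^ a * fps_const (1 * hyp_coeff i a)) - fps_of_poly (hasse_poly CARD('p))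
    \<in> (coeff_ideal 1 :: 'p R fps set)"
  unfolding coeff_ideal_def
proof (rule CollectI, rule allI)
  fix n
  have "fps_nth (\<Sum>a<CARD('p). fps_X ^ a * fps_const (1 * hyp_coeff i a)) n =
      (\<Sum>a<CARD('p). if a = n then hyp_coeff i n else (0 :: 'p R))"
    unfolding fps_sum_nth by (intro sum.cong refl) (auto simp: fps_X_power_mult_nth)
  also have "\<dots> = (if n < CARD('p) then hyp_coeff i n else 0)"
    by simp
  finally have 1: "fps_nth (\<Sum>a<CARD('p). fps_X ^ a * fps_const (1 * hyp_coeff i a)) n =
      (if n < CARD('p) then hyp_coeff i n else (0 :: 'p R))" .
  have 2: "coeff (hasse_poly CARD('p)) n = (of_nat ((((CARD('p) - 1) div 2) choose n)\<^sup>2) :: 'p R)"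
    unfolding hasse_poly_def coeff_sum
    by (cases "n \<le> (CARD('p) - 1) div 2") (simp_all add: binomial_eq_0)
  have "n < CARD('p) \<or> ((CARD('p) - 1) div 2) choose n = 0"
    using p_ge_3 by (auto intro!: binomial_eq_0)
  then show "fps_nth ((\<Sum>a<CARD('p). fps_X ^ a * fps_const (1 * hyp_coeff i a)) - fps_of_poly (hasse_poly CARD('p))) n
      \<in> (ideal_power 1 :: 'p R set)"
    using hyp_coeff_cong[of n i] unfolding fps_sub_nth 1 fps_of_poly_nth 2 by (auto simp: binomial_eq_0)
qed

lemma dwork_step_1:
  assumes IH: "\<And>w'. dwork_weight (Suc i) w' \<Longrightarrow>
      \<exists>e\<in>SR. hyp_series (Suc i) w' - e * hyp (Suc i) \<in> coeff_ideal K"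
  shows "\<exists>z w :: 'p S'. z * w = 1
    \<and> lexp z - fps_of_poly (hasse_poly CARD('p)) ^ 1 \<in> coeff_ideal 1
    \<and> hyp i - lexp z * dil CARD('p) (hyp (Suc i)) \<in> coeff_ideal (Suc K)"
proof -
  obtain z where z: "hyp i - lexp z * dil CARD('p) (hyp (Suc i)) \<in> coeff_ideal (Suc K)"
    "lexp (z :: 'p S') - (\<Sum>a<CARD('p). fps_X ^ a * fps_const (1 * hyp_coeff i a)) \<in> coeff_ideal 1"
    using dwork_step[OF dwork_weight_const[of i 1] IH] by blast
  have "lexp z - fps_of_poly (hasse_poly CARD('p)) ^ 1 \<in> coeff_ideal 1"
    using coeff_ideal_trans[OF z(2) hyp_polynomial_cong] by simp
  then show ?thesis
    using lexp_unit[of z] z(1) by blast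
qed

text \<open>Up to precision, F_w is B times, and F is a unit z times, the same substituted series of
  the next twist. Eliminating it gives e = B / z. The twist has to vary in the induction, as the
  hypothesis is used at \<open>Suc i\<close>.\<close>

lemma dwork_congruence:
  assumes "dwork_weight i w"
  shows "\<exists>e\<in>SR. hyp_series i w - e * hyp i \<in> coeff_ideal K"
  using assms
proof (induction K arbitrary: i w)
  case 0
  then show ?case
    using SR_const by (auto simp: coeff_ideal_0_UNIV)
next
  case (Suc K)
  let ?F = "dil CARD('p) (hyp (Suc i))"
  obtain B where B: "B \<in> SR" "hyp_series i w - B * ?F \<in> coeff_ideal (Suc K)"
    using dwork_step[OF Suc.prems Suc.IH] by blast
  obtain z z' :: "'p S'" where z: "z * z' = 1" "hyp i - lexp z * ?F \<in> coeff_ideal (Suc K)"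
    using dwork_step_1[OF Suc.IH] by blast
  have zz: "lexp z' * lexp z = 1"
    using z(1) by (simp add: mult.commute flip: lexp.hom_mult)
  have "hyp_series i w - B * lexp z' * hyp i =
      (hyp_series i w - B * ?F) - B * lexp z' * (hyp i - lexp z * ?F) + B * (1 - lexp z' * lexp z) * ?F"
    by (simp add: algebra_simps)
  also have "\<dots> \<in> coeff_ideal (Suc K)"
    unfolding zz using B(2) z(2) by (simp add: coeff_ideal_diff coeff_ideal_mult)
  finally show ?case
    using B(1) by (intro bexI[of _ "B * lexp z'"] SR_mult) auto
qed

lemma hyp_inverse: "\<exists>G. hyp i * G = 1"
  by (rule exI[of _ "fps_right_inverse (hyp i) 1"], rule fps_right_inverse) (simp add: hyp_series_def)

text \<open>\<open>q\<close>-analogues of Dwork's theorems on \<open>f'/f\<close> and on \<open>f/\<phi>(f)\<close>\<close>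

theorem hyp_series_quotient:
  assumes "dwork_weight 0 w"
  shows "\<exists>x :: 'p S'. lexp x * hyp 0 = hyp_series 0 w"
proof -
  obtain G where G: "hyp 0 * G = 1"
    using hyp_inverse by blast
  have "hyp_series 0 w * G \<in> SR"
  proof (rule range_lexp_limit)
    fix n
    obtain e where e: "e \<in> SR" "hyp_series 0 w - e * hyp 0 \<in> coeff_ideal n"
      using dwork_congruence[OF assms] by blast
    have "hyp_series 0 w * G - e = (hyp_series 0 w - e * hyp 0) * G"
      using G by (simp add: left_diff_distrib mult.assoc)
    then show "\<exists>z\<in>SR. hyp_series 0 w * G - z \<in> coeff_ideal n"
      using e by (intro bexI[of _ e]) (simp_all add: coeff_ideal_mult2)
  qed
  then obtain x :: "'p S'" where "lexp x = hyp_series 0 w * G"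
    by (metis imageE)
  then have "lexp x * hyp 0 = hyp_series 0 w"
    using G by (simp add: mult.assoc mult.commute[of G])
  then show ?thesis ..
qed

theorem hyp_frobenius_quotient: "\<exists>v w :: 'p S'. v * w = 1 \<and> lexp v * dil CARD('p) (hyp 1) = hyp 0"
proof -
  have p0: "CARD('p) > 0" using p_prime by (rule prime_gt_0_nat)
  interpret D: comm_ring_hom "dil CARD('p) :: 'p R fps \<Rightarrow> 'p R fps" by (rule dil_hom[OF p0])
  obtain G where "hyp 1 * G = 1"
    using hyp_inverse by blast
  then have "dil CARD('p) (hyp 1 * G) = 1" by simp
  then have G: "dil CARD('p) (hyp 1) * dil CARD('p) G = 1"
    by (simp add: D.hom_mult)
  \<comment> \<open>With \<open>Suc n\<close> even the approximant for n = 0 determines the quotient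
    modulo the ideal, which is what \<open>lexp_unit\<close> asks for.\<close>
  have approx: "\<exists>z :: 'p S'. lexp z - fps_of_poly (hasse_poly CARD('p)) ^ 1 \<in> coeff_ideal 1
      \<and> hyp 0 * dil CARD('p) G - lexp z \<in> coeff_ideal (Suc n)" for n
  proof -
    obtain z :: "'p S'" where z: "hyp 0 - lexp z * dil CARD('p) (hyp 1) \<in> coeff_ideal (Suc n)"
      "lexp z - fps_of_poly (hasse_poly CARD('p)) ^ 1 \<in> coeff_ideal 1"
      using dwork_step_1[of 0 n] dwork_congruence[of "Suc 0"] by auto
    have "hyp 0 * dil CARD('p) G - lexp z = (hyp 0 - lexp z * dil CARD('p) (hyp 1)) * dil CARD('p) G"
      using G by (simp add: left_diff_distrib mult.assoc)
    then have "hyp 0 * dil CARD('p) G - lexp z \<in> coeff_ideal (Suc n)"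
      using z by (simp add: coeff_ideal_mult2)
    then show ?thesis
      using z(2) by blast
  qed
  have "hyp 0 * dil CARD('p) G \<in> SR"
  proof (rule range_lexp_limit)
    fix n
    obtain z :: "'p S'" where "hyp 0 * dil CARD('p) G - lexp z \<in> coeff_ideal (Suc n)"
      using approx by blast
    then show "\<exists>z\<in>SR. hyp 0 * dil CARD('p) G - z \<in> coeff_ideal n"
      using coeff_ideal_antimono[of n "Suc n"] by auto
  qed
  then obtain v :: "'p S'" where v: "lexp v = hyp 0 * dil CARD('p) G"
    by (metis imageE)
  obtain z :: "'p S'" where z: "lexp z - fps_of_poly (hasse_poly CARD('p)) ^ 1 \<in> coeff_ideal 1"
    "lexp v - lexp z \<in> coeff_ideal 1"
    using approx[of 0] v by auto
  have "lexp v - fps_of_poly (hasse_poly CARD('p)) ^ 1 \<in> coeff_ideal 1"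
    by (rule coeff_ideal_trans[OF z(2,1)])
  then obtain w where "v * w = 1"
    using lexp_unit by blast
  moreover have "lexp v * dil CARD('p) (hyp 1) = hyp 0"
    using G v by (simp add: mult.assoc mult.commute[of "dil CARD('p) G"])
  ultimately show ?thesis by blast
qed

end

section \<open>The structure maps in terms of expansions\<close>

lemma comm_ring_hom_comp:
  assumes "comm_ring_hom f" "comm_ring_hom g"
  shows "comm_ring_hom (\<lambda>x. g (f x))"
proof -
  interpret f: comm_ring_hom f by fact
  interpret g: comm_ring_hom g by fact
  show ?thesis by unfold_locales (simp_all add: f.hom_add f.hom_mult g.hom_add g.hom_mult)
qed

lemma fps_map_const: "f 0 = 0 \<Longrightarrow> fps_map f (fps_const c) = fps_const (f c)"
  by (rule fps_ext) simp

lemma fps_map_X: "f 0 = 0 \<Longrightarrow> f 1 = 1 \<Longrightarrow> fps_map f fps_X = fps_X"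
  by (rule fps_ext) (simp add: fps_X_def)

lemma dil_const: "k > 0 \<Longrightarrow> dil k (fps_const c) = (fps_const c :: 'a::comm_ring_1 fps)"
  by (simp add: dil_eq_compose)

text \<open>The source of the factor p in the horizontality of the Frobenius: dlog of \<lambda>^p is
  p dlog of \<lambda>.\<close>

lemma X_fps_deriv_dil:
  fixes F :: "'a::comm_ring_1 fps"
  assumes "k > 0"
  shows "fps_X * fps_deriv (dil k F) = of_nat k * dil k (fps_X * fps_deriv F)"
proof (rule fps_ext)
  fix n
  have *: "fps_nth (fps_X * fps_deriv G) m = of_nat m * fps_nth G m" for G :: "'a fps" and m
    by (cases m) simp_all
  show "fps_nth (fps_X * fps_deriv (dil k F)) n = fps_nth (of_nat k * dil k (fps_X * fps_deriv F)) n"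
    using assms by (auto simp: * dil_nth mult.assoc[symmetric] simp flip: fps_of_nat elim!: dvdE)
qed

lemma algebra_map_inj: "algebra_map c = (algebra_map d :: ('p::finite, 'c::complete_adic_ring) hloc completion) \<longleftrightarrow> c = d"
proof
  assume "algebra_map c = (algebra_map d :: ('p, 'c) hloc completion)"
  then have "lexp (algebra_map c :: ('p, 'c) hloc completion) = lexp (algebra_map d :: ('p, 'c) hloc completion)"
    by simp
  then show "c = d" by (simp add: lexp_algebra_map)
qed simp

text \<open>Cancellation in S' and B' is inherited from the domain of power series.\<close>

lemma lexp_mult_cancel:
  fixes x y z :: "('p::finite, 'c::complete_adic_ring) hloc completion"
  assumes "z * x = z * y" "z \<noteq> 0"
  shows "x = y"
proof -
  have "lexp z * lexp x = lexp z * lexp y"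
    using assms(1) by (simp flip: lexp.hom_mult)
  moreover have "lexp z \<noteq> 0"
    using assms(2) lexp_inj[of z 0] by simp
  ultimately show ?thesis
    by (simp add: lexp_inj)
qed

lemma lam_neq_0: "lam \<noteq> (0 :: ('p::finite, 'c::complete_adic_ring) hloc completion)"
proof
  assume "lam = (0 :: ('p, 'c) hloc completion)"
  then have "lexp (lam :: ('p, 'c) hloc completion) = 0" by simp
  then show False by (simp add: lexp_lam)
qed

lemma one_minus_lam_neq_0: "1 - lam \<noteq> (0 :: ('p::finite, 'c::complete_adic_ring) hloc completion)"
proof
  assume "1 - lam = (0 :: ('p, 'c) hloc completion)"
  then have "lexp (1 - lam :: ('p, 'c) hloc completion) = 0" by simp
  then have "1 - fps_X = (0 :: 'c fps)" by (simp add: lexp.hom_minus lexp_lam)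
  then have "fps_nth (1 - fps_X :: 'c fps) 0 = 0" by simp
  then show False by simp
qed

lemma qS_minus_1: "qS - 1 = (algebra_map fps_X :: 'p::prime_card S')"
  by (simp add: algebra_map.hom_add)

lemma qS_minus_1_neq_0: "qS - 1 \<noteq> (0 :: 'p::prime_card S')"
  using algebra_map_inj[of "fps_X :: 'p R" 0, where 'p = 'p] by (simp add: qS_minus_1)

lemma lexp_qS_minus_1: "lexp (qS - 1 :: 'p::prime_card S') = fps_const fps_X"
  by (simp add: qS_minus_1 lexp_algebra_map)

section \<open>Reduction modulo q - 1\<close>

abbreviation red_fps :: "'p::prime_card R fps \<Rightarrow> 'p zp fps" where
  "red_fps \<equiv> fps_map (\<lambda>r. fps_nth r 0)"

lemma red_fps_hom: "comm_ring_hom (red_fps :: 'p::prime_card R fps \<Rightarrow> _)"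
  by (rule fps_map_hom[OF fps_nth_0_hom])

interpretation red_fps: comm_ring_hom "red_fps :: 'p::prime_card R fps \<Rightarrow> 'p zp fps"
  by (rule red_fps_hom)

lemma red_unique:
  fixes f :: "'p::prime_card S' \<Rightarrow> 'p B'"
  assumes "comm_ring_hom f" "\<And>r. f (algebra_map r) = algebra_map (fps_nth r 0)" "f lam = lam"
  shows "lexp (f z) = red_fps (lexp z)"
proof (rule completion_hom_eqI[where f = "\<lambda>z. lexp (f z)" and g = "\<lambda>z. red_fps (lexp z)"])
  show "comm_ring_hom (\<lambda>z. lexp (f z))"
    by (rule comm_ring_hom_comp[OF assms(1) lexp_hom])
  show "comm_ring_hom (\<lambda>z :: 'p S'. red_fps (lexp z))"
    by (rule comm_ring_hom_comp[OF lexp_hom red_fps_hom])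
  show "lexp (f (algebra_map c)) \<in> coeff_ideal 1" if "c \<in> ideal_gens" for c
    unfolding assms(2) lexp_algebra_map by (rule coeff_ideal_const[OF fps_nth_0_ideal_gens[OF that]])
qed (simp_all add: assms lexp_algebra_map lexp_lam fps_map_const fps_map_X)

text \<open>Setting q = 1 in the coefficients of the expansion preserves the images, which gives
  existence; \<open>red_unique\<close> gives uniqueness, so the definite description
  \<open>red\<close> denotes.\<close>

lemma red_spec:
  "comm_ring_hom (red :: 'p::prime_card S' \<Rightarrow> 'p B') \<and> (\<forall>r. red (algebra_map r :: 'p S') = algebra_map (fps_nth r 0))
     \<and> red (lam :: 'p S') = lam"
proof -
  define f :: "'p S' \<Rightarrow> 'p B'" where "f z = (SOME w. lexp w = red_fps (lexp z))" for z
  have f: "lexp (f z) = red_fps (lexp z)" for z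
  proof -
    have "red_fps (lexp z) \<in> range (lexp :: 'p B' \<Rightarrow> _)"
      by (rule range_lexp_fps_map[OF fps_nth_0_hom fps_nth_0_ideal_gens]) auto
    then show ?thesis
      unfolding f_def by (metis (mono_tags, lifting) imageE someI)
  qed
  have 1: "comm_ring_hom f"
    by unfold_locales
      (simp_all add: lexp_inj[symmetric] f lexp.hom_add lexp.hom_mult red_fps.hom_add red_fps.hom_mult)
  have 2: "f (algebra_map r) = algebra_map (fps_nth r 0)" for r
    by (simp add: lexp_inj[symmetric] f lexp_algebra_map fps_map_const)
  have 3: "f lam = lam"
    by (simp add: lexp_inj[symmetric] f lexp_lam fps_map_X)
  have "\<exists>!f. comm_ring_hom f \<and> (\<forall>r. f (algebra_map r :: 'p S') = (algebra_map (fps_nth r 0) :: 'p B')) \<and> f lam = lam"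
  proof (rule ex1I[of _ f])
    fix g :: "'p S' \<Rightarrow> 'p B'"
    assume "comm_ring_hom g \<and> (\<forall>r. g (algebra_map r) = algebra_map (fps_nth r 0)) \<and> g lam = lam"
    then have "lexp (g z) = lexp (f z)" for z
      using red_unique[of g] f by simp
    then show "g = f" by (auto simp: lexp_inj)
  qed (use 1 2 3 in blast)
  from theI'[OF this] show ?thesis
    unfolding red_def[symmetric] .
qed

lemma red_hom: "comm_ring_hom (red :: 'p::prime_card S' \<Rightarrow> 'p B')"
  using red_spec by blast

interpretation red: comm_ring_hom "red :: 'p::prime_card S' \<Rightarrow> 'p B'"
  by (rule red_hom)

lemma lexp_red: "lexp (red z) = red_fps (lexp (z :: 'p::prime_card S'))"
  using red_spec[where 'p='p] by (intro red_unique) auto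

lemma red_algebra_map: "red (algebra_map r :: 'p::prime_card S') = algebra_map (fps_nth r 0)"
  using red_spec[where 'p='p] by blast

lemma red_lam: "red (lam :: 'p::prime_card S') = lam"
  using red_spec[where 'p='p] by blast

lemma red_qS_minus_1: "red (qS - 1 :: 'p::prime_card S') = 0"
  by (simp add: qS_minus_1 red_algebra_map)

lemma red_surj: "\<exists>z :: 'p::prime_card S'. red z = b"
proof -
  have "fps_map fps_const (lexp b) \<in> range (lexp :: 'p S' \<Rightarrow> _)"
    by (rule range_lexp_fps_map[OF fps_const_hom fps_const_ideal_gens]) auto
  then obtain z :: "'p S'" where "lexp z = fps_map fps_const (lexp b)"
    by (metis imageE)
  then have "lexp (red z) = lexp b"
    by (intro fps_ext) (simp add: lexp_red)
  then show ?thesis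
    by (auto simp: lexp_inj)
qed

lemma range_lexp_obtain:
  assumes "y \<in> range (lexp :: ('p::finite, 'c::complete_adic_ring) hloc completion \<Rightarrow> 'c fps)"
  obtains z :: "('p::finite, 'c::complete_adic_ring) hloc completion" where "lexp z = y"
  using assms by auto

text \<open>Coefficients without constant term are divisible by q - 1, and the quotient series stays
  in the image of S'. This justifies identifying S'/(q - 1) with B'.\<close>

lemma red_eq_0_iff:
  fixes z :: "'p::prime_card S'"
  shows "red z = 0 \<longleftrightarrow> (\<exists>y. z = (qS - 1) * y)"
proof
  assume "red z = 0"
  then have red: "red_fps (lexp z) = 0"
    by (simp flip: lexp_red)
  have "fps_map fps_const 0 = (0 :: 'p R fps)"
    by (rule fps_ext) simp
  then have eq: "lexp z = fps_const fps_X * fps_map (fps_shift 1) (lexp z)"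
    using fps_decompose_coeffs[of "lexp z"] unfolding red by (simp only: add_0_left)
  have "fps_const fps_X * fps_map (fps_shift 1) (lexp z) \<in> range (lexp :: 'p S' \<Rightarrow> _)"
    unfolding eq[symmetric] by (rule rangeI)
  then obtain y :: "'p S'" where "lexp y = fps_map (fps_shift 1) (lexp z)"
    by (rule range_lexp_obtain[OF range_lexp_const_X_mult])
  then have "lexp z = lexp ((qS - 1) * y)"
    by (subst eq) (simp add: lexp.hom_mult lexp_qS_minus_1)
  then show "\<exists>y. z = (qS - 1) * y"
    by (auto simp: lexp_inj)
qed (auto simp: red.hom_mult red_qS_minus_1)

lemma red_eq_iff:
  fixes x z :: "'p::prime_card S'"
  shows "red x = red z \<longleftrightarrow> (\<exists>y. x - z = (qS - 1) * y)"
  using red_eq_0_iff[of "x - z"] by (simp add: red.hom_minus)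

subsection \<open>Frobenius\<close>

text \<open>Peeling off the constant term leaves a multiple of u(X), which is small, so each peeling
  gains one power of the ideal.\<close>

lemma fps_hom_eqI:
  fixes u v :: "'c::complete_adic_ring fps \<Rightarrow> 'd::complete_adic_ring fps"
  assumes u: "comm_ring_hom u" and v: "comm_ring_hom v"
    and const: "\<And>a. u (fps_const a) = v (fps_const a)" and X: "u fps_X = v fps_X"
    and small: "u fps_X \<in> coeff_ideal 1"
  shows "u c = v c"
proof (rule coeff_ideal_separated_eq)
  interpret u: comm_ring_hom u by fact
  interpret v: comm_ring_hom v by fact
  fix n
  show "u c - v c \<in> coeff_ideal n"
  proof (induction n arbitrary: c)
    case (Suc n)
    have c: "c = fps_const (fps_nth c 0) + fps_X * fps_shift 1 c"
      by (rule fps_ext) auto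
    have "u c - v c = u fps_X * (u (fps_shift 1 c) - v (fps_shift 1 c))"
      by (subst (1 2) c) (simp add: u.hom_add v.hom_add u.hom_mult v.hom_mult const X right_diff_distrib)
    then show ?case
      using coeff_ideal_times[OF small Suc] by simp
  qed (simp add: coeff_ideal_0_UNIV)
qed

definition frob_fps :: "'p::prime_card R fps \<Rightarrow> 'p R fps" where
  "frob_fps F = dil CARD('p) (fps_map frob_R F)"

lemma frob_fps_hom: "comm_ring_hom (frob_fps :: 'p::prime_card R fps \<Rightarrow> 'p R fps)"
  unfolding frob_fps_def
  by (intro comm_ring_hom_comp[OF fps_map_hom[OF frob_R_hom] dil_hom] prime_gt_0_nat prime_card)

interpretation frob_fps: comm_ring_hom "frob_fps :: 'p::prime_card R fps \<Rightarrow> 'p R fps"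
  by (rule frob_fps_hom)

lemma frob_fps_const: "frob_fps (fps_const c) = fps_const (frob_R c :: 'p::prime_card R)"
  using prime_gt_0_nat[OF prime_card[where 'a='p]] by (simp add: frob_fps_def fps_map_const dil_const)

lemma frob_fps_X: "frob_fps fps_X = (fps_X ^ CARD('p) :: 'p::prime_card R fps)"
  using prime_gt_0_nat[OF prime_card[where 'a='p]] by (simp add: frob_fps_def fps_map_X dil_fps_X)

text \<open>The Frobenius is prescribed only on \<int>_p and on q; rigidity of homomorphisms on
  power series determines it on R.\<close>

lemma frobenius_algebra_map:
  fixes \<phi> :: "'p::prime_card S' \<Rightarrow> 'p S'"
  assumes "is_frobenius \<phi>"
  shows "lexp (\<phi> (algebra_map c)) = fps_const (frob_R c)"
proof (rule fps_hom_eqI[where u = "\<lambda>c. lexp (\<phi> (algebra_map c))" and v = "\<lambda>c. fps_const (frob_R c)"])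
  have \<phi>: "comm_ring_hom \<phi>" "\<And>a. \<phi> (algebra_map (fps_const a)) = algebra_map (fps_const a)" "\<phi> qS = qS ^ CARD('p)"
    using assms by (auto simp: is_frobenius_def)
  interpret \<phi>: comm_ring_hom \<phi> by fact
  show "comm_ring_hom (\<lambda>c. lexp (\<phi> (algebra_map c)))"
    by (intro comm_ring_hom_comp[OF algebra_map_hom comm_ring_hom_comp[OF \<phi>(1) lexp_hom]])
  show "comm_ring_hom (\<lambda>c :: 'p R. fps_const (frob_R c))"
    by (rule comm_ring_hom_comp[OF frob_R_hom fps_const_hom])
  show "lexp (\<phi> (algebra_map (fps_const a))) = fps_const (frob_R (fps_const a))" for a
    by (simp add: \<phi>(2) lexp_algebra_map frob_R_const)
  have "\<phi> (algebra_map fps_X) = qS ^ CARD('p) - 1"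
    unfolding qS_minus_1[symmetric] \<phi>.hom_minus \<phi>(3) by simp
  also have "\<dots> = algebra_map (frob_R fps_X)"
    by (simp add: frob_R_X algebra_map.hom_power algebra_map.hom_minus)
  finally show X: "lexp (\<phi> (algebra_map fps_X)) = fps_const (frob_R fps_X)"
    by (simp add: lexp_algebra_map)
  show "lexp (\<phi> (algebra_map fps_X)) \<in> coeff_ideal 1"
    unfolding X by (intro coeff_ideal_const frob_R_ideal fps_X_ideal)
qed

lemma lexp_frobenius:
  fixes \<phi> :: "'p::prime_card S' \<Rightarrow> 'p S'"
  assumes "is_frobenius \<phi>"
  shows "lexp (\<phi> z) = frob_fps (lexp z)"
proof (rule completion_hom_eqI[where f = "\<lambda>z. lexp (\<phi> z)" and g = "\<lambda>z. frob_fps (lexp z)"])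
  have \<phi>: "comm_ring_hom \<phi>" "\<phi> lam = lam ^ CARD('p)"
    using assms by (auto simp: is_frobenius_def)
  show "comm_ring_hom (\<lambda>z. lexp (\<phi> z))"
    by (rule comm_ring_hom_comp[OF \<phi>(1) lexp_hom])
  show "comm_ring_hom (\<lambda>z :: 'p S'. frob_fps (lexp z))"
    by (rule comm_ring_hom_comp[OF lexp_hom frob_fps_hom])
  show "lexp (\<phi> (algebra_map c)) = frob_fps (lexp (algebra_map c :: 'p S'))" for c
    by (simp add: frobenius_algebra_map[OF assms] lexp_algebra_map frob_fps_const)
  show "lexp (\<phi> lam) = frob_fps (lexp (lam :: 'p S'))"
    by (simp add: \<phi>(2) lexp.hom_power lexp_lam frob_fps_X)
  show "lexp (\<phi> (algebra_map c)) \<in> coeff_ideal 1" if "c \<in> ideal_gens" for c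
    unfolding frobenius_algebra_map[OF assms]
    using that by (intro coeff_ideal_const frob_R_ideal) (simp add: ideal_gens_power_1)
qed

lemma red_fps_frob_fps: "red_fps (frob_fps F) = dil CARD('p) (red_fps (F :: 'p::prime_card R fps))"
  by (rule fps_ext) (simp add: frob_fps_def dil_nth frob_R_nth_0)

lemma lexp_frobenius_B':
  fixes \<phi> :: "'p::prime_card S' \<Rightarrow> 'p S'"
  assumes "is_frobenius \<phi>"
  shows "lexp (frobenius_B' \<phi> b) = dil CARD('p) (lexp b)"
proof -
  have *: "lexp (red (\<phi> x)) = dil CARD('p) (lexp (red x))" for x
    by (simp add: lexp_red lexp_frobenius[OF assms] red_fps_frob_fps)
  obtain x :: "'p S'" where x: "red x = b"
    using red_surj by blast
  have "frobenius_B' \<phi> b = red (\<phi> x)"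
    unfolding frobenius_B'_def
  proof (rule the_equality)
    show "\<exists>x'. red x' = b \<and> red (\<phi> x') = red (\<phi> x)"
      using x by blast
    show "c = red (\<phi> x)" if "\<exists>x. red x = b \<and> red (\<phi> x) = c" for c
      using that * x by (metis lexp_inj)
  qed
  then show ?thesis by (simp add: * x)
qed

lemma frobenius_B'_red:
  fixes \<phi> :: "'p::prime_card S' \<Rightarrow> 'p S'"
  assumes "is_frobenius \<phi>"
  shows "frobenius_B' \<phi> (red x) = red (\<phi> x)"
  by (simp add: lexp_inj[symmetric] lexp_frobenius_B'[OF assms] lexp_red lexp_frobenius[OF assms] red_fps_frob_fps)

lemma frobenius_B'_hom:
  fixes \<phi> :: "'p::prime_card S' \<Rightarrow> 'p S'"
  assumes "is_frobenius \<phi>"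
  shows "comm_ring_hom (frobenius_B' \<phi>)"
proof -
  interpret D: comm_ring_hom "dil CARD('p) :: 'p zp fps \<Rightarrow> 'p zp fps"
    by (intro dil_hom prime_gt_0_nat prime_card)
  show ?thesis
    by unfold_locales (simp_all add: lexp_inj[symmetric] lexp_frobenius_B'[OF assms] D.hom_add D.hom_mult
      lexp.hom_add lexp.hom_mult)
qed

subsection \<open>Derivation and expansion over \<open>B'\<close>\<close>

text \<open>The difference of two derivations kills fractions. It is p-adically continuous for free:
  the ideal of B' is generated by the constant p, on which both derivations vanish, so p^n y goes to
  p^n times a series.\<close>

lemma derivation_unique:
  fixes d :: "'p::prime_card B' \<Rightarrow> 'p B'"
  assumes add: "\<And>x y. d (x + y) = d x + d y" and mult: "\<And>x y. d (x * y) = d x * y + x * d y"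
    and const: "\<And>c. d (algebra_map c) = 0" and lam: "d lam = 1"
  shows "lexp (d z) = fps_deriv (lexp z)"
proof -
  define \<delta> where "\<delta> z = lexp (d z) - fps_deriv (lexp z)" for z
  have \<delta>_add: "\<delta> (x + y) = \<delta> x + \<delta> y" for x y
    by (simp add: \<delta>_def add lexp.hom_add)
  have \<delta>_mult: "\<delta> (x * y) = \<delta> x * lexp y + lexp x * \<delta> y" for x y
    by (simp add: \<delta>_def mult lexp.hom_add lexp.hom_mult algebra_simps)
  have \<delta>_const: "\<delta> (algebra_map c) = 0" for c
    by (simp add: \<delta>_def const lexp_algebra_map)
  have \<delta>_lam: "\<delta> lam = 0"
    by (simp add: \<delta>_def lam lexp_lam)
  have poly: "\<delta> (completion_of (hloc_of_poly a)) = 0" for a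
  proof (induction a)
    case 0
    then show ?case using \<delta>_const[of 0] by simp
  next
    case (pCons c a)
    have "pCons c a = [:c:] + [:0, 1:] * a" by simp
    then have "completion_of (hloc_of_poly (pCons c a)) =
        algebra_map c + lam * completion_of (hloc_of_poly a :: ('p, 'p zp) hloc)"
      by (simp only: hloc_of_poly.hom_add hloc_of_poly.hom_mult completion_of.hom_add
            completion_of.hom_mult algebra_map_def lam_def)
    then show ?case
      by (simp add: \<delta>_add \<delta>_mult \<delta>_const \<delta>_lam pCons)
  qed
  have loc: "\<delta> (completion_of x) = 0" for x
  proof -
    let ?h = "hasse_poly CARD('p) :: 'p zp poly"
    obtain a n where a: "hloc_of_poly ?h ^ n * x = hloc_of_poly a"
      by (rule hloc_cases)
    let ?H = "completion_of (hloc_of_poly (?h ^ n)) :: 'p B'"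
    have eq: "completion_of (hloc_of_poly a) = ?H * completion_of x"
      by (simp flip: a completion_of.hom_mult hloc_of_poly.hom_power)
    have "lexp ?H * \<delta> (completion_of x) = 0"
      using poly[of a] unfolding eq by (simp add: \<delta>_mult poly)
    moreover have "lexp ?H \<noteq> 0"
      by (simp add: lexp_of_poly fps_of_poly_power)
    ultimately show ?thesis by simp
  qed
  have "\<delta> z = 0"
  proof (rule coeff_ideal_separated)
    fix n
    obtain x where x: "z - completion_of x \<in> ideal_power n"
      using completion_approx by blast
    have "(ideal_gens :: 'p B' set) = {algebra_map (of_nat CARD('p))}"
      by (simp add: ideal_gens_hloc_completion ideal_gens_zp_def)
    then have "algebra_map (of_nat CARD('p)) ^ n dvd z - completion_of x"
      using x by (simp add: ideal_power_principal)
    then obtain y where "z - completion_of x = algebra_map (of_nat CARD('p) ^ n) * y"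
      by (auto simp: algebra_map.hom_power)
    then have "z = completion_of x + algebra_map (of_nat CARD('p) ^ n) * y"
      by (simp add: algebra_simps)
    then have "\<delta> z = fps_const (of_nat CARD('p) ^ n) * \<delta> y"
      by (simp add: \<delta>_add \<delta>_mult loc \<delta>_const lexp_algebra_map)
    also have "\<dots> \<in> coeff_ideal n"
      by (intro coeff_ideal_mult2 coeff_ideal_const ideal_power_power p_ideal_zp)
    finally show "\<delta> z \<in> coeff_ideal n" .
  qed
  then show ?thesis by (simp add: \<delta>_def)
qed

lemma ddlam_spec:
  "(\<forall>x y. ddlam (x + y) = ddlam x + (ddlam y :: 'p::prime_card B'))
    \<and> (\<forall>x y. ddlam (x * y) = ddlam x * y + x * (ddlam y :: 'p B'))
    \<and> (\<forall>c. ddlam (algebra_map c) = (0 :: 'p B')) \<and> ddlam lam = (1 :: 'p B')"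
proof -
  define d :: "'p B' \<Rightarrow> 'p B'" where "d z = (SOME w. lexp w = fps_deriv (lexp z))" for z
  have d: "lexp (d z) = fps_deriv (lexp z)" for z
  proof -
    have "fps_deriv (lexp z) \<in> range (lexp :: 'p B' \<Rightarrow> _)"
      by (rule range_lexp_deriv) blast
    then show ?thesis
      unfolding d_def by (metis (mono_tags, lifting) imageE someI)
  qed
  have "\<exists>!d. (\<forall>x y. d (x + y) = d x + d y) \<and> (\<forall>x y. d (x * y) = d x * y + x * d y)
      \<and> (\<forall>c. d (algebra_map c) = (0 :: 'p B')) \<and> d lam = 1"
  proof (rule ex1I[of _ d])
    show "(\<forall>x y. d (x + y) = d x + d y) \<and> (\<forall>x y. d (x * y) = d x * y + x * d y)
      \<and> (\<forall>c. d (algebra_map c) = (0 :: 'p B')) \<and> d lam = 1"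
      by (simp add: lexp_inj[symmetric] d lexp.hom_add lexp.hom_mult lexp_algebra_map lexp_lam algebra_simps)
    fix e :: "'p B' \<Rightarrow> 'p B'"
    assume "(\<forall>x y. e (x + y) = e x + e y) \<and> (\<forall>x y. e (x * y) = e x * y + x * e y)
      \<and> (\<forall>c. e (algebra_map c) = 0) \<and> e lam = 1"
    then have "lexp (e z) = lexp (d z)" for z
      using derivation_unique[of e] d by simp
    then show "e = d" by (auto simp: lexp_inj)
  qed
  from theI'[OF this] show ?thesis
    unfolding ddlam_def[symmetric] .
qed

lemma lexp_ddlam: "lexp (ddlam z) = fps_deriv (lexp (z :: 'p::prime_card B'))"
  using ddlam_spec[where 'p='p] by (intro derivation_unique) auto

lemma expansion_eq: "expansion = (lexp :: 'p::prime_card B' \<Rightarrow> _)"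
  unfolding expansion_def
proof (rule the_equality)
  show "comm_ring_hom lexp \<and> (\<forall>c. lexp (algebra_map c :: 'p B') = fps_const c) \<and> lexp (lam :: 'p B') = fps_X"
    by (simp add: lexp_hom lexp_algebra_map lexp_lam)
  fix g :: "'p B' \<Rightarrow> 'p zp fps"
  assume g: "comm_ring_hom g \<and> (\<forall>c. g (algebra_map c) = fps_const c) \<and> g lam = fps_X"
  show "g = lexp"
  proof
    fix z
    show "g z = lexp z"
    proof (rule completion_hom_eqI)
      show "comm_ring_hom g" using g by blast
      show "comm_ring_hom (lexp :: 'p B' \<Rightarrow> _)" by (rule lexp_hom)
      show "g (algebra_map c) \<in> coeff_ideal 1" if "c \<in> ideal_gens" for c
        using g that by (simp add: coeff_ideal_const ideal_gens_power_1)
    qed (use g in \<open>simp_all add: lexp_algebra_map lexp_lam\<close>)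
  qed
qed

section \<open>The action of \<open>\<Gamma>\<close>\<close>

definition scale_fps :: "'c::comm_ring_1 \<Rightarrow> 'c fps \<Rightarrow> 'c fps" where
  "scale_fps u F = Abs_fps (\<lambda>n. u ^ n * fps_nth F n)"

lemma scale_fps_hom: "comm_ring_hom (scale_fps u :: 'c::idom fps \<Rightarrow> 'c fps)"
proof -
  have "scale_fps u = (\<lambda>F :: 'c fps. fps_compose F (fps_const u * fps_X))"
    by (rule ext) (simp add: scale_fps_def fps_compose_linear)
  then show ?thesis
    by unfold_locales (simp_all add: fps_compose_add_distrib fps_compose_mult_distrib)
qed

lemma scale_fps_mult: "scale_fps u (F * G) = scale_fps u F * scale_fps u (G :: 'c::idom fps)"
proof -
  interpret comm_ring_hom "scale_fps u :: 'c fps \<Rightarrow> 'c fps" by (rule scale_fps_hom)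
  show ?thesis by (rule hom_mult)
qed

lemma scale_fps_const: "scale_fps u (fps_const c) = fps_const c"
  by (rule fps_ext) (simp add: scale_fps_def)

lemma scale_fps_X: "scale_fps u fps_X = fps_const u * fps_X"
proof (rule fps_ext)
  fix n show "fps_nth (scale_fps u fps_X) n = fps_nth (fps_const u * fps_X) n"
    by (cases "n = 1") (auto simp: scale_fps_def fps_X_def)
qed

lemma scale_fps_scale: "scale_fps u (scale_fps w F) = scale_fps (u * w) F"
  by (rule fps_ext) (simp add: scale_fps_def power_mult_distrib ac_simps)

locale Gamma_action = odd_prime_card P for P :: "'p::prime_card itself" +
  fixes \<rho> :: "int \<Rightarrow> 'p S' \<Rightarrow> 'p S'"
  assumes Gamma: "is_Gamma_action \<rho>"
begin

lemma \<rho>_hom: "comm_ring_hom (\<rho> k)"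
  and \<rho>_algebra_map: "\<rho> k (algebra_map r) = algebra_map r"
  and \<rho>_0: "\<rho> 0 x = x"
  and \<rho>_add: "\<rho> (k + l) x = \<rho> k (\<rho> l x)"
  and \<rho>_1_lam: "\<rho> 1 lam = qS * lam"
  using Gamma by (auto simp: is_Gamma_action_def)

sublocale \<rho>: comm_ring_hom "\<rho> k" for k
  by (rule \<rho>_hom)

lemma \<rho>_nat_lam: "\<rho> (int n) lam = algebra_map ((1 + fps_X) ^ n) * lam"
proof (induction n)
  case (Suc n)
  have "\<rho> (int (Suc n)) lam = \<rho> (int n) (\<rho> 1 lam)"
    by (simp flip: \<rho>_add add: add.commute)
  also have "\<dots> = qS * (algebra_map ((1 + fps_X) ^ n) * lam)"
    by (simp add: \<rho>_1_lam \<rho>.hom_mult \<rho>_algebra_map Suc del: algebra_map.hom_add)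
  finally show ?case
    by (simp add: algebra_map.hom_mult mult.assoc del: algebra_map.hom_add)
qed (simp add: \<rho>_0)

text \<open>The q-number in base q, against base q^(1/2) for \<open>qnum\<close>; the two are
  related by \<open>qbr_qnum\<close>.\<close>

definition qbr :: "nat \<Rightarrow> 'p R" where
  "qbr n = (\<Sum>i<n. (1 + fps_X) ^ i)"

lemma X_qbr: "fps_X * qbr n = (1 + fps_X) ^ n - 1"
  using power_diff_1_eq[of "1 + fps_X :: 'p R" n] by (simp add: qbr_def)

lemma X_factor: "fps_X = (sqrt_q - 1) * (sqrt_q + 1 :: 'p R)"
proof -
  have "(sqrt_q - 1) * (sqrt_q + 1) = sqrt_q ^ 2 - (1 :: 'p R)"
    by (simp add: power2_eq_square algebra_simps)
  then show ?thesis by (simp add: sqrt_q_square)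
qed

lemma qbr_qnum: "(sqrt_q + 1) * qbr n = qnum (2 * n)"
proof -
  have "(sqrt_q - 1) * ((sqrt_q + 1) * qbr n) = sqrt_q ^ (2 * n) - 1"
    by (simp add: power_mult sqrt_q_square flip: mult.assoc X_factor X_qbr)
  then show ?thesis by (rule qnum_eqI[symmetric])
qed

text \<open>With t = q^(1/2), [1/2] is (t - 1)/(t^2 - 1). It is thus a unit that converts between
  the bases t and q.\<close>

lemma half_bracket: "(sqrt_q + 1) * q_bracket (1 / 2) = (1 :: 'p R)"
proof -
  have "fps_X * ((sqrt_q + 1) * q_bracket (1 / 2)) = (sqrt_q + 1) * (sqrt_q - 1 :: 'p R)"
    by (simp add: sqrt_q_def algebra_simps)
  also have "\<dots> = fps_X * 1"
    by (simp add: X_factor mult.commute)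
  finally show ?thesis by simp
qed

lemma qnum_dvd_qbr: "qnum (CARD('p) ^ s) dvd qbr (CARD('p) ^ s * k)"
proof -
  have "qbr n = q_bracket (1 / 2) * qnum (2 * n)" for n
    using half_bracket by (simp add: mult.commute[of "q_bracket (1/2)"] mult.assoc[symmetric] flip: qbr_qnum)
  then show ?thesis
    by (simp add: dvd_mult qnum_dvd)
qed

section \<open>The weights [n] and q^(kn)\<close>

lemma dwork_weight_0_iff:
  "dwork_weight 0 w \<longleftrightarrow> (\<forall>s n k. qnum (CARD('p) ^ s) dvd w (n + CARD('p) ^ s * k) - (w n :: 'p R))"
  by (simp add: dwork_weight_def dwork_modulus_def)

lemma qbr_add: "qbr (m + n) = qbr m + (1 + fps_X) ^ m * qbr n"
proof -
  have "fps_X * qbr (m + n) = fps_X * (qbr m + (1 + fps_X) ^ m * qbr n)"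
    by (simp add: distrib_left mult.left_commute[of fps_X] X_qbr power_add) (simp add: algebra_simps)
  then show ?thesis by simp
qed

lemma dwork_weight_qbr: "dwork_weight 0 qbr"
  unfolding dwork_weight_0_iff by (simp add: qbr_add qnum_dvd_qbr)

lemma dwork_weight_power:
  assumes "\<And>n. fps_X * qbr n dvd u ^ n - 1"
  shows "dwork_weight 0 (\<lambda>n. u ^ n)"
  unfolding dwork_weight_0_iff
proof (intro allI)
  fix s n k
  have "qnum (CARD('p) ^ s) dvd u ^ (CARD('p) ^ s * k) - 1"
    using qnum_dvd_qbr[of s k] assms[of "CARD('p) ^ s * k"] by (meson dvd_mult dvd_trans)
  then have "qnum (CARD('p) ^ s) dvd u ^ n * (u ^ (CARD('p) ^ s * k) - 1)"
    by (rule dvd_mult)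
  then show "qnum (CARD('p) ^ s) dvd u ^ (n + CARD('p) ^ s * k) - u ^ n"
    by (simp add: power_add right_diff_distrib)
qed

lemma q_power_weight: "fps_X * qbr n dvd ((1 + fps_X) ^ m) ^ n - 1"
proof -
  have "(1 + fps_X :: 'p R) ^ n - 1 dvd ((1 + fps_X) ^ n) ^ m - 1"
    by (simp add: power_diff_1_eq[of _ m])
  then show ?thesis
    by (simp add: X_qbr mult.commute flip: power_mult)
qed

lemma q_unit: "\<exists>w. (1 + fps_X) * w = (1 :: 'p R)"
  by (rule unit_of_coprime[OF p_ideal_R, of 1]) (simp_all add: fps_X_ideal[simplified])

lemma \<rho>_lam:
  "\<exists>u. \<rho> k lam = algebra_map u * lam \<and> dwork_weight 0 (\<lambda>n. u ^ n) \<and> frob_R u = u ^ CARD('p)"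
proof (cases "k \<ge> 0")
  case True
  then obtain m where k: "k = int m" by (metis nonneg_int_cases)
  have "frob_R ((1 + fps_X) ^ m :: 'p R) = ((1 + fps_X) ^ m) ^ CARD('p)"
    by (simp add: frob_R.hom_power frob_R.hom_add frob_R_X mult.commute flip: power_mult)
  then show ?thesis
    using \<rho>_nat_lam[of m] dwork_weight_power[OF q_power_weight] unfolding k by blast
next
  case False
  define m where "m = nat (- k)"
  have k: "k = - int m" using False by (simp add: m_def)
  obtain w where w: "(1 + fps_X) * w = (1 :: 'p R)"
    using q_unit by blast
  have wm: "w ^ n * (1 + fps_X) ^ n = 1" for n
    using w by (simp flip: power_mult_distrib add: mult.commute)
  \<comment> \<open>For negative k the known relation for the opposite exponent is transported by
    the action and solved, q being a unit of R.\<close>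
  have "lam = \<rho> k (\<rho> (int m) lam)"
    by (simp flip: \<rho>_add add: k \<rho>_0)
  also have "\<dots> = algebra_map ((1 + fps_X) ^ m) * \<rho> k lam"
    by (simp add: \<rho>_nat_lam \<rho>.hom_mult \<rho>_algebra_map)
  finally have "algebra_map (w ^ m) * lam = algebra_map (w ^ m) * (algebra_map ((1 + fps_X) ^ m) * \<rho> k lam)"
    by simp
  then have 1: "\<rho> k lam = algebra_map (w ^ m) * lam"
    by (simp flip: mult.assoc algebra_map.hom_mult add: wm)
  have "fps_X * qbr n dvd (w ^ m) ^ n - 1" for n
  proof -
    have "(w ^ m) ^ n * ((1 + fps_X) ^ m) ^ n = 1"
      by (simp flip: power_mult add: wm)
    then have "(w ^ m) ^ n - 1 = - ((w ^ m) ^ n) * (((1 + fps_X) ^ m) ^ n - 1)"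
      by (simp add: algebra_simps)
    then show ?thesis
      using q_power_weight[of n m] by simp
  qed
  then have 2: "dwork_weight 0 (\<lambda>n. (w ^ m) ^ n)"
    by (rule dwork_weight_power)
  have "frob_R ((1 + fps_X) * w) = 1"
    unfolding w by simp
  then have "(1 + fps_X) ^ CARD('p) * frob_R w = 1"
    by (simp add: frob_R.hom_mult frob_R.hom_add frob_R_X)
  then have "w ^ CARD('p) * ((1 + fps_X) ^ CARD('p) * frob_R w) = w ^ CARD('p)"
    by simp
  then have "frob_R w = w ^ CARD('p)"
    by (simp flip: mult.assoc add: wm)
  then have "frob_R (w ^ m) = (w ^ m) ^ CARD('p)"
    by (simp add: frob_R.hom_power mult.commute flip: power_mult)
  with 1 2 show ?thesis by blast
qed

text \<open>This is \<open>q ^ k\<close>.\<close>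

definition uq :: "int \<Rightarrow> 'p R" where
  "uq k = (SOME u. \<rho> k lam = algebra_map u * lam \<and> dwork_weight 0 (\<lambda>n. u ^ n) \<and> frob_R u = u ^ CARD('p))"

lemma uq: "\<rho> k lam = algebra_map (uq k) * lam" "dwork_weight 0 (\<lambda>n. uq k ^ n)" "frob_R (uq k) = uq k ^ CARD('p)"
  using someI_ex[OF \<rho>_lam[of k]] by (simp_all add: uq_def)

lemma uq_eqI: "\<rho> k lam = algebra_map u * lam \<Longrightarrow> uq k = u"
proof -
  assume "\<rho> k lam = algebra_map u * lam"
  then have "lam * algebra_map (uq k) = lam * (algebra_map u :: 'p S')"
    by (simp add: uq(1) mult.commute)
  from lexp_mult_cancel[OF this lam_neq_0] show ?thesis
    by (simp add: algebra_map_inj)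
qed

lemma uq_0: "uq 0 = 1"
  by (rule uq_eqI) (simp add: \<rho>_0)

lemma uq_1: "uq 1 = 1 + fps_X"
  by (rule uq_eqI) (rule \<rho>_1_lam)

lemma uq_add: "uq (k + l) = uq k * uq l"
proof (rule uq_eqI)
  have "\<rho> (k + l) lam = \<rho> k (algebra_map (uq l) * lam)"
    unfolding \<rho>_add uq(1)[of l] ..
  also have "\<dots> = algebra_map (uq l) * (algebra_map (uq k) * lam)"
    by (simp only: \<rho>.hom_mult \<rho>_algebra_map uq(1))
  finally show "\<rho> (k + l) lam = algebra_map (uq k * uq l) * lam"
    by (simp add: algebra_map.hom_mult ac_simps)
qed

lemma lexp_\<rho>: "lexp (\<rho> k z) = scale_fps (uq k) (lexp z)"
proof (rule completion_hom_eqI[where f = "\<lambda>z. lexp (\<rho> k z)" and g = "\<lambda>z. scale_fps (uq k) (lexp z)"])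
  show "comm_ring_hom (\<lambda>z. lexp (\<rho> k z))"
    by (rule comm_ring_hom_comp[OF \<rho>_hom lexp_hom])
  show "comm_ring_hom (\<lambda>z :: 'p S'. scale_fps (uq k) (lexp z))"
    by (rule comm_ring_hom_comp[OF lexp_hom scale_fps_hom])
  show "lexp (\<rho> k (algebra_map c)) \<in> coeff_ideal 1" if "c \<in> ideal_gens" for c
    using that by (simp add: \<rho>_algebra_map lexp_algebra_map coeff_ideal_const ideal_gens_power_1)
qed (simp_all add: \<rho>_algebra_map lexp_algebra_map scale_fps_const uq(1) lexp.hom_mult lexp_lam scale_fps_X)

lemma \<rho>_ideal_power: "x \<in> ideal_power n \<Longrightarrow> \<rho> k x \<in> ideal_power n"
  by (rule hom_ideal_power[OF \<rho>_hom])
    (auto simp: ideal_gens_hloc_completion \<rho>_algebra_map intro!: ideal_gens_power_1[simplified])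

subsection \<open>The \<open>q\<close>-derivation\<close>

text \<open>The n-th coefficient of the difference is multiplied by q^n - 1 = (q - 1)[n]. Both
  divisions, by q - 1 and by \<lambda>, stay in S' by the two range lemmas.\<close>

lemma lexp_d_q_ex:
  "\<exists>y. lexp y = Abs_fps (\<lambda>n. qbr (Suc n) * fps_nth (lexp x) (Suc n)) \<and> \<rho> 1 x - x = (qS - 1) * lam * y"
proof -
  define y where "y = Abs_fps (\<lambda>n. qbr (Suc n) * fps_nth (lexp x) (Suc n))"
  have eq: "fps_const fps_X * (fps_X * y) = lexp (\<rho> 1 x - x)"
  proof (rule fps_ext)
    fix n
    show "fps_nth (fps_const fps_X * (fps_X * y)) n = fps_nth (lexp (\<rho> 1 x - x)) n"
    proof (cases n)
      case 0
      then show ?thesis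
        by (simp add: lexp.hom_minus lexp_\<rho> scale_fps_def)
    next
      case (Suc m)
      have "fps_nth (fps_const fps_X * (fps_X * y)) n = (fps_X * qbr n) * fps_nth (lexp x) n"
        by (simp add: Suc y_def mult.assoc)
      then show ?thesis
        by (simp add: X_qbr lexp.hom_minus lexp_\<rho> scale_fps_def uq_1 left_diff_distrib)
    qed
  qed
  then have "fps_const fps_X * (fps_X * y) \<in> SR" by simp
  then have "y \<in> SR"
    by (rule range_lexp_X_mult[OF range_lexp_const_X_mult])
  then obtain z :: "'p S'" where z: "lexp z = y"
    by (rule range_lexp_obtain)
  have "lexp (\<rho> 1 x - x) = lexp ((qS - 1) * lam * z)"
    by (simp only: lexp.hom_mult lexp_qS_minus_1 lexp_lam z mult.assoc eq)
  then show ?thesis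
    using z by (auto simp: lexp_inj y_def)
qed

lemma d_q_eqI:
  assumes "\<rho> 1 x - x = (qS - 1) * lam * y"
  shows "d_q \<rho> x = y"
  unfolding d_q_def
proof (rule the_equality)
  fix z assume "\<rho> 1 x - x = (qS - 1) * lam * z"
  then have "(qS - 1) * (lam * z) = (qS - 1) * (lam * y)"
    using assms by (simp add: mult.assoc)
  from lexp_mult_cancel[OF this qS_minus_1_neq_0] show "z = y"
    by (rule lexp_mult_cancel[OF _ lam_neq_0])
qed (rule assms)

lemma d_q: "\<rho> 1 x - x = (qS - 1) * lam * d_q \<rho> x"
  and lexp_d_q: "lexp (d_q \<rho> x) = Abs_fps (\<lambda>n. qbr (Suc n) * fps_nth (lexp x) (Suc n))"
  using lexp_d_q_ex[of x] d_q_eqI[of x] by metis+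

lemma red_d_q: "red (d_q \<rho> x) = ddlam (red x)"
proof -
  have *: "fps_nth (qbr n) 0 = of_nat n" for n
    by (simp add: qbr_def fps_sum_nth fps_nth_power_0)
  have "lexp (red (d_q \<rho> x)) = lexp (ddlam (red x))"
    by (rule fps_ext) (simp add: lexp_red lexp_d_q lexp_ddlam * del: of_nat_Suc)
  then show ?thesis by (simp add: lexp_inj)
qed

lemma red_\<rho>_1: "red (\<rho> 1 x) = red x"
  unfolding red_eq_iff using d_q[of x] by (auto simp: mult.assoc)

section \<open>The \<open>q\<close>-hypergeometric series and its quotients\<close>

abbreviation F :: "'p R fps" where
  "F \<equiv> hyp 0"

lemma F_neq_0: "F \<noteq> 0"
  using hyp_inverse[of 0] by auto

lemma cancel_F: "lexp x * F = lexp y * F \<Longrightarrow> x = (y :: 'p S')"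
  using F_neq_0 by (simp add: lexp_inj)

text \<open>The elements of \<open>S'\<close> defined below have the expansions \<open>bq k = \<gamma>\<^sup>k F / F\<close>, \<open>aq k = F / \<gamma>\<^sup>k F\<close>,
  \<open>vq = F / \<phi>(F)\<close>, \<open>Dq = \<lambda> d\<^sub>q(F) / F\<close> and \<open>gq = \<lambda> F d\<^sub>q(1/F)\<close>.\<close>

definition bq :: "int \<Rightarrow> 'p S'" where
  "bq k = (SOME x. lexp x * F = scale_fps (uq k) F)"

lemma hyp_nth: "fps_nth (hyp i) n = hyp_coeff i n"
  by (simp add: hyp_series_def)

lemma bq: "lexp (bq k) * F = scale_fps (uq k) F"
proof -
  have "hyp_series 0 (\<lambda>n. uq k ^ n) = scale_fps (uq k) F"
    by (rule fps_ext) (simp add: hyp_series_def scale_fps_def)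
  then have "\<exists>x :: 'p S'. lexp x * F = scale_fps (uq k) F"
    using hyp_series_quotient[OF uq(2)[of k]] by simp
  then show ?thesis
    unfolding bq_def by (rule someI_ex)
qed

lemma bq_0: "bq 0 = 1"
proof (rule cancel_F)
  show "lexp (bq 0) * F = lexp (1 :: 'p S') * F"
    unfolding bq uq_0 by (simp add: scale_fps_def fps_nth_inverse)
qed

lemma bq_add: "bq (k + l) = \<rho> k (bq l) * bq k"
proof (rule cancel_F)
  have "lexp (bq (k + l)) * F = scale_fps (uq k) (scale_fps (uq l) F)"
    by (simp add: bq uq_add scale_fps_scale)
  also have "\<dots> = lexp (\<rho> k (bq l)) * scale_fps (uq k) F"
    by (simp flip: bq add: scale_fps_mult lexp_\<rho>)
  also have "\<dots> = lexp (\<rho> k (bq l) * bq k) * F"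
    by (simp add: lexp.hom_mult bq mult.assoc)
  finally show "lexp (bq (k + l)) * F = lexp (\<rho> k (bq l) * bq k) * F" .
qed

text \<open>The cocycle relation of \<open>bq\<close> at k and -k shows that this is the inverse of
  \<open>bq k\<close>, so the inverse is already an element of S'.\<close>

definition aq :: "int \<Rightarrow> 'p S'" where
  "aq k = \<rho> k (bq (- k))"

lemma aq_bq: "aq k * bq k = 1"
  using bq_add[of k "- k"] by (simp add: aq_def bq_0)

lemma aq_0: "aq 0 = 1"
  by (simp add: aq_def \<rho>_0 bq_0)

lemma unit_inverse_unique: "a * b = 1 \<Longrightarrow> c * b = 1 \<Longrightarrow> a = (c :: 'x::comm_ring_1)"
  by (metis mult.assoc mult.commute mult_1)

lemma aq_add: "aq (k + l) = aq k * \<rho> k (aq l)"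
proof (rule unit_inverse_unique[OF aq_bq])
  have "\<rho> k (aq l * bq l) = \<rho> k 1"
    by (simp only: aq_bq)
  then have "\<rho> k (aq l) * \<rho> k (bq l) = 1"
    by (simp only: \<rho>.hom_mult \<rho>.hom_one)
  then have "(aq k * bq k) * (\<rho> k (aq l) * \<rho> k (bq l)) = 1"
    by (simp add: aq_bq)
  then show "aq k * \<rho> k (aq l) * bq (k + l) = 1"
    by (simp add: bq_add ac_simps)
qed

definition vq :: "'p S'" where
  "vq = (SOME v. (\<exists>w. v * w = 1) \<and> lexp v * dil CARD('p) (hyp 1) = F)"

lemma vq: "\<exists>w. vq * w = 1" "lexp vq * dil CARD('p) (hyp 1) = F"
proof -
  have "\<exists>v :: 'p S'. (\<exists>w. v * w = 1) \<and> lexp v * dil CARD('p) (hyp 1) = F"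
    using hyp_frobenius_quotient by blast
  from someI_ex[OF this] show "\<exists>w. vq * w = 1" "lexp vq * dil CARD('p) (hyp 1) = F"
    by (simp_all add: vq_def)
qed

lemma frob_fps_F: "frob_fps F = dil CARD('p) (hyp 1)"
  unfolding frob_fps_def
  by (intro arg_cong[where f = "dil CARD('p)"] fps_ext) (simp add: hyp_nth hyp_coeff_def)

lemma scale_frob_fps: "scale_fps (uq k) (frob_fps G) = frob_fps (scale_fps (uq k) G)"
  by (rule fps_ext)
    (auto simp: scale_fps_def frob_fps_def dil_nth frob_R.hom_mult frob_R.hom_power uq(3) elim!: dvdE
      simp flip: power_mult)

text \<open>The Frobenius and \<open>\<Gamma>\<close> commute because \<open>aq k = F / \<gamma>\<^sup>k F\<close> and \<open>vq = F / \<phi>(F)\<close> are both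
  coboundaries of \<open>F\<close>.\<close>

lemma frobenius_cocycle:
  assumes \<phi>: "is_frobenius \<phi>"
  shows "\<rho> k vq * aq k = \<phi> (aq k) * vq"
proof -
  have "comm_ring_hom \<phi>" using \<phi> by (simp add: is_frobenius_def)
  then interpret \<phi>: comm_ring_hom \<phi> .
  let ?G = "frob_fps F"
  have G: "lexp vq * ?G = F"
    unfolding frob_fps_F by (rule vq(2))
  have "lexp (\<rho> k vq * \<phi> (bq k)) * ?G = lexp (\<rho> k vq) * frob_fps (lexp (bq k) * F)"
    by (simp add: lexp.hom_mult lexp_frobenius[OF \<phi>] frob_fps.hom_mult mult.assoc)
  also have "\<dots> = scale_fps (uq k) (lexp vq * ?G)"
    by (simp add: bq lexp_\<rho> scale_fps_mult scale_frob_fps)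
  also have "\<dots> = lexp (vq * bq k) * ?G"
    unfolding G bq[symmetric] by (simp add: lexp.hom_mult mult.assoc mult.left_commute[of "lexp vq"] G)
  finally have "lexp (\<rho> k vq * \<phi> (bq k)) * ?G = lexp (vq * bq k) * ?G" .
  moreover have "?G \<noteq> 0"
    using G F_neq_0 by auto
  ultimately have eq: "\<rho> k vq * \<phi> (bq k) = vq * bq k"
    by (simp add: lexp_inj)
  have ab: "\<phi> (aq k) * \<phi> (bq k) = 1"
    by (simp flip: \<phi>.hom_mult add: aq_bq)
  have "\<rho> k vq * aq k = (\<rho> k vq * \<phi> (bq k)) * aq k * \<phi> (aq k)"
    using ab by (simp add: ac_simps)
  also have "\<dots> = \<phi> (aq k) * vq * (aq k * bq k)"
    unfolding eq by (simp add: ac_simps)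
  finally show ?thesis by (simp add: aq_bq)
qed

definition Dq :: "'p S'" where
  "Dq = (SOME x. lexp x * F = hyp_series 0 qbr)"

lemma Dq: "lexp Dq * F = hyp_series 0 qbr"
  unfolding Dq_def by (rule someI_ex[OF hyp_series_quotient[OF dwork_weight_qbr]])

lemma bq_1: "bq 1 = 1 + (qS - 1) * Dq"
proof (rule cancel_F)
  have "lexp (bq 1) * F = F + fps_const fps_X * hyp_series 0 qbr"
    unfolding bq by (rule fps_ext) (simp add: scale_fps_def hyp_series_def uq_1 mult.assoc[symmetric] X_qbr algebra_simps)
  also have "\<dots> = lexp (1 + (qS - 1) * Dq) * F"
    by (simp only: lexp.hom_add lexp.hom_mult lexp.hom_one lexp_qS_minus_1 distrib_right mult.assoc Dq mult_1_left)
  finally show "lexp (bq 1) * F = lexp (1 + (qS - 1) * Dq) * F" .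
qed

text \<open>In base \<open>t = q ^ (1/2)\<close> this is \<open>[n - 1/2]\<^sup>2 = [n][n - 1] + [1/2]\<^sup>2 q ^ (n - 1)\<close>.\<close>

lemma qnum_square: "qnum (2 * n + 1) ^ 2 = qnum (2 * n + 2) * qnum (2 * n) + (1 + fps_X :: 'p R) ^ n"
proof -
  have "(sqrt_q - 1) ^ 2 * qnum (2 * n + 1) ^ 2 = (sqrt_q * sqrt_q ^ (2 * n) - (1 :: 'p R)) ^ 2"
    by (simp flip: power_mult_distrib add: qnum_mult)
  also have "\<dots> = (sqrt_q ^ 2 * sqrt_q ^ (2 * n) - 1) * (sqrt_q ^ (2 * n) - 1) + (sqrt_q - 1) ^ 2 * sqrt_q ^ (2 * n)"
    by (simp add: power2_eq_square algebra_simps)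
  also have "\<dots> = ((sqrt_q - 1) * qnum (2 * n + 2)) * ((sqrt_q - 1) * qnum (2 * n)) + (sqrt_q - 1) ^ 2 * (1 + fps_X) ^ n"
    by (simp only: qnum_mult power_add power_mult sqrt_q_square) (simp add: mult.commute)
  also have "\<dots> = (sqrt_q - 1) ^ 2 * (qnum (2 * n + 2) * qnum (2 * n) + (1 + fps_X) ^ n)"
    by (simp add: power2_eq_square algebra_simps)
  finally show ?thesis
    using sqrt_q_neq_1 by simp
qed

text \<open>The recursion [n + 1]^2 A_(n+1) = [n + 1/2]^2 A_n with the right factor expanded by
  \<open>qnum_square\<close>; the factor (t + 1)^2 passes from base t to base q.\<close>

lemma hyp_coeff_Suc:
  "qbr (Suc n) ^ 2 * hyp_coeff 0 (Suc n) =
    (qbr (Suc n) * qbr n + q_bracket (1 / 2) ^ 2 * (1 + fps_X) ^ n) * hyp_coeff 0 n"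
proof -
  let ?s = "sqrt_q + 1 :: 'p R"
  have s: "?s ^ 2 * q_bracket (1 / 2) ^ 2 = 1"
    by (simp flip: power_mult_distrib add: half_bracket)
  have "?s ^ 2 * (qbr (Suc n) ^ 2 * hyp_coeff 0 (Suc n)) = (?s * qbr (Suc n)) ^ 2 * hyp_root (Suc n) ^ 2"
    by (simp add: hyp_coeff_def power_mult_distrib mult.assoc)
  also have "\<dots> = (qnum (2 * n + 2) * hyp_root (Suc n)) ^ 2"
    unfolding qbr_qnum by (simp add: power_mult_distrib)
  also have "\<dots> = qnum (2 * n + 1) ^ 2 * hyp_root n ^ 2"
    unfolding hyp_root_Suc by (simp add: power_mult_distrib)
  also have "\<dots> = ((?s * qbr (Suc n)) * (?s * qbr n) + (?s ^ 2 * q_bracket (1 / 2) ^ 2) * (1 + fps_X) ^ n) * hyp_coeff 0 n"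
    unfolding qnum_square s qbr_qnum by (simp add: hyp_coeff_def)
  also have "\<dots> = ?s ^ 2 * ((qbr (Suc n) * qbr n + q_bracket (1 / 2) ^ 2 * (1 + fps_X) ^ n) * hyp_coeff 0 n)"
    by (simp add: power2_eq_square algebra_simps)
  finally have *: "?s ^ 2 * (qbr (Suc n) ^ 2 * hyp_coeff 0 (Suc n)) =
    ?s ^ 2 * ((qbr (Suc n) * qbr n + q_bracket (1 / 2) ^ 2 * (1 + fps_X) ^ n) * hyp_coeff 0 n)" .
  have "?s ^ 2 \<noteq> 0"
    using s by auto
  from mult_left_cancel[OF this, THEN iffD1, OF *] show ?thesis .
qed

definition gq :: "'p S'" where
  "gq = - Dq * aq 1"

lemma aq_1: "aq 1 = 1 + (qS - 1) * gq"
proof -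
  have "aq 1 * (1 + (qS - 1) * Dq) = 1"
    using aq_bq[of 1] by (simp only: bq_1)
  then show ?thesis
    unfolding gq_def by (simp only: distrib_left) (simp add: algebra_simps)
qed

text \<open>The q-hypergeometric equation can be written d_q(\<lambda>(1 - \<lambda>) d_q F) =
  [1/2]^2 \<gamma>F. Multiplied by (q - 1)\<lambda> and divided by \<gamma>F it becomes this
  identity, since \<open>gq\<close> is -\<open>Dq\<close> times F / \<gamma>F. The proof multiplies
  back and compares coefficients.\<close>

lemma q_hypergeometric_first_order:
  "\<rho> 1 ((1 - lam) * Dq) + (1 - lam) * gq = lam * (algebra_map (q_bracket (1 / 2)))\<^sup>2 * (qS - 1)"
proof -
  let ?q = "1 + fps_X :: 'p R"
  let ?c = "q_bracket (1 / 2) :: 'p R"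
  let ?th = "hyp_series 0 qbr"
  have \<rho>1: "\<rho> 1 ((1 - lam) * Dq) = (1 - qS * lam) * \<rho> 1 Dq"
    by (simp only: \<rho>.hom_mult \<rho>.hom_minus \<rho>.hom_one \<rho>_1_lam)
  have gb: "gq * bq 1 = - Dq"
    using aq_bq[of 1] by (simp add: gq_def mult.assoc)
  have "lexp (\<rho> 1 Dq * bq 1) * F = lexp (\<rho> 1 Dq) * scale_fps ?q F"
    by (simp add: lexp.hom_mult mult.assoc bq uq_1)
  also have "\<dots> = scale_fps ?q ?th"
    by (simp add: lexp_\<rho> uq_1 scale_fps_mult[symmetric] Dq)
  finally have 1: "lexp (\<rho> 1 Dq * bq 1) * F = scale_fps ?q ?th" .
  have "lexp ((\<rho> 1 ((1 - lam) * Dq) + (1 - lam) * gq) * bq 1) * F =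
      lexp (1 - qS * lam :: 'p S') * (lexp (\<rho> 1 Dq * bq 1) * F) + lexp (1 - lam :: 'p S') * lexp (gq * bq 1) * F"
    unfolding \<rho>1 by (simp only: lexp.hom_add lexp.hom_mult distrib_right mult.assoc)
  also have "\<dots> = (1 - fps_const ?q * fps_X) * scale_fps ?q ?th - (1 - fps_X) * ?th"
    unfolding 1 gb
    unfolding lexp.hom_minus lexp.hom_uminus lexp.hom_mult lexp.hom_one lexp_algebra_map lexp_lam
    by (simp add: Dq mult.assoc)
  also have "\<dots> = fps_const (fps_X * ?c ^ 2) * (fps_X * scale_fps ?q F)"
  proof (rule fps_ext)
    fix n
    show "fps_nth ((1 - fps_const ?q * fps_X) * scale_fps ?q ?th - (1 - fps_X) * ?th) n =
        fps_nth (fps_const (fps_X * ?c ^ 2) * (fps_X * scale_fps ?q F)) n"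
    proof (cases n)
      case 0
      then show ?thesis
        by (simp add: left_diff_distrib mult.assoc scale_fps_def hyp_series_def qbr_def)
    next
      case (Suc m)
      let ?A = "hyp_coeff 0 :: nat \<Rightarrow> 'p R"
      have "fps_nth ((1 - fps_const ?q * fps_X) * scale_fps ?q ?th - (1 - fps_X) * ?th) n =
          ?q ^ Suc m * (qbr (Suc m) * ?A (Suc m)) - ?q * (?q ^ m * (qbr m * ?A m)) - (qbr (Suc m) * ?A (Suc m) - qbr m * ?A m)"
        by (simp add: Suc left_diff_distrib mult.assoc scale_fps_def hyp_series_def)
      also have "\<dots> = (?q ^ Suc m - 1) * (qbr (Suc m) * ?A (Suc m) - qbr m * ?A m)"
        by (simp add: algebra_simps)
      also have "\<dots> = fps_X * (qbr (Suc m) ^ 2 * ?A (Suc m) - qbr (Suc m) * qbr m * ?A m)"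
        unfolding X_qbr[symmetric] by (simp add: power2_eq_square algebra_simps)
      also have "\<dots> = fps_X * ?c ^ 2 * (?q ^ m * ?A m)"
        unfolding hyp_coeff_Suc by (simp add: algebra_simps)
      also have "\<dots> = fps_nth (fps_const (fps_X * ?c ^ 2) * (fps_X * scale_fps ?q F)) n"
        by (simp add: Suc scale_fps_def hyp_nth)
      finally show ?thesis .
    qed
  qed
  also have "\<dots> = lexp (lam * (algebra_map ?c)\<^sup>2 * (qS - 1) * bq 1) * F"
  proof -
    have "lexp (lam * (algebra_map ?c)\<^sup>2 * (qS - 1) * bq 1) * F =
        fps_X * fps_const ?c ^ 2 * fps_const fps_X * (lexp (bq 1) * F)"
      by (simp only: lexp.hom_mult lexp.hom_power lexp_lam lexp_algebra_map lexp_qS_minus_1 mult.assoc)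
    then have "lexp (lam * (algebra_map ?c)\<^sup>2 * (qS - 1) * bq 1) * F =
        fps_X * fps_const ?c ^ 2 * fps_const fps_X * scale_fps ?q F"
      unfolding bq uq_1 .
    moreover have "fps_const (fps_X * ?c ^ 2) = fps_const fps_X * fps_const ?c ^ 2"
      by simp
    ultimately show ?thesis
      by (simp only: ac_simps)
  qed
  finally have "(\<rho> 1 ((1 - lam) * Dq) + (1 - lam) * gq) * bq 1 = lam * (algebra_map ?c)\<^sup>2 * (qS - 1) * bq 1"
    by (rule cancel_F)
  then have "(\<rho> 1 ((1 - lam) * Dq) + (1 - lam) * gq) * (aq 1 * bq 1) = lam * (algebra_map ?c)\<^sup>2 * (qS - 1) * (aq 1 * bq 1)"
    by (simp only: mult.left_commute[of _ "aq 1"] mult.assoc)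
  then show ?thesis by (simp add: aq_bq)
qed

subsection \<open>Reduction modulo \<open>q - 1\<close>\<close>

lemma hyp_root_represents: "zp_represents (\<Prod>i<n. (of_nat i + 1 / 2) / (of_nat i + 1)) (fps_nth (hyp_root n :: 'p R) 0)"
proof (induction n)
  case 0
  then show ?case using zp_represents_of_int[of 1] by simp
next
  case (Suc n)
  let ?x = "\<lambda>n. \<Prod>i<n. (of_nat i + 1 / 2) / (of_nat i + 1) :: rat"
  let ?z = "\<lambda>n. fps_nth (hyp_root n :: 'p R) 0"
  have "fps_nth (qnum (2 * n + 2) * hyp_root (Suc n) :: 'p R) 0 = fps_nth (qnum (2 * n + 1) * hyp_root n) 0"
    unfolding hyp_root_Suc ..
  then have z: "of_int (2 * int n + 2) * ?z (Suc n) = of_int (2 * int n + 1) * ?z n"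
    by (simp add: qnum_nth_0 add.commute)
  have "(of_nat n + 1 :: rat) \<noteq> 0"
    by (metis of_nat_Suc of_nat_neq_0 add.commute)
  then have x: "of_int (2 * int n + 2) * ?x (Suc n) = of_int (2 * int n + 1) * ?x n"
    by (simp add: field_simps)
  have "zp_represents (of_int (2 * int n + 2) * ?x (Suc n)) (of_int (2 * int n + 2) * ?z (Suc n))"
    unfolding x z by (intro zp_represents_mult zp_represents_of_int Suc)
  then show ?case
    by (rule zp_represents_cancel[rotated]) simp
qed

lemma red_hyp: "red_fps (hyp i) = hypergeom"
proof (rule fps_ext)
  fix n
  have "fps_nth ((frob_R ^^ i) r) 0 = fps_nth r 0" for r :: "'p R"
    by (induction i) (simp_all add: frob_R_nth_0)
  then have "fps_nth (red_fps (hyp i)) n = fps_nth (hyp_root n ^ 2 :: 'p R) 0"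
    by (simp add: hyp_nth hyp_coeff_def)
  moreover have "zp_represents ((\<Prod>i<n. (of_nat i + 1 / 2) / (of_nat i + 1))\<^sup>2) (fps_nth (hyp_root n ^ 2 :: 'p R) 0)"
    unfolding power2_eq_square fps_mult_nth_0 by (intro zp_represents_mult hyp_root_represents)
  ultimately show "fps_nth (red_fps (hyp i)) n = fps_nth hypergeom n"
    unfolding hypergeom_def by (simp add: zp_of_rat_eqI)
qed

lemma hypergeom_neq_0: "hypergeom \<noteq> (0 :: 'p zp fps)"
proof
  assume "hypergeom = (0 :: 'p zp fps)"
  then have "fps_nth (red_fps F) 0 = 0" by (simp add: red_hyp)
  then show False by (simp add: hyp_nth)
qed

lemma unit_root_factor_spec: "lexp (red vq) * dil CARD('p) hypergeom = (hypergeom :: 'p zp fps)"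
proof -
  have "red_fps (lexp vq * dil CARD('p) (hyp 1)) = red_fps F"
    unfolding vq(2) ..
  moreover have "red_fps (dil CARD('p) (hyp 1)) = dil CARD('p) (red_fps (hyp 1))"
    by (rule fps_ext) (simp add: dil_nth)
  ultimately show ?thesis
    by (simp add: red_fps.hom_mult red_hyp lexp_red)
qed

lemma dil_hypergeom_neq_0: "dil CARD('p) hypergeom \<noteq> (0 :: 'p zp fps)"
  using unit_root_factor_spec hypergeom_neq_0 by auto

lemma unit_root_factor_eq: "unit_root_factor = red vq"
  unfolding unit_root_factor_def expansion_eq dil_eq_compose[OF prime_gt_0_nat[OF p_prime], symmetric]
proof (rule the_equality)
  fix u :: "'p B'"
  assume "lexp u * dil CARD('p) hypergeom = hypergeom"
  then have "lexp u * dil CARD('p) hypergeom = lexp (red vq) * dil CARD('p) hypergeom"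
    by (simp add: unit_root_factor_spec)
  then show "u = red vq"
    using dil_hypergeom_neq_0 by (simp add: lexp_inj)
qed (rule unit_root_factor_spec)

text \<open>The reduction of \<open>Dq\<close> is \<lambda> f'/f. It has zero constant term, so it
  can be divided by \<lambda> inside B'; hence f'/f lies in B' and the definite description
  denotes.\<close>

lemma log_deriv_spec: "lexp log_deriv * hypergeom = fps_deriv (hypergeom :: 'p zp fps)"
  and red_Dq: "red Dq = lam * log_deriv"
proof -
  have qbr0: "fps_nth (qbr n) 0 = of_nat n" for n
    by (simp add: qbr_def fps_sum_nth fps_nth_power_0)
  have "red_fps (lexp Dq * F) = red_fps (hyp_series 0 qbr)"
    by (simp add: Dq)
  moreover have "red_fps (hyp_series 0 qbr) = fps_X * fps_deriv (red_fps F)"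
  proof (rule fps_ext)
    fix n show "fps_nth (red_fps (hyp_series 0 qbr)) n = fps_nth (fps_X * fps_deriv (red_fps F)) n"
      by (cases n) (simp_all add: hyp_series_def qbr0)
  qed
  ultimately have D: "lexp (red Dq) * hypergeom = fps_X * fps_deriv hypergeom"
    by (simp add: red_fps.hom_mult red_hyp lexp_red)
  then have "fps_nth (lexp (red Dq) * hypergeom) 0 = 0" by simp
  moreover have "fps_nth (hypergeom :: 'p zp fps) 0 = 1"
    by (simp flip: red_hyp[of 0] add: hyp_nth)
  ultimately have "fps_nth (lexp (red Dq)) 0 = 0" by simp
  then have shift: "lexp (red Dq) = fps_X * fps_shift 1 (lexp (red Dq))"
    by (intro fps_ext) simp
  have "fps_X * fps_shift 1 (lexp (red Dq)) \<in> range (lexp :: 'p B' \<Rightarrow> _)"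
    unfolding shift[symmetric] by (rule rangeI)
  then obtain b :: "'p B'" where b: "lexp b = fps_shift 1 (lexp (red Dq))"
    by (rule range_lexp_obtain[OF range_lexp_X_mult])
  have Db: "red Dq = lam * b"
    using shift by (simp add: lexp_inj[symmetric] lexp.hom_mult lexp_lam b)
  have "fps_X * (lexp b * hypergeom) = fps_X * fps_deriv hypergeom"
    using D by (simp add: Db lexp.hom_mult lexp_lam mult.assoc)
  then have b1: "lexp b * hypergeom = fps_deriv hypergeom" by simp
  have "log_deriv = b"
    unfolding log_deriv_def expansion_eq
  proof (rule the_equality)
    fix c :: "'p B'" assume "lexp c * hypergeom = fps_deriv hypergeom"
    then have "lexp c * hypergeom = lexp b * hypergeom" by (simp add: b1)
    then show "c = b" using hypergeom_neq_0 by (simp add: lexp_inj)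
  qed (rule b1)
  then show "lexp log_deriv * hypergeom = fps_deriv (hypergeom :: 'p zp fps)" "red Dq = lam * log_deriv"
    using b1 Db by simp_all
qed

lemma red_aq_1: "red (aq 1) = 1"
  by (simp only: aq_1 red.hom_add red.hom_mult red_qS_minus_1 red.hom_one) simp

lemma red_gq: "red gq = - (lam * log_deriv)"
  by (simp add: gq_def red.hom_mult red.hom_uminus red_aq_1 red_Dq)

end

section \<open>Modules of rank one\<close>

lemma rank_one_free:
  assumes "Modules.module smul" "\<And>a. smul a e = 0 \<Longrightarrow> a = 0"
  shows "free_of_rank smul 1 (range (\<lambda>a. smul a e))"
proof -
  interpret M: Modules.module smul by fact
  have "\<not> M.dependent {e}"
  proof
    assume "M.dependent {e}"
    then obtain t u v where "t \<subseteq> {e}" "(\<Sum>v\<in>t. smul (u v) v) = 0" "v \<in> t" "u v \<noteq> 0"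
      unfolding M.dependent_explicit by blast
    moreover from this have "t = {e}" "v = e" by auto
    ultimately show False using assms(2) by simp
  qed
  then show ?thesis
    unfolding free_of_rank_def by (intro exI[of _ "{e}"]) (simp add: M.span_singleton)
qed

lemma rank_one_inj:
  assumes "Modules.module smul" "\<And>a. smul a e = 0 \<Longrightarrow> a = 0" "smul a e = smul b e"
  shows "a = b"
proof -
  interpret M: Modules.module smul by fact
  have "smul (a - b) e = 0"
    using assms(3) by (simp add: M.scale_left_diff_distrib)
  then show ?thesis using assms(2) by force
qed

lemma line_map_eq:
  assumes "Modules.module smul" "\<And>a. smul a e = 0 \<Longrightarrow> a = 0"
  shows "line_map smul e g (smul b e) = smul (g b) e"
  unfolding line_map_def using rank_one_inj[OF assms] by (intro the_equality) auto

lemma topspace_adic_topology: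
  assumes "Modules.module smul"
  shows "topspace (adic_topology smul M) = M"
proof (rule subset_antisym)
  show "topspace (adic_topology smul M) \<subseteq> M"
    using openin_topspace[of "adic_topology smul M"] unfolding openin_adic_topology[OF assms] by blast
  have "openin (adic_topology smul M) M"
    unfolding openin_adic_topology[OF assms] by blast
  then show "M \<subseteq> topspace (adic_topology smul M)"
    by (rule openin_subset)
qed

text \<open>Over a discrete group the slices with fixed k are open, so preserving the adic
  filtration for each k separately suffices.\<close>

lemma continuous_discrete_action:
  assumes smul: "Modules.module smul"
    and maps: "\<And>k x. x \<in> M \<Longrightarrow> f k x \<in> M"
    and cont: "\<And>k x y n. x \<in> M \<Longrightarrow> y \<in> M \<Longrightarrow> y - x \<in> module_ideal_power smul M n
      \<Longrightarrow> f k y - f k x \<in> module_ideal_power smul M n"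
  shows "continuous_map (prod_topology (discrete_topology UNIV) (adic_topology smul M))
    (adic_topology smul M) (\<lambda>(k, x). f k x)"
  unfolding continuous_map_def
proof (intro conjI allI impI)
  show "(\<lambda>(k, x). f k x) \<in> topspace (prod_topology (discrete_topology UNIV) (adic_topology smul M))
      \<rightarrow> topspace (adic_topology smul M)"
    by (auto simp: topspace_adic_topology[OF smul] maps)
next
  fix W assume W: "openin (adic_topology smul M) W"
  show "openin (prod_topology (discrete_topology UNIV) (adic_topology smul M))
    {x \<in> topspace (prod_topology (discrete_topology UNIV) (adic_topology smul M)). (\<lambda>(k, x). f k x) x \<in> W}"
    unfolding openin_prod_topology_alt
  proof (intro allI impI)
    fix k x
    assume "(k, x) \<in> {x \<in> topspace (prod_topology (discrete_topology UNIV) (adic_topology smul M)). (\<lambda>(k, x). f k x) x \<in> W}"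
    then have x: "x \<in> {y \<in> M. f k y \<in> W}"
      by (simp add: topspace_adic_topology[OF smul])
    have "openin (adic_topology smul M) {y \<in> M. f k y \<in> W}"
      unfolding openin_adic_topology[OF smul]
    proof (intro conjI ballI)
      fix y assume y: "y \<in> {y \<in> M. f k y \<in> W}"
      then obtain n where n: "\<And>z. z \<in> M \<Longrightarrow> z - f k y \<in> module_ideal_power smul M n \<Longrightarrow> z \<in> W"
        using W unfolding openin_adic_topology[OF smul] by blast
      show "\<exists>n. \<forall>z\<in>M. z - y \<in> module_ideal_power smul M n \<longrightarrow> z \<in> {y \<in> M. f k y \<in> W}"
        using y n maps cont by (intro exI[of _ n]) auto
    qed auto
    then show "\<exists>U V. openin (discrete_topology UNIV) U \<and> openin (adic_topology smul M) V \<and> k \<in> U \<and> x \<in> V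
        \<and> U \<times> V \<subseteq> {x \<in> topspace (prod_topology (discrete_topology UNIV) (adic_topology smul M)). (\<lambda>(k, x). f k x) x \<in> W}"
      using x by (intro exI[of _ "{k}"] exI[of _ "{y \<in> M. f k y \<in> W}"])
        (auto simp: topspace_adic_topology[OF smul])
  qed
qed

locale q_legendre = Gamma_action P \<rho> for P :: "'p::prime_card itself" and \<rho> +
  fixes \<phi> :: "'p S' \<Rightarrow> 'p S'"
    and nabla_q :: "'p S' \<times> 'p S' \<Rightarrow> 'p S' \<times> 'p S'"
    and smulH :: "'p B' \<Rightarrow> 'h::ab_group_add \<Rightarrow> 'h"
    and G :: "'h \<Rightarrow> 'h"
    and \<omega> :: 'h
  assumes frobenius: "is_frobenius \<phi>"
    and q_conn: "is_q_connection_M' \<rho> nabla_q"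
    and legendre: "is_legendre_deRham smulH G \<omega>"
begin

section \<open>The unit root part over \<open>S'\<close>\<close>

definition cq :: "'p S'" where
  "cq = (1 - lam) * Dq"

text \<open>\<open>F\<close> times the generator \<open>cq e\<^sub>1' + e\<^sub>2\<close> is the horizontal section
  \<open>\<lambda>(1 - \<lambda>) d\<^sub>q(F) e\<^sub>1' + F e\<^sub>2\<close>.\<close>

definition vec :: "'p S' \<Rightarrow> 'p S' \<times> 'p S'" where
  "vec s = (s * cq, s)"

definition UU :: "('p S' \<times> 'p S') set" where
  "UU = range vec"

lemma vec_simps [simp]: "snd (vec s) = s" "vec s \<in> UU"
  by (simp_all add: vec_def UU_def)

lemma vec_inj [simp]: "vec s = vec t \<longleftrightarrow> s = t"
  by (auto simp: vec_def)

lemma vec_add: "vec s + vec t = vec (s + t)"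
  by (simp add: vec_def distrib_right)

lemma vec_diff: "vec s - vec t = vec (s - t)"
  by (simp add: vec_def left_diff_distrib)

lemma vec_scale: "pair_scale a (vec s) = vec (a * s)"
  by (simp add: vec_def pair_scale mult.assoc)

lemma vec_0: "vec 0 = 0"
  by (simp add: vec_def zero_prod_def)

lemma UU_E: assumes "x \<in> UU" obtains s where "x = vec s"
  using assms by (auto simp: UU_def)

lemma UU_eq: "UU = range (\<lambda>s. pair_scale s (vec 1))"
  by (simp add: UU_def vec_scale)

lemma span_UU: "Modules.module.span pair_scale {vec 1} = UU"
  by (simp add: UU_eq module.span_singleton[OF module_pair_scale])

lemma free_UU: "free_of_rank pair_scale 1 UU"
  unfolding UU_eq by (rule rank_one_free[OF module_pair_scale]) (simp add: vec_scale flip: vec_0)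

text \<open>The generator has e2-coordinate 1, so S' e1' is a complement.\<close>

lemma direct_factor_UU: "direct_factor pair_scale UU UNIV"
  unfolding direct_factor_def
proof (intro conjI exI[of _ "range (\<lambda>a. (a, 0))"])
  show "Modules.module.subspace pair_scale UU"
    unfolding span_UU[symmetric] by (rule module.subspace_span[OF module_pair_scale])
  show "Modules.module.subspace pair_scale (range (\<lambda>a. (a, 0)) :: ('p S' \<times> 'p S') set)"
    unfolding module.subspace_def[OF module_pair_scale] by (auto simp: pair_scale zero_prod_def)
  show "UU \<inter> range (\<lambda>a. (a, 0)) = {0}"
    by (auto simp: UU_def vec_def zero_prod_def image_iff)
  have "x \<in> {u + v |u v. u \<in> UU \<and> v \<in> range (\<lambda>a. (a, 0))}" for x
  proof -
    have "x = vec (snd x) + (fst x - snd x * cq, 0)"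
      by (cases x) (simp add: vec_def)
    then show ?thesis
      by (intro CollectI exI[of _ "vec (snd x)"] exI[of _ "(fst x - snd x * cq, 0)"]) auto
  qed
  then show "{u + v |u v. u \<in> UU \<and> v \<in> range (\<lambda>a. (a, 0))} = UNIV"
    by blast
qed

subsection \<open>The \<open>q\<close>-connection and the action of \<open>\<Gamma>\<close>\<close>

lemma nabla_q:
  "nabla_q (x + y) = nabla_q x + nabla_q y"
  "nabla_q (pair_scale a x) = pair_scale ((1 - lam) * lam * d_q \<rho> a) x + pair_scale (\<rho> 1 a) (nabla_q x)"
  "nabla_q (1, 0) = (0, - 1)"
  "nabla_q (0, 1) = (lam * (1 - lam) * - (algebra_map (q_bracket (1/2)))\<^sup>2,
      lam * (algebra_map (q_bracket (1/2)))\<^sup>2 * (qS - 1))"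
  using q_conn unfolding is_q_connection_M'_def q_connection_def by blast+

text \<open>The q-Riccati equation for the slope \<open>cq\<close> of a line stable under the
  connection: it makes the e1'-coordinate of the derivative of the generator match its
  e2-coordinate.\<close>

lemma riccati: "lam * (d_q \<rho> cq - (algebra_map (q_bracket (1/2)))\<^sup>2) = gq * cq"
proof (rule lexp_mult_cancel[OF _ qS_minus_1_neq_0])
  let ?b = "(algebra_map (q_bracket (1/2)))\<^sup>2 :: 'p S'"
  define X where "X = (qS - 1 :: 'p S')"
  have \<rho>c: "\<rho> 1 cq = lam * ?b * X - (1 - lam) * gq"
    unfolding cq_def X_def using q_hypergeometric_first_order by (simp only: algebra_simps)
  have "aq 1 * (1 + X * Dq) = 1"
    using aq_bq[of 1] by (simp only: bq_1 X_def)
  then have ab: "aq 1 * (X * Dq) = 1 - aq 1"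
    by (simp add: algebra_simps)
  have "X * (gq * Dq) = - (aq 1 * (X * Dq)) * Dq"
    by (simp add: gq_def ac_simps)
  also have "\<dots> = - gq - Dq"
    unfolding ab by (simp add: gq_def algebra_simps)
  \<comment> \<open>This is (1 + X \<open>gq\<close>)(1 + X \<open>Dq\<close>) = 1, the inverse
    relation between F / \<gamma>F and \<gamma>F / F, with one X cancelled in effect.\<close>
  finally have gD: "X * (gq * Dq) = - gq - Dq" .
  have "X * (lam * (d_q \<rho> cq - ?b)) = (\<rho> 1 cq - cq) - lam * ?b * X"
    unfolding d_q X_def by (simp only: algebra_simps)
  also have "\<dots> = (1 - lam) * (- gq - Dq)"
    unfolding \<rho>c by (simp add: cq_def algebra_simps)
  also have "\<dots> = X * (gq * cq)"
    unfolding gD[symmetric] by (simp add: cq_def ac_simps)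
  finally show "(qS - 1) * (lam * (d_q \<rho> cq - ?b)) = (qS - 1) * (gq * cq)"
    by (simp only: X_def)
qed

text \<open>\<open>vec s\<close> is s/F times a horizontal section, so the logarithmic coefficient
  is \<lambda> F d_q(s/F), expanded by the twisted Leibniz rule. The factor 1 - \<lambda> cancels
  the pole at \<lambda> = 1.\<close>

lemma nabla_q_vec: "nabla_q (vec s) = pair_scale (1 - lam) (vec (lam * d_q \<rho> s + \<rho> 1 s * gq))"
proof -
  let ?b = "(algebra_map (q_bracket (1/2)))\<^sup>2 :: 'p S'"
  have "nabla_q (vec 1) = nabla_q (pair_scale cq (1, 0) + (0, 1))"
    by (simp add: vec_def pair_scale)
  also have "\<dots> = pair_scale ((1 - lam) * lam * d_q \<rho> cq) (1, 0) + pair_scale (\<rho> 1 cq) (0, - 1) +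
      (lam * (1 - lam) * - ?b, lam * ?b * (qS - 1))"
    by (simp only: nabla_q)
  also have "\<dots> = ((1 - lam) * (lam * (d_q \<rho> cq - ?b)), lam * ?b * (qS - 1) - \<rho> 1 cq)"
    by (simp add: pair_scale algebra_simps)
  also have "lam * ?b * (qS - 1) - \<rho> 1 cq = (1 - lam) * gq"
    unfolding cq_def q_hypergeometric_first_order[symmetric] by simp
  also have "((1 - lam) * (lam * (d_q \<rho> cq - ?b)), (1 - lam) * gq) = pair_scale (1 - lam) (vec gq)"
    unfolding riccati by (simp add: pair_scale vec_def)
  finally have 1: "nabla_q (vec 1) = pair_scale (1 - lam) (vec gq)" .
  have "nabla_q (vec s) = nabla_q (pair_scale s (vec 1))"
    by (simp add: vec_scale)
  also have "\<dots> = pair_scale ((1 - lam) * lam * d_q \<rho> s) (vec 1) + pair_scale (\<rho> 1 s) (nabla_q (vec 1))"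
    by (rule nabla_q(2))
  also have "\<dots> = pair_scale (1 - lam) (vec (lam * d_q \<rho> s + \<rho> 1 s * gq))"
    unfolding 1 vec_scale vec_add by (simp add: algebra_simps)
  finally show ?thesis .
qed

lemma D_q_log_vec: "D_q_log (1 - lam) pair_scale UU nabla_q (vec s) = vec (lam * d_q \<rho> s + \<rho> 1 s * gq)"
  unfolding D_q_log_def
proof (rule the_equality)
  fix y
  assume y: "y \<in> UU \<and> nabla_q (vec s) = pair_scale (1 - lam) y"
  then obtain t where t: "y = vec t" by (auto elim: UU_E)
  then have "(1 - lam) * t = (1 - lam) * (lam * d_q \<rho> s + \<rho> 1 s * gq)"
    using y by (simp add: nabla_q_vec vec_scale)
  from lexp_mult_cancel[OF this one_minus_lam_neq_0] show "y = vec (lam * d_q \<rho> s + \<rho> 1 s * gq)"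
    by (simp add: t)
qed (simp add: nabla_q_vec)

text \<open>The horizontal section is fixed by the group; only the coefficient s/F moves, which
  produces the factor F / \<gamma>^k F.\<close>

definition \<rho>U :: "int \<Rightarrow> 'p S' \<times> 'p S' \<Rightarrow> 'p S' \<times> 'p S'" where
  "\<rho>U k x = vec (\<rho> k (snd x) * aq k)"

lemma \<rho>U_1: "\<rho>U 1 (vec s) = vec s + pair_scale (qS - 1) (vec (lam * d_q \<rho> s + \<rho> 1 s * gq))"
proof -
  have "\<rho> 1 s * aq 1 = s + (\<rho> 1 s - s) + (qS - 1) * (\<rho> 1 s * gq)"
    by (simp only: aq_1 distrib_left mult_1_right) (simp add: ac_simps)
  also have "\<dots> = s + (qS - 1) * (lam * d_q \<rho> s + \<rho> 1 s * gq)"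
    by (simp only: d_q distrib_left mult.assoc add.assoc)
  finally show ?thesis
    by (simp only: \<rho>U_def vec_simps vec_scale vec_add)
qed

lemma semilinear_\<rho>U: "semilinear_endo (\<rho> k) pair_scale UU (\<rho>U k)"
  unfolding semilinear_endo_def
  by (auto simp: \<rho>U_def vec_add vec_scale \<rho>.hom_add \<rho>.hom_mult distrib_right mult.assoc elim!: UU_E)

lemma module_ideal_power_UU: "x \<in> module_ideal_power pair_scale UU n \<Longrightarrow> snd x \<in> ideal_power n"
proof -
  let ?S = "{x :: 'p S' \<times> 'p S'. snd x \<in> ideal_power n}"
  have "Modules.module.span pair_scale {pair_scale c x |c x. c \<in> ideal_power n \<and> x \<in> UU} \<subseteq> ?S"
  proof (rule module.span_minimal[OF module_pair_scale])
    show "{pair_scale c x |c x. c \<in> ideal_power n \<and> x \<in> UU} \<subseteq> ?S"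
      by (auto simp: vec_scale ideal_power_mult2 elim!: UU_E)
    show "Modules.module.subspace pair_scale ?S"
      unfolding module.subspace_def[OF module_pair_scale]
      by (auto simp: pair_scale ideal_power_add ideal_power_mult)
  qed
  then show "x \<in> module_ideal_power pair_scale UU n \<Longrightarrow> snd x \<in> ideal_power n"
    unfolding module_ideal_power_def by blast
qed

lemma semilinear_Gamma_action_\<rho>U: "semilinear_Gamma_action \<rho> pair_scale UU \<rho>U"
  unfolding semilinear_Gamma_action_def
proof (intro conjI allI ballI)
  show "semilinear_endo (\<rho> k) pair_scale UU (\<rho>U k)" for k
    by (rule semilinear_\<rho>U)
  show "\<rho>U 0 x = x" if "x \<in> UU" for x
    using that by (auto simp: \<rho>U_def \<rho>_0 aq_0 elim!: UU_E)
  show "\<rho>U (k + l) x = \<rho>U k (\<rho>U l x)" if "x \<in> UU" for k l x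
    using that by (auto simp: \<rho>U_def \<rho>_add aq_add \<rho>.hom_mult ac_simps elim!: UU_E)
  show "continuous_map (prod_topology (discrete_topology UNIV) (adic_topology pair_scale UU))
     (adic_topology pair_scale UU) (\<lambda>(k, x). \<rho>U k x)"
  proof (rule continuous_discrete_action[OF module_pair_scale])
    show "\<rho>U k x \<in> UU" for k x
      by (simp add: \<rho>U_def)
    fix k x y n
    assume "y - x \<in> module_ideal_power pair_scale UU n"
    then have "snd (y - x) \<in> ideal_power n"
      by (rule module_ideal_power_UU)
    then have "\<rho> k (snd (y - x)) \<in> ideal_power n"
      by (rule \<rho>_ideal_power)
    moreover have "\<rho>U k y - \<rho>U k x = pair_scale (\<rho> k (snd (y - x))) (vec (aq k))"
      by (simp add: \<rho>U_def vec_diff vec_scale \<rho>.hom_minus left_diff_distrib)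
    ultimately have "\<rho>U k y - \<rho>U k x \<in> {pair_scale c x |c x. c \<in> ideal_power n \<and> x \<in> UU}"
      using vec_simps(2) by blast
    then show "\<rho>U k y - \<rho>U k x \<in> module_ideal_power pair_scale UU n"
      unfolding module_ideal_power_def by (rule module.span_base[OF module_pair_scale])
  qed
qed

lemma associated_action_\<rho>U: "associated_action \<rho> (1 - lam) pair_scale UU nabla_q \<rho>U"
  unfolding associated_action_def
proof (intro conjI ballI semilinear_Gamma_action_\<rho>U)
  fix x assume "x \<in> UU"
  then obtain s where "x = vec s" by (rule UU_E)
  then show "\<rho>U 1 x = x + pair_scale (qS - 1) (D_q_log (1 - lam) pair_scale UU nabla_q x)"
    by (simp only: D_q_log_vec \<rho>U_1)
qed

subsection \<open>The Frobenius\<close>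

text \<open>The sign is a constant fixed by the action and by \<phi>; it is dictated by the
  Frobenius of the classical unit root part.\<close>

definition vs :: "'p S'" where
  "vs = (- 1) ^ ((CARD('p) - 1) div 2) * vq"

definition \<phi>U :: "'p S' \<times> 'p S' \<Rightarrow> 'p S' \<times> 'p S'" where
  "\<phi>U x = vec (\<phi> (snd x) * vs)"

lemma \<phi>_hom: "comm_ring_hom \<phi>"
  using frobenius by (simp add: is_frobenius_def)

sublocale \<phi>: comm_ring_hom \<phi>
  by (rule \<phi>_hom)

lemma vs_unit: "\<exists>w. vs * w = 1"
proof -
  obtain w where w: "vq * w = 1" using vq(1) by blast
  have "vs * ((- 1) ^ ((CARD('p) - 1) div 2) * w) = ((- 1) ^ ((CARD('p) - 1) div 2) * (- 1) ^ ((CARD('p) - 1) div 2)) * (vq * w)"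
    by (simp only: vs_def ac_simps)
  also have "\<dots> = 1"
    by (simp add: w flip: power_mult_distrib)
  finally show ?thesis ..
qed

lemma semilinear_\<phi>U: "semilinear_endo \<phi> pair_scale UU \<phi>U"
  unfolding semilinear_endo_def
  by (auto simp: \<phi>U_def vec_add vec_scale \<phi>.hom_add \<phi>.hom_mult distrib_right mult.assoc elim!: UU_E)

lemma span_\<phi>U: "Modules.module.span pair_scale (\<phi>U ` UU) = UU"
proof (rule subset_antisym)
  have "\<phi>U ` UU \<subseteq> UU"
    by (auto simp: \<phi>U_def)
  from module.span_mono[OF module_pair_scale this]
  show "Modules.module.span pair_scale (\<phi>U ` UU) \<subseteq> UU"
    by (metis module.span_span[OF module_pair_scale] span_UU)
  obtain w where w: "vs * w = 1" using vs_unit by blast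
  show "UU \<subseteq> Modules.module.span pair_scale (\<phi>U ` UU)"
  proof
    fix x assume "x \<in> UU"
    then obtain s where s: "x = vec s" by (rule UU_E)
    have "x = pair_scale (s * w) (\<phi>U (vec 1))"
      using w by (simp add: s \<phi>U_def vec_scale mult.assoc mult.commute[of w])
    then show "x \<in> Modules.module.span pair_scale (\<phi>U ` UU)"
      by (simp add: module.span_scale[OF module_pair_scale] module.span_base[OF module_pair_scale])
  qed
qed

lemma \<rho>_vs: "\<rho> k vs * aq k = \<phi> (aq k) * vs"
proof -
  have "\<rho> k ((- 1) ^ n) = (- 1) ^ n" for n
    by (simp add: \<rho>.hom_power \<rho>.hom_uminus)
  then show ?thesis
    unfolding vs_def using frobenius_cocycle[OF frobenius, of k] by (simp add: \<rho>.hom_mult mult.assoc mult.left_commute)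
qed

lemma frobenius_\<rho>: "\<rho> k (\<phi> s) = \<phi> (\<rho> k s)"
proof -
  have "lexp (\<rho> k (\<phi> s)) = lexp (\<phi> (\<rho> k s))"
    by (simp add: lexp_\<rho> lexp_frobenius[OF frobenius] scale_frob_fps)
  then show ?thesis by (simp add: lexp_inj)
qed

lemma MF_object_UU: "MF_object \<phi> \<rho> pair_scale UU \<phi>U \<rho>U"
  unfolding MF_object_def
proof (intro conjI allI ballI)
  show "\<exists>n. free_of_rank pair_scale n UU"
    using free_UU by blast
  show "\<rho>U k (\<phi>U x) = \<phi>U (\<rho>U k x)" if "x \<in> UU" for k x
  proof -
    have "\<rho> k (\<phi> s * vs) * aq k = \<phi> (\<rho> k s * aq k) * vs" for s
      using \<rho>_vs[of k] by (simp add: \<rho>.hom_mult \<phi>.hom_mult frobenius_\<rho> mult.assoc)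
    then show ?thesis by (simp add: \<rho>U_def \<phi>U_def)
  qed
  show "\<exists>y\<in>UU. \<rho>U 1 x - x = pair_scale (qS - 1) y" if x: "x \<in> UU" for x
  proof -
    obtain s where "x = vec s" using x by (rule UU_E)
    then have "\<rho>U 1 x - x = pair_scale (qS - 1) (vec (lam * d_q \<rho> s + \<rho> 1 s * gq))"
      by (simp only: \<rho>U_1 add_diff_cancel_left')
    then show ?thesis using vec_simps(2) by blast
  qed
qed (simp_all add: module_pair_scale semilinear_\<phi>U span_\<phi>U semilinear_Gamma_action_\<rho>U)

section \<open>Comparison with the classical unit root part\<close>

lemma smulH: "Modules.module smulH"
  and bij_H: "bij (\<lambda>(a, b). smulH a \<omega> + smulH b (G \<omega>))"
  using legendre by (auto simp: is_legendre_deRham_def)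

sublocale H: Modules.module smulH
  by (rule smulH)

abbreviation eb :: 'h where
  "eb \<equiv> e2bar smulH G \<omega>"

abbreviation UB :: "'h set" where
  "UB \<equiv> U_B' smulH G \<omega>"

abbreviation UB_frob :: "'h \<Rightarrow> 'h" where
  "UB_frob \<equiv> frobenius_U_B' \<phi> smulH G \<omega>"

abbreviation UB_conn :: "'h \<Rightarrow> 'h" where
  "UB_conn \<equiv> connection_U_B' smulH G \<omega>"

abbreviation \<phi>B :: "'p B' \<Rightarrow> 'p B'" where
  "\<phi>B \<equiv> frobenius_B' \<phi>"

lemma eb_independent: "smulH a eb = 0 \<Longrightarrow> a = 0"
proof -
  assume "smulH a eb = 0"
  then have "(\<lambda>(a, b). smulH a \<omega> + smulH b (G \<omega>)) (a * (lam * (1 - lam) * log_deriv), - a) =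
      (\<lambda>(a, b). smulH a \<omega> + smulH b (G \<omega>)) (0, 0)"
    by (simp add: e2bar_def H.scale_right_diff_distrib)
  from injD[OF bij_is_inj[OF bij_H] this] show "a = 0" by simp
qed

lemma eb_inj [simp]: "smulH a eb = smulH b eb \<longleftrightarrow> a = b"
  using rank_one_inj[OF smulH eb_independent] by blast

lemma U_B'_eq: "UB = range (\<lambda>a. smulH a eb)"
  by (simp add: U_B'_def H.span_singleton)

lemma U_B'_E:
  assumes "x \<in> UB" obtains a where "x = smulH a eb"
  using assms by (auto simp: U_B'_eq)

lemma U_B'_I [simp]: "smulH a eb \<in> UB"
  by (simp add: U_B'_eq)

definition vB :: "'p B'" where
  "vB = (- 1) ^ ((CARD('p) - 1) div 2) * unit_root_factor"

lemma red_vs: "red vs = vB"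
  by (simp add: vs_def vB_def unit_root_factor_eq red.hom_mult red.hom_power red.hom_uminus)

lemma frobenius_U_B'_eq: "UB_frob (smulH b eb) = smulH (\<phi>B b * vB) eb"
  unfolding frobenius_U_B'_def vB_def by (rule line_map_eq[OF smulH eb_independent])

lemma connection_U_B'_eq:
  "UB_conn (smulH b eb) = smulH (lam * ddlam b + b * (lam * - log_deriv)) eb"
  unfolding connection_U_B'_def by (rule line_map_eq[OF smulH eb_independent])

lemma vB_unit: "\<exists>w. vB * w = 1"
  using vs_unit by (metis red.hom_mult red.hom_one red_vs)

lemma ddlam_add: "ddlam (x + y) = ddlam x + (ddlam y :: 'p B')"
  and ddlam_mult: "ddlam (x * y) = ddlam x * y + x * (ddlam y :: 'p B')"
  using ddlam_spec[where 'p='p] by auto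

sublocale \<phi>B: comm_ring_hom \<phi>B
  by (rule frobenius_B'_hom[OF frobenius])

lemma dil_zp_hom: "comm_ring_hom (dil CARD('p) :: 'p zp fps \<Rightarrow> 'p zp fps)"
  by (intro dil_hom prime_gt_0_nat prime_card)

sublocale dil_zp: comm_ring_hom "dil CARD('p) :: 'p zp fps \<Rightarrow> 'p zp fps"
  by (rule dil_zp_hom)

lemma p_gt_0: "CARD('p) > 0"
  using p_ge_3 by simp

lemma ddlam_\<phi>B: "lam * ddlam (\<phi>B b) = of_nat CARD('p) * \<phi>B (lam * ddlam b)"
proof -
  have "lexp (lam * ddlam (\<phi>B b)) = lexp (of_nat CARD('p) * \<phi>B (lam * ddlam b))"
    unfolding lexp.hom_mult lexp_lam lexp_ddlam lexp_frobenius_B'[OF frobenius] lexp.hom_of_nat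
    by (rule X_fps_deriv_dil[OF p_gt_0])
  then show ?thesis by (simp add: lexp_inj)
qed

text \<open>The logarithmic derivative of f / \<phi>(f), the constant sign dropping out. This
  identity is the horizontality of the Frobenius on the generator.\<close>

lemma lam_ddlam_vB: "lam * ddlam vB = vB * (lam * log_deriv - of_nat CARD('p) * \<phi>B (lam * log_deriv))"
proof -
  let ?f = "hypergeom :: 'p zp fps"
  let ?d = "dil CARD('p) :: 'p zp fps \<Rightarrow> 'p zp fps"
  let ?s = "(- 1) ^ ((CARD('p) - 1) div 2) :: 'p zp"
  let ?L = "fps_X * lexp (log_deriv :: 'p B')"
  have s: "lexp vB = fps_const ?s * lexp (red vq)"
    by (simp add: vB_def unit_root_factor_eq lexp.hom_mult lexp.hom_power lexp.hom_uminus fps_const_power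
        fps_const_neg[symmetric] flip: fps_const_power del: fps_const_neg)
  have v: "lexp vB * ?d ?f = fps_const ?s * ?f"
    unfolding s mult.assoc unit_root_factor_spec ..
  have L: "fps_X * fps_deriv ?f = ?L * ?f"
    by (simp flip: log_deriv_spec add: mult.assoc)
  have "fps_X * fps_deriv (lexp vB) * ?d ?f + lexp vB * (fps_X * fps_deriv (?d ?f)) = fps_X * fps_deriv (lexp vB * ?d ?f)"
    by (simp add: algebra_simps)
  also have "\<dots> = fps_const ?s * (fps_X * fps_deriv ?f)"
    unfolding v by (simp add: mult.left_commute)
  also have "\<dots> = ?L * (fps_const ?s * ?f)"
    unfolding L by (simp only: ac_simps)
  also have "\<dots> = ?L * (lexp vB * ?d ?f)"
    unfolding v ..
  also have "fps_X * fps_deriv (?d ?f) = of_nat CARD('p) * (?d ?L * ?d ?f)"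
    unfolding X_fps_deriv_dil[OF p_gt_0] L dil_zp.hom_mult ..
  finally have "(fps_X * fps_deriv (lexp vB)) * ?d ?f = (lexp vB * (?L - of_nat CARD('p) * ?d ?L)) * ?d ?f"
    by (simp only: algebra_simps)
  then have "fps_X * fps_deriv (lexp vB) = lexp vB * (?L - of_nat CARD('p) * ?d ?L)"
    using dil_hypergeom_neq_0 by (simp only: mult_cancel_right) simp
  then have "lexp (lam * ddlam vB) = lexp (vB * (lam * log_deriv - of_nat CARD('p) * \<phi>B (lam * log_deriv)))"
    by (simp add: lexp.hom_mult lexp_lam lexp_ddlam lexp.hom_minus lexp.hom_of_nat lexp_frobenius_B'[OF frobenius])
  then show ?thesis by (simp add: lexp_inj)
qed

lemma MIC_object_U_B':
  "MIC_object \<phi>B smulH UB UB_frob UB_conn"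
  unfolding MIC_object_def
proof (intro conjI ballI)
  show "Modules.module smulH" by (rule smulH)
  show "\<exists>n. free_of_rank smulH n UB"
    using rank_one_free[OF smulH eb_independent] by (auto simp: U_B'_eq)
  show "semilinear_endo \<phi>B smulH UB UB_frob"
    unfolding semilinear_endo_def
    by (auto simp: frobenius_U_B'_eq \<phi>B.hom_add \<phi>B.hom_mult distrib_right mult.assoc H.scale_scale
        simp flip: H.scale_left_distrib elim!: U_B'_E)
  show "H.span (UB_frob ` UB) = UB"
  proof (rule subset_antisym)
    have "UB_frob ` UB \<subseteq> H.span {eb}"
      unfolding U_B'_def[symmetric] by (auto simp: frobenius_U_B'_eq elim!: U_B'_E)
    from H.span_mono[OF this] show "H.span (UB_frob ` UB) \<subseteq> UB"
      by (simp add: U_B'_def H.span_span)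
    obtain w where w: "vB * w = 1" using vB_unit by blast
    show "UB \<subseteq> H.span (UB_frob ` UB)"
    proof
      fix x assume "x \<in> UB"
      then obtain a where a: "x = smulH a eb" by (rule U_B'_E)
      have "x = smulH (a * w) (UB_frob (smulH 1 eb))"
        unfolding frobenius_U_B'_eq a using w by (simp add: H.scale_scale mult.assoc mult.commute[of w])
      moreover have "UB_frob (smulH 1 eb) \<in> UB_frob ` UB"
        by (rule imageI) (rule U_B'_I)
      ultimately show "x \<in> H.span (UB_frob ` UB)"
        by (simp only: H.span_scale H.span_base)
    qed
  qed
  show "is_connection lam smulH UB UB_conn"
    unfolding is_connection_def
  proof (intro conjI ballI allI)
    show "UB_conn ` UB \<subseteq> UB"
      using U_B'_I by (auto simp: connection_U_B'_eq simp del: U_B'_I elim!: U_B'_E)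
    fix x y b assume x: "x \<in> UB"
    obtain a where a: "x = smulH a eb" using x by (rule U_B'_E)
    show "UB_conn (smulH b x) = smulH (lam * ddlam b) x + smulH b (UB_conn x)"
      unfolding a H.scale_scale connection_U_B'_eq H.scale_left_distrib[symmetric]
      by (simp add: ddlam_mult algebra_simps)
    assume "y \<in> UB"
    then obtain a' where a': "y = smulH a' eb" by (rule U_B'_E)
    show "UB_conn (x + y) = UB_conn x + UB_conn y"
      unfolding a a' H.scale_left_distrib[symmetric] connection_U_B'_eq
      by (simp add: ddlam_add algebra_simps)
  qed
  fix x assume "x \<in> UB"
  then obtain b where b: "x = smulH b eb" by (rule U_B'_E)
  have "lam * ddlam (\<phi>B b * vB) + \<phi>B b * vB * (lam * - log_deriv) =
      (lam * ddlam (\<phi>B b)) * vB + \<phi>B b * (lam * ddlam vB) - \<phi>B b * vB * (lam * log_deriv)"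
    by (simp add: ddlam_mult algebra_simps)
  also have "\<dots> = of_nat CARD('p) * (\<phi>B (lam * ddlam b + b * (lam * - log_deriv)) * vB)"
    unfolding ddlam_\<phi>B lam_ddlam_vB
    by (simp add: \<phi>B.hom_add \<phi>B.hom_mult \<phi>B.hom_minus algebra_simps)
  finally show "UB_conn (UB_frob x) =
      smulH (of_nat CARD('p)) (UB_frob (UB_conn x))"
    unfolding b frobenius_U_B'_eq connection_U_B'_eq by (simp add: H.scale_scale)
qed

subsection \<open>The reduction of the unit root part\<close>

lemma red_cq: "red cq = lam * (1 - lam) * log_deriv"
  by (simp add: cq_def red.hom_mult red.hom_minus red_lam red_Dq)

lemma M'_to_H_vec: "M'_to_H smulH G \<omega> (vec s) = smulH (red s) eb"
  by (simp add: M'_to_H_def vec_def e2bar_def red.hom_mult red_cq H.scale_right_diff_distrib H.scale_scale)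

text \<open>The fibres of \<open>red\<close> in the coordinate of \<open>vec\<close>; they are the
  classes modulo q - 1 and are thereby indexed by B'.\<close>

definition coset :: "'p B' \<Rightarrow> ('p S' \<times> 'p S') set" where
  "coset r = {vec s | s. red s = r}"

lemma coset_nonempty: "\<exists>s. vec s \<in> coset r"
  using red_surj[of r] by (auto simp: coset_def)

lemma vec_coset: "vec s \<in> coset r \<longleftrightarrow> red s = r"
  by (auto simp: coset_def)

lemma coset_inj: "coset r = coset r' \<longleftrightarrow> r = r'"
  using coset_nonempty[of r] vec_coset by metis

lemma red_class_vec: "red_class pair_scale UU (vec s) = coset (red s)"
proof -
  have "red_class pair_scale UU (vec s) = {vec t | t. \<exists>z. t - s = (qS - 1) * z}"
    unfolding red_class_def
    by (auto simp: vec_diff vec_scale elim!: UU_E) (metis vec_scale vec_simps(2))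
  then show ?thesis
    by (simp add: coset_def red_eq_iff)
qed

lemma red_module_UU: "red_module pair_scale UU = range coset"
proof -
  have "red_class pair_scale UU ` range vec = range (\<lambda>s. coset (red s))"
    by (simp add: image_image red_class_vec)
  then have "red_module pair_scale UU = range (\<lambda>s. coset (red s))"
    unfolding red_module_def by (simp only: UU_def[symmetric])
  moreover have "range (\<lambda>s. coset (red (s :: 'p S'))) = range coset"
    using red_surj by (metis (no_types, lifting) rangeI image_cong full_SetCompr_eq surjI image_image surj_def)
  ultimately show ?thesis by simp
qed

text \<open>The operations on classes are unions over representatives. Surjectivity of
  \<open>red\<close> makes the index set nonempty, so a constant family has its constant value as
  union.\<close>

lemma UN_coset: "(\<And>s. red s = r \<Longrightarrow> f (vec s) = A) \<Longrightarrow> (\<Union>x\<in>coset r. f x) = A"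
  using red_surj[of r] by (auto simp: coset_def)

lemma red_add_coset: "red_add pair_scale UU (coset r) (coset r') = coset (r + r')"
  unfolding red_add_def
  by (intro UN_coset) (simp add: vec_add red_class_vec red.hom_add)

lemma red_scale_coset: "red_scale pair_scale UU b (coset r) = coset (b * r)"
proof -
  have "(\<Union>x\<in>coset r. red_class pair_scale UU (pair_scale a x)) = coset (b * r)" if "red a = b" for a
    by (intro UN_coset) (simp add: vec_scale red_class_vec red.hom_mult that)
  then show ?thesis
    unfolding red_scale_def using red_surj[of b] by auto
qed

lemma red_frobenius_coset: "red_frobenius pair_scale UU \<phi>U (coset r) = coset (\<phi>B r * vB)"
  unfolding red_frobenius_def
  by (intro UN_coset) (simp add: \<phi>U_def red_class_vec red.hom_mult red_vs flip: frobenius_B'_red[OF frobenius])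

lemma red_connection_coset:
  "red_connection pair_scale UU \<rho>U (coset r) = coset (lam * ddlam r + r * (lam * - log_deriv))"
  unfolding red_connection_def
proof (rule UN_coset)
  fix s :: "'p S'" assume s: "red s = r"
  let ?t = "lam * d_q \<rho> s + \<rho> 1 s * gq"
  have "{y \<in> UU. pair_scale (qS - 1) y = \<rho>U 1 (vec s) - vec s} = {vec ?t}"
  proof (intro subset_antisym subsetI)
    fix y assume "y \<in> {y \<in> UU. pair_scale (qS - 1) y = \<rho>U 1 (vec s) - vec s}"
    then have y: "y \<in> UU" "pair_scale (qS - 1) y = pair_scale (qS - 1) (vec ?t)"
      by (simp_all only: mem_Collect_eq \<rho>U_1 add_diff_cancel_left')
    obtain t where t: "y = vec t" using y(1) by (rule UU_E)
    then have "(qS - 1) * t = (qS - 1) * ?t"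
      using y(2) by (simp only: vec_scale vec_inj)
    from lexp_mult_cancel[OF this qS_minus_1_neq_0] show "y \<in> {vec ?t}"
      by (simp add: t)
  next
    fix y assume "y \<in> {vec ?t}"
    then show "y \<in> {y \<in> UU. pair_scale (qS - 1) y = \<rho>U 1 (vec s) - vec s}"
      by (simp only: \<rho>U_1 add_diff_cancel_left') simp
  qed
  moreover have "red ?t = lam * ddlam r + r * (lam * - log_deriv)"
    by (simp add: red.hom_add red.hom_mult red_lam red_d_q red_\<rho>_1 red_gq s)
  ultimately show "(\<Union>y\<in>{y \<in> UU. pair_scale (qS - 1) y = \<rho>U 1 (vec s) - vec s}. red_class pair_scale UU y) =
      coset (lam * ddlam r + r * (lam * - log_deriv))"
    by (simp only: red_class_vec UN_singleton UN_insert UN_empty Un_empty_right)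
qed

definition iso :: "('p S' \<times> 'p S') set \<Rightarrow> 'h" where
  "iso C = smulH (THE r. C = coset r) eb"

lemma iso_coset: "iso (coset r) = smulH r eb"
  by (simp add: iso_def coset_inj)

lemma red_linear_iso_iso: "red_linear_iso pair_scale UU smulH UB iso"
  unfolding red_linear_iso_def red_module_UU
proof (intro conjI)
  show "bij_betw iso (range coset) UB"
    by (auto simp: bij_betw_def inj_on_def iso_coset U_B'_eq image_image)
qed (auto simp: iso_coset red_add_coset red_scale_coset H.scale_left_distrib H.scale_scale)

lemma red_MIC_iso_iso:
  "red_MIC_iso pair_scale UU \<phi>U \<rho>U smulH UB
    UB_frob UB_conn iso"
  unfolding red_MIC_iso_def red_module_UU
  using red_linear_iso_iso
  by (auto simp: iso_coset red_frobenius_coset red_connection_coset frobenius_U_B'_eq connection_U_B'_eq)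

text \<open>This ties the abstract isomorphism to the one induced by the given comparison of M' with
  the de Rham cohomology.\<close>

lemma iso_red_class: "x \<in> UU \<Longrightarrow> iso (red_class pair_scale UU x) = M'_to_H smulH G \<omega> x"
  by (auto simp: red_class_vec iso_coset M'_to_H_vec elim!: UU_E)

lemma nabla_q_UU: "x \<in> UU \<Longrightarrow> \<exists>y\<in>UU. nabla_q x = pair_scale (1 - lam) y"
  using nabla_q_vec vec_simps(2) by (auto elim!: UU_E)

end

theorem theorem4p1:
  fixes \<phi> :: "'p::prime_card S' \<Rightarrow> 'p S'"
    and \<rho> :: "int \<Rightarrow> 'p S' \<Rightarrow> 'p S'"
    and nabla_q :: "'p S' \<times> 'p S' \<Rightarrow> 'p S' \<times> 'p S'"
    and smulH :: "'p B' \<Rightarrow> 'h::ab_group_add \<Rightarrow> 'h"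
    and G :: "'h \<Rightarrow> 'h"
    and \<omega> :: 'h
  assumes "odd CARD('p)"
    and "is_frobenius \<phi>"
    and "is_Gamma_action \<rho>"
    and "is_q_connection_M' \<rho> nabla_q"
    and "is_legendre_deRham smulH G \<omega>"
  shows "\<exists>U' \<phi>U'.
    direct_factor pair_scale U' UNIV \<and> free_of_rank pair_scale 1 U'
    \<and> (\<forall>x\<in>U'. \<exists>y\<in>U'. nabla_q x = pair_scale (1 - lam) y)
    \<and> semilinear_endo \<phi> pair_scale U' \<phi>U' \<and> Modules.module.span pair_scale (\<phi>U' ` U') = U'
    \<and> (\<exists>\<rho>U'. associated_action \<rho> (1 - lam) pair_scale U' nabla_q \<rho>U'
        \<and> MF_object \<phi> \<rho> pair_scale U' \<phi>U' \<rho>U'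
        \<and> MIC_object (frobenius_B' \<phi>) smulH (U_B' smulH G \<omega>)
            (frobenius_U_B' \<phi> smulH G \<omega>) (connection_U_B' smulH G \<omega>)
        \<and> (\<exists>F. (\<forall>x\<in>U'. F (red_class pair_scale U' x) = M'_to_H smulH G \<omega> x)
            \<and> red_linear_iso pair_scale U' smulH (U_B' smulH G \<omega>) F
            \<and> red_MIC_iso pair_scale U' \<phi>U' \<rho>U' smulH (U_B' smulH G \<omega>)
                (frobenius_U_B' \<phi> smulH G \<omega>) (connection_U_B' smulH G \<omega>) F))"
proof -
  interpret q_legendre "TYPE('p)" \<rho> \<phi> nabla_q smulH G \<omega>
    by unfold_locales (fact assms)+
  show ?thesis
    using direct_factor_UU free_UU nabla_q_UU semilinear_\<phi>U span_\<phi>U associated_action_\<rho>U MF_object_UU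
      MIC_object_U_B' iso_red_class red_linear_iso_iso red_MIC_iso_iso
    by (intro exI[of _ UU] exI[of _ \<phi>U] exI[of _ \<rho>U] exI[of _ iso] conjI ballI) auto
qed

end
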